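(* Let the data $L_0,H_0,b,V,\Psi,m_0,\alpha,\gamma$ satisfy all the hypotheses listed in the context. Then there exists a time $T_0>0$ such that for any terminal time $T\le T_0$ there exists a $C^\infty$ solution $(u,m)$, with $m>0$, to $$ \begin{cases} -u_t-\Delta u+m^{\alpha}H_0\left(x,\frac{Du}{m^{\alpha}}\right)+b\cdot Du=V(x,m(x,t)),\\ m_t-\Delta m-\operatorname{div}\left(D_pH_0\left(x,\frac{Du}{m^{\alpha}}\right)m\right)-\operatorname{div}(bm)=0,\\ u(x,T)=\Psi(x),\quad m(x,0)=m_0(x), \end{cases} $$ on $\mathbb{T}^d\times[0,T]$.
   Context: $\mathbb{T}^d$ is the $d$-dimensional torus, and $T>0$ is the terminal time. $D$, $\Delta$, $\operatorname{div}$ act in $x$. The unknowns are $u:\mathbb{T}^d\times[0,T]\to\mathbb{R}$ and $m:\mathbb{T}^d\times[0,T]\to\mathbb{R}^+$. Given a Lagrangian $L_0$, the Hamiltonian is its Legendre transform $H_0(x,p)=\sup_{v\in\mathbb{R}^d}[-v\cdot p-L_0(x,v)]$. Hypotheses on the data: (1) $\Psi:\mathbb{T}^d\to\mathbb{R}$, $b:\mathbb{T}^d\times[0,T]\to\mathbb{R}^d$, $V:\mathbb{T}^d\times\mathbb{R}\to\mathbb{R}$ are $C^\infty$, globally bounded with bounded derivatives of all orders. (2) $m_0:\mathbb{T}^d\to\mathbb{R}$ is a $C^\infty$ probability density, $\int_{\mathbb{T}^d}m_0\,dx=1$, and there is $k_0>0$ with $m_0(x)\ge k_0$ for all $x$.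 (3) $L_0:\mathbb{T}^d\times\mathbb{R}^d\to\mathbb{R}$ is $C^\infty$ and $v\mapsto L_0(x,v)$ is strictly convex for every $x$. (4) $L_0(x,v)\ge0$ for all $(x,v)$. (5) There are conjugate powers $\gamma,\gamma'>1$, $\frac1\gamma+\frac1{\gamma'}=1$, and constants $C_i,c_i>0$, $i=1,2$, with $C_1\frac{|v|^{\gamma'}}{\gamma'}-c_1\le L_0(x,v)\le C_2\frac{|v|^{\gamma'}}{\gamma'}+c_2$ for all $x,v$. (6) There are $c,C>0$ with $p\cdot D_pH_0(x,p)-H_0(x,p)\ge c|p|^\gamma-C$. (7) There is $C$ with $|D_pH_0(x,p)|\le C|p|^{\gamma-1}+C$. (8) $0\le\alpha<\frac{2}{d-2}$. (9) $\gamma<2$. (10) $H_0$ is $C^\infty$ and $p\mapsto H_0(x,p)$ is strictly convex for every $x$, that is, $D^2_{pp}H_0(x,p)>0$ for all $(x,p)\in\mathbb{T}^d\times\mathbb{R}^d$. (11) For $p\ne0$: $D_pH_0(x,p)\cdot p-H_0(x,p)>\frac{\alpha}{4}\,p^t\cdot D^2_{pp}H_0(x,p)\cdot p$. (12) $V$ is strictly increasing in its second variable. *)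

theory Defs
  imports "HOL-Analysis.Analysis"
begin

text \<open>
  Functions on the torus \<open>\<real>\<^sup>d / \<int>\<^sup>d\<close> are represented by \<open>\<int>\<^sup>d\<close>-periodic functions
  on \<open>\<real>\<^sup>d\<close>, with \<open>d = CARD('n)\<close>; integrals over the torus are integrals over the unit cube.
\<close>

definition torus_periodic :: "((real ^ 'n) \<Rightarrow> 'b) \<Rightarrow> bool" where
  "torus_periodic f \<longleftrightarrow> (\<forall>x k. (\<forall>i. k $ i \<in> \<int>) \<longrightarrow> f (x + k) = f x)"

text \<open>
  Iterated directional derivatives relative to \<open>S\<close>. It is only used for sets \<open>S\<close> that are convex
  with nonempty interior (the whole space, or a strip \<open>UNIV \<times> {0..T}\<close> with \<open>T > 0\<close>),
  where the derivative within \<open>S\<close> is unique. At the two boundary times of the strip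
  the derivatives are one-sided, so that smoothness is up to and including the boundary.
\<close>

fun iter_deriv ::
  "'a::real_normed_vector set \<Rightarrow> 'a list \<Rightarrow> ('a \<Rightarrow> 'b::real_normed_vector) \<Rightarrow> 'a \<Rightarrow> 'b" where
  "iter_deriv S [] f = f"
| "iter_deriv S (v # vs) f = (\<lambda>x. frechet_derivative (iter_deriv S vs f) (at x within S) v)"

definition smooth_on ::
  "'a::euclidean_space set \<Rightarrow> ('a \<Rightarrow> 'b::euclidean_space) \<Rightarrow> bool" where
  "smooth_on S f \<longleftrightarrow> (\<forall>vs. iter_deriv S vs f differentiable_on S)"

text \<open>The case of the empty list of directions says that the function itself is bounded.\<close>

definition bounded_derivs_on ::
  "'a::euclidean_space set \<Rightarrow> ('a \<Rightarrow> 'b::euclidean_space) \<Rightarrow> bool" where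
  "bounded_derivs_on S f \<longleftrightarrow> (\<forall>vs. bounded (iter_deriv S vs f ` S))"

definition grad :: "((real ^ 'n) \<Rightarrow> real) \<Rightarrow> real ^ 'n \<Rightarrow> real ^ 'n" where
  "grad f x = (THE D. GDERIV f x :> D)"

definition hessian :: "((real ^ 'n) \<Rightarrow> real) \<Rightarrow> real ^ 'n \<Rightarrow> real ^ 'n ^ 'n" where
  "hessian f x = jacobian (grad f) (at x)"

definition divergence :: "((real ^ 'n) \<Rightarrow> real ^ 'n) \<Rightarrow> real ^ 'n \<Rightarrow> real" where
  "divergence F x = trace (jacobian F (at x))"

definition laplacian :: "((real ^ 'n) \<Rightarrow> real) \<Rightarrow> real ^ 'n \<Rightarrow> real" where
  "laplacian f x = divergence (grad f) x"

definition strictly_convex :: "('a::real_vector \<Rightarrow> real) \<Rightarrow> bool" where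
  "strictly_convex f \<longleftrightarrow>
     (\<forall>v w s. v \<noteq> w \<longrightarrow> 0 < s \<longrightarrow> s < 1 \<longrightarrow>
        f ((1 - s) *\<^sub>R v + s *\<^sub>R w) < (1 - s) * f v + s * f w)"

text \<open>
  The real-valued supremum is the genuine one whenever \<open>L x\<close> grows superlinearly, because the set
  is then bounded above; otherwise its value is unspecified.
\<close>

definition legendre :: "('x \<Rightarrow> real ^ 'n \<Rightarrow> real) \<Rightarrow> 'x \<Rightarrow> real ^ 'n \<Rightarrow> real" where
  "legendre L x p = (SUP v. - (v \<bullet> p) - L x v)"

end

theory Submission
  imports Defs "HOL-Probability.Probability"
begin

text \<open>
  Write \<open>w = Du\<close>. In divergence form the system is
  \<open>- u\<^sub>t - \<Delta>u = N1 (x, t, m, w)\<close> and \<open>m\<^sub>t - \<Delta>m = div (N2 (x, t, m, w))\<close>, with nonlinearities that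
  are smooth as long as \<open>m > 0\<close>. Duhamel's formula for \<open>m\<close> and the gradient of Duhamel's formula
  for \<open>u\<close> turn it into a fixed-point equation \<open>z = g + A (N z)\<close> for \<open>z = (m, w)\<close>. Here \<open>A\<close>
  integrates one space derivative of the heat semigroup over time, forwards for \<open>m\<close> and backwards
  for \<open>w\<close>. That derivative costs a factor \<open>\<tau> powr (-1/2)\<close> at elapsed time \<open>\<tau>\<close>, which is
  integrable, so the norm of \<open>A\<close> on continuous periodic functions is a multiple of \<open>sqrt T\<close>
  (\<open>system_operator_invariant\<close>). No derivative is lost, and for small \<open>T\<close> the map is a contraction of a
  ball around \<open>g\<close> in the supremum norm on which \<open>m\<close> stays away from zero
  (\<open>nonlinear_fixed_point\<close>). The opposite time directions of the two equations do not matter for this.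

  Smoothness in \<open>x\<close> comes without a further restriction on \<open>T\<close>. Since \<open>A\<close> commutes with
  translations, the increments \<open>z (x + h) - z x\<close> solve a contractive equation as well; this gives
  differentiability (\<open>xderiv_fixed_point\<close>). The derivative solves the linearised equation, whose
  contraction constant is the same, and so do all higher derivatives, up to source terms of lower
  order (\<open>xreg_linear_fixed_point\<close>, \<open>xreg_nonlinear_fixed_point\<close>). This is why one time \<open>T0\<close> serves
  for all orders of differentiability.

  A fixed point that is smooth in \<open>x\<close> solves the differential equations
  (\<open>system_of_fixed_point\<close>): Gaussian integration by parts puts the derivative in \<open>A\<close> back on the
  source. The equations then express the time derivatives by \<open>x\<close>-derivatives, and induction
  gives smoothness in all variables up to the boundary times (\<open>system_bootstrap\<close>).

  The heat semigroup is realised as \<open>P\<^sub>\<tau> f x = E f (x + sqrt (2 * \<tau>) Y)\<close> with a standard Gaussian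
  vector \<open>Y\<close>, acting on periodic functions on \<open>\<real>\<^sup>d\<close>; its derivative bound and its time derivative both
  follow from Stein's identity \<open>E (f Y Y\<^sub>i) = E (\<partial>\<^sub>i f Y)\<close>.
\<close>

section \<open>Classes of functions closed under differentiation\<close>

text \<open>
  One notion has to cover three kinds of smoothness: smoothness of the data in all variables,
  smoothness in \<open>x\<close> alone on the strip, and smoothness in \<open>x\<close> of functions that are already
  \<open>k\<close> times differentiable in all variables. All three arise by iterating \<open>deriv_class\<close>, with
  \<open>V\<close> the subspace of the admissible directions and \<open>P\<close> the class to be refined. The derivative
  \<open>f' p\<close> is only meaningful on \<open>V\<close>.
\<close>

definition deriv_along ::
  "'p::real_normed_vector set \<Rightarrow> 'p set \<Rightarrow> ('p \<Rightarrow> 'b::real_normed_vector) \<Rightarrow> ('p \<Rightarrow> 'p \<Rightarrow> 'b) \<Rightarrow> bool" where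
  "deriv_along V S f f' \<longleftrightarrow> (\<forall>p\<in>S. (f has_derivative f' p) (at p within {q\<in>S. q - p \<in> V}))"

definition deriv_class ::
  "'p::real_normed_vector set \<Rightarrow> 'p set \<Rightarrow> ('p \<Rightarrow> real) set \<Rightarrow> ('p \<Rightarrow> real) set" where
  "deriv_class V S P = {f\<in>P. \<exists>f'. deriv_along V S f f' \<and> (\<forall>v\<in>V. (\<lambda>p. f' p v) \<in> P)}"

definition smooth_class ::
  "'p::real_normed_vector set \<Rightarrow> 'p set \<Rightarrow> ('p \<Rightarrow> real) set \<Rightarrow> ('p \<Rightarrow> real) set" where
  "smooth_class V S P = (\<Inter>k. (deriv_class V S ^^ k) P)"

definition cont_class :: "'p::topological_space set \<Rightarrow> ('p \<Rightarrow> real) set" where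
  "cont_class S = {f. continuous_on S f}"

abbreviation Cinf :: "'p::real_normed_vector set \<Rightarrow> ('p \<Rightarrow> real) set" where
  "Cinf S \<equiv> smooth_class UNIV S (cont_class S)"

text \<open>
  The classes below are built by iterating \<open>deriv_class\<close>. These two closure properties are what
  survives each iteration, and together they let nonlinear expressions be handled without any formula
  for higher derivatives of a composition.
\<close>

definition function_algebra :: "'p set \<Rightarrow> ('p \<Rightarrow> real) set \<Rightarrow> bool" where
  "function_algebra S P \<longleftrightarrow>
     (\<forall>f g. f \<in> P \<longrightarrow> (\<forall>p\<in>S. f p = g p) \<longrightarrow> g \<in> P) \<and> (\<forall>c. (\<lambda>_. c) \<in> P) \<and>
     (\<forall>f\<in>P. \<forall>g\<in>P. (\<lambda>p. f p + g p) \<in> P) \<and> (\<forall>f\<in>P. \<forall>g\<in>P. (\<lambda>p. f p * g p) \<in> P)"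

definition comp_closed ::
  "'p set \<Rightarrow> 'q::euclidean_space set \<Rightarrow> ('p \<Rightarrow> real) set \<Rightarrow> bool" where
  "comp_closed S Q P \<longleftrightarrow> (\<forall>F\<in>Cinf Q. \<forall>G. (\<forall>p\<in>S. G p \<in> Q) \<longrightarrow>
     (\<forall>b\<in>Basis. (\<lambda>p. G p \<bullet> b) \<in> P) \<longrightarrow> (\<lambda>p. F (G p)) \<in> P)"

text \<open>The condition under which derivatives along \<open>V\<close> are unique. It holds on the closed strip,
  where only one-sided time increments are available at the two boundary times.\<close>

definition thick :: "'p::real_normed_vector set \<Rightarrow> 'p set \<Rightarrow> bool" where
  "thick V S \<longleftrightarrow> (\<forall>p\<in>S. \<forall>v\<in>V. \<forall>e>0. \<exists>d. 0 < \<bar>d\<bar> \<and> \<bar>d\<bar> < e \<and> p + d *\<^sub>R v \<in> S \<and> d *\<^sub>R v \<in> V)"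

lemma falgD:
  assumes "function_algebra S P"
  shows falg_cong: "\<And>f g. f \<in> P \<Longrightarrow> (\<And>p. p \<in> S \<Longrightarrow> f p = g p) \<Longrightarrow> g \<in> P"
    and falg_const: "\<And>c. (\<lambda>_. c) \<in> P"
    and falg_add: "\<And>f g. f \<in> P \<Longrightarrow> g \<in> P \<Longrightarrow> (\<lambda>p. f p + g p) \<in> P"
    and falg_mult: "\<And>f g. f \<in> P \<Longrightarrow> g \<in> P \<Longrightarrow> (\<lambda>p. f p * g p) \<in> P"
  using assms unfolding function_algebra_def by blast+

lemma falg_sum:
  assumes "function_algebra S P" "finite I" "\<And>i. i \<in> I \<Longrightarrow> f i \<in> P"
  shows "(\<lambda>p. \<Sum>i\<in>I. f i p) \<in> P"
  using assms(2,3)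
proof (induction I rule: finite_induct)
  case empty then show ?case using falg_const[OF assms(1)] by simp
next
  case (insert i I)
  then show ?case using falg_add[OF assms(1), of "f i" "\<lambda>p. \<Sum>i\<in>I. f i p"] by simp
qed

lemma falg_uminus:
  assumes "function_algebra S P" "f \<in> P" shows "(\<lambda>p. - f p) \<in> P"
  using falg_mult[OF assms(1) falg_const[OF assms(1), of "-1"] assms(2)] by simp

lemma falg_diff:
  assumes "function_algebra S P" "f \<in> P" "g \<in> P" shows "(\<lambda>p. f p - g p) \<in> P"
  using falg_add[OF assms(1,2) falg_uminus[OF assms(1,3)]] by simp

lemma deriv_classI:
  assumes "f \<in> P" "deriv_along V S f f'" "\<And>v. v \<in> V \<Longrightarrow> (\<lambda>p. f' p v) \<in> P"
  shows "f \<in> deriv_class V S P"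
  unfolding deriv_class_def using assms by auto

lemma deriv_classD:
  "f \<in> deriv_class V S P \<Longrightarrow> \<exists>f'. deriv_along V S f f' \<and> (\<forall>v\<in>V. (\<lambda>p. f' p v) \<in> P)"
  unfolding deriv_class_def by blast

lemma deriv_class_subset: "deriv_class V S P \<subseteq> P"
  unfolding deriv_class_def by auto

lemma deriv_along_unique:
  assumes "thick V S" "deriv_along V S f f'" "deriv_along V S f f''" "p \<in> S" "v \<in> V"
  shows "f' p v = f'' p v"
proof -
  define A where "A = {d. p + d *\<^sub>R v \<in> S \<and> d *\<^sub>R v \<in> V}"
  have img: "(\<lambda>d. p + d *\<^sub>R v) ` A \<subseteq> {q\<in>S. q - p \<in> V}" by (auto simp: A_def)
  have 1: "((\<lambda>d. p + d *\<^sub>R v) has_derivative (\<lambda>d. d *\<^sub>R v)) (at 0 within A)"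
    by (auto intro!: derivative_eq_intros)
  have vd: "((\<lambda>d. f (p + d *\<^sub>R v)) has_vector_derivative g p v) (at 0 within A)"
    if "deriv_along V S f g" for g
  proof -
    have d: "(f has_derivative g p) (at p within {q\<in>S. q - p \<in> V})"
      using that assms(4) by (simp add: deriv_along_def)
    have "((\<lambda>d. f (p + d *\<^sub>R v)) has_derivative (\<lambda>d. g p (d *\<^sub>R v))) (at 0 within A)"
      by (rule has_derivative_in_compose[OF 1]) (use has_derivative_subset[OF d img] in simp)
    then show ?thesis
      using linear_cmul[OF has_derivative_linear[OF d]] by (simp add: has_vector_derivative_def)
  qed
  have "(0::real) islimpt A"
    unfolding islimpt_approachable
  proof (intro allI impI)
    fix e :: real assume "e > 0"
    then obtain d where "0 < \<bar>d\<bar>" "\<bar>d\<bar> < e" "p + d *\<^sub>R v \<in> S" "d *\<^sub>R v \<in> V"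
      using assms(1,4,5) unfolding thick_def by blast
    then show "\<exists>x'\<in>A. x' \<noteq> 0 \<and> dist x' 0 < e" by (intro bexI[of _ d]) (auto simp: A_def)
  qed
  then have "at (0::real) within A \<noteq> bot" by (simp add: trivial_limit_within)
  from vector_derivative_unique_within[OF this vd[OF assms(2)] vd[OF assms(3)]] show ?thesis .
qed

lemma falg_cont_class: "function_algebra S (cont_class S)"
proof -
  have "continuous_on S g" if "continuous_on S f" "\<forall>p\<in>S. f p = g p" for f g :: "'a \<Rightarrow> real"
    using that continuous_on_cong[of S S f g] by simp
  then show ?thesis
    unfolding function_algebra_def cont_class_def by (auto intro!: continuous_intros)
qed

lemma has_derivative_cong_within:
  assumes "(f has_derivative D) (at p within A)" "p \<in> A" "\<And>q. q \<in> A \<Longrightarrow> f q = g q"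
  shows "(g has_derivative D) (at p within A)"
  using has_derivative_transform[OF assms(2) _ assms(1), of g] assms(3) by simp

lemma falg_deriv_class:
  assumes P: "function_algebra S P" and V: "0 \<in> V"
  shows "function_algebra S (deriv_class V S P)"
  unfolding function_algebra_def
proof (intro conjI allI ballI impI)
  fix f g assume f: "f \<in> deriv_class V S P" and eq: "\<forall>p\<in>S. f p = g p"
  then obtain f' where f': "deriv_along V S f f'" "\<And>v. v \<in> V \<Longrightarrow> (\<lambda>p. f' p v) \<in> P"
    unfolding deriv_class_def by blast
  have "deriv_along V S g f'"
    unfolding deriv_along_def
  proof
    fix p assume p: "p \<in> S"
    show "(g has_derivative f' p) (at p within {q \<in> S. q - p \<in> V})"
      by (rule has_derivative_cong_within[where f=f])
        (use f'(1) p eq V in \<open>auto simp: deriv_along_def\<close>)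
  qed
  then show "g \<in> deriv_class V S P"
    using f f'(2) falg_cong[OF P, of f g] eq unfolding deriv_class_def by blast
next
  fix c
  show "(\<lambda>_. c) \<in> deriv_class V S P"
    unfolding deriv_class_def deriv_along_def using falg_const[OF P]
    by (auto intro!: exI[of _ "\<lambda>_ _. 0"])
next
  fix f g assume f: "f \<in> deriv_class V S P" and g: "g \<in> deriv_class V S P"
  obtain f' where f': "deriv_along V S f f'" "\<And>v. v \<in> V \<Longrightarrow> (\<lambda>p. f' p v) \<in> P" "f \<in> P"
    using f unfolding deriv_class_def by blast
  obtain g' where g': "deriv_along V S g g'" "\<And>v. v \<in> V \<Longrightarrow> (\<lambda>p. g' p v) \<in> P" "g \<in> P"
    using g unfolding deriv_class_def by blast
  have "deriv_along V S (\<lambda>p. f p + g p) (\<lambda>p v. f' p v + g' p v)"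
    using f'(1) g'(1) unfolding deriv_along_def by (auto intro!: derivative_intros)
  then show "(\<lambda>p. f p + g p) \<in> deriv_class V S P"
    unfolding deriv_class_def using f' g' falg_add[OF P]
    by (auto intro!: exI[of _ "\<lambda>p v. f' p v + g' p v"])
  have "deriv_along V S (\<lambda>p. f p * g p) (\<lambda>p v. f p * g' p v + f' p v * g p)"
    using f'(1) g'(1) unfolding deriv_along_def by (auto intro!: has_derivative_mult)
  then show "(\<lambda>p. f p * g p) \<in> deriv_class V S P"
    unfolding deriv_class_def using f' g' falg_add[OF P] falg_mult[OF P]
    by (auto intro!: exI[of _ "\<lambda>p v. f p * g' p v + f' p v * g p"])
qed

lemma falg_funpow:
  assumes "function_algebra S P" "0 \<in> V"
  shows "function_algebra S ((deriv_class V S ^^ k) P)"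
  by (induction k) (use assms falg_deriv_class in auto)

lemma falg_smooth_class:
  assumes "function_algebra S P" "0 \<in> V"
  shows "function_algebra S (smooth_class V S P)"
proof -
  note A = falg_funpow[OF assms]
  show ?thesis
    unfolding function_algebra_def smooth_class_def
    by (auto intro: falg_cong[OF A] falg_const[OF A] falg_add[OF A] falg_mult[OF A])
qed

lemma smooth_class_subset: "smooth_class V S P \<subseteq> P"
  unfolding smooth_class_def using funpow_0[of "deriv_class V S" P] by blast

text \<open>
  Smoothness without counting derivatives: it is enough to exhibit a family that contains a derivative
  of each of its members.
\<close>

lemma smooth_class_coinduct:
  assumes "f \<in> F" "F \<subseteq> P"
    and "\<And>g. g \<in> F \<Longrightarrow> \<exists>g'. deriv_along V S g g' \<and> (\<forall>v\<in>V. (\<lambda>p. g' p v) \<in> F)"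
  shows "f \<in> smooth_class V S P"
proof -
  have "F \<subseteq> (deriv_class V S ^^ k) P" for k
  proof (induction k)
    case (Suc k)
    then show ?case using assms(3) by (fastforce simp: deriv_class_def)
  qed (use assms in simp)
  then show ?thesis using assms(1) unfolding smooth_class_def by blast
qed

text \<open>
  Membership in each \<open>(deriv_class V S ^^ k) P\<close> provides a derivative that may depend on \<open>k\<close>;
  uniqueness identifies them, so that one derivative has all the regularity.
\<close>

lemma smooth_class_derivative:
  assumes th: "thick V S" and P: "function_algebra S P" "0 \<in> V" and f: "f \<in> smooth_class V S P"
  obtains f' where "deriv_along V S f f'" "\<And>v. v \<in> V \<Longrightarrow> (\<lambda>p. f' p v) \<in> smooth_class V S P"
proof -
  have "\<forall>k. \<exists>f'. deriv_along V S f f' \<and> (\<forall>v\<in>V. (\<lambda>p. f' p v) \<in> (deriv_class V S ^^ k) P)"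
  proof
    fix k
    have "f \<in> (deriv_class V S ^^ Suc k) P" using f unfolding smooth_class_def by blast
    then show "\<exists>f'. deriv_along V S f f' \<and> (\<forall>v\<in>V. (\<lambda>p. f' p v) \<in> (deriv_class V S ^^ k) P)"
      by (auto simp: deriv_class_def)
  qed
  then obtain D where D: "\<And>k. deriv_along V S f (D k)"
      "\<And>k v. v \<in> V \<Longrightarrow> (\<lambda>p. D k p v) \<in> (deriv_class V S ^^ k) P" by metis
  have "(\<lambda>p. D 0 p v) \<in> smooth_class V S P" if v: "v \<in> V" for v
    unfolding smooth_class_def
  proof
    fix k
    show "(\<lambda>p. D 0 p v) \<in> (deriv_class V S ^^ k) P"
      by (rule falg_cong[OF falg_funpow[OF P] D(2)[OF v]])
        (rule deriv_along_unique[OF th D(1) D(1) _ v])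
  qed
  with D(1) that show ?thesis by blast
qed

lemma smooth_class_has_deriv:
  assumes "thick V S" "function_algebra S P" "0 \<in> V" "f \<in> smooth_class V S P"
    "deriv_along V S f f'" "v \<in> V"
  shows "(\<lambda>p. f' p v) \<in> smooth_class V S P"
proof -
  obtain D where D: "deriv_along V S f D" "\<And>v. v \<in> V \<Longrightarrow> (\<lambda>p. D p v) \<in> smooth_class V S P"
    using smooth_class_derivative[OF assms(1-4)] by blast
  show ?thesis
    by (rule falg_cong[OF falg_smooth_class[OF assms(2,3)] D(2)[OF assms(6)]])
      (rule deriv_along_unique[OF assms(1) D(1) assms(5) _ assms(6)])
qed

lemma smooth_class_step:
  assumes "deriv_along V S f f'" "\<And>v. v \<in> V \<Longrightarrow> (\<lambda>p. f' p v) \<in> smooth_class V S P" "f \<in> P"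
  shows "f \<in> smooth_class V S P"
proof -
  have "f \<in> (deriv_class V S ^^ k) P" for k
  proof (induction k)
    case (Suc k)
    moreover have "(\<lambda>p. f' p v) \<in> (deriv_class V S ^^ k) P" if "v \<in> V" for v
      using assms(2)[OF that] by (simp add: smooth_class_def)
    ultimately have "f \<in> deriv_class V S ((deriv_class V S ^^ k) P)"
      unfolding deriv_class_def mem_Collect_eq
      by (intro conjI exI[of _ f'] ballI assms(1))
    then show ?case by simp
  qed (use assms in simp)
  then show ?thesis unfolding smooth_class_def by blast
qed

lemma deriv_along_componentwise:
  fixes G :: "'p::real_normed_vector \<Rightarrow> 'q::euclidean_space"
  assumes "\<And>b. b \<in> Basis \<Longrightarrow> deriv_along V S (\<lambda>p. G p \<bullet> b) (g b)"
  shows "deriv_along V S G (\<lambda>p v. \<Sum>b\<in>Basis. g b p v *\<^sub>R b)"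
  unfolding deriv_along_def
proof
  fix p assume p: "p \<in> S"
  show "(G has_derivative (\<lambda>v. \<Sum>b\<in>Basis. g b p v *\<^sub>R b)) (at p within {q \<in> S. q - p \<in> V})"
    by (subst has_derivative_componentwise_within)
      (use assms p in \<open>auto simp: inner_sum_left inner_Basis if_distrib sum.If_cases deriv_along_def cong: if_cong\<close>)
qed

lemma deriv_along_chain:
  assumes F: "deriv_along UNIV Q F F'" and G: "deriv_along V S G G'"
    and sub: "\<And>p. p \<in> S \<Longrightarrow> G p \<in> Q"
  shows "deriv_along V S (\<lambda>p. F (G p)) (\<lambda>p v. F' (G p) (G' p v))"
  unfolding deriv_along_def
proof
  fix p assume p: "p \<in> S"
  have "(G has_derivative G' p) (at p within {q \<in> S. q - p \<in> V})"
    using G p by (simp add: deriv_along_def)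
  moreover have "(F has_derivative F' (G p)) (at (G p) within G ` {q \<in> S. q - p \<in> V})"
    by (rule has_derivative_subset[where s=Q]) (use F p sub in \<open>auto simp: deriv_along_def\<close>)
  ultimately show "((\<lambda>p. F (G p)) has_derivative (\<lambda>v. F' (G p) (G' p v))) (at p within {q \<in> S. q - p \<in> V})"
    by (rule has_derivative_in_compose)
qed

lemma comp_closedD:
  assumes "comp_closed S Q P" "F \<in> Cinf Q" "\<And>p. p \<in> S \<Longrightarrow> G p \<in> Q"
    "\<And>b. b \<in> Basis \<Longrightarrow> (\<lambda>p. G p \<bullet> b) \<in> P"
  shows "(\<lambda>p. F (G p)) \<in> P"
  using assms unfolding comp_closed_def by blast

lemma comp_closed_cont_class:
  fixes S :: "'a::t2_space set" and Q :: "'b::euclidean_space set"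
  shows "comp_closed S Q (cont_class S)"
  unfolding comp_closed_def
proof (intro ballI allI impI)
  fix F and G :: "'a \<Rightarrow> 'b"
  assume F: "F \<in> Cinf Q" and G: "\<forall>p\<in>S. G p \<in> Q" "\<forall>b\<in>Basis. (\<lambda>p. G p \<bullet> b) \<in> cont_class S"
  have "continuous_on S G"
    using G(2) by (subst continuous_on_componentwise) (simp add: cont_class_def)
  moreover have "continuous_on Q F" using F smooth_class_subset by (force simp: cont_class_def)
  ultimately show "(\<lambda>p. F (G p)) \<in> cont_class S"
    using G(1) by (auto simp: cont_class_def intro: continuous_on_compose2)
qed

text \<open>
  By the chain rule the derivative of \<open>F (G p)\<close> is a sum of products of derivatives of components of \<open>G\<close>
  with functions of the form \<open>F' (G p) b\<close>, and the latter are again compositions with a smooth function.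
\<close>

lemma comp_closed_deriv_class:
  fixes Q :: "'q::euclidean_space set"
  assumes P: "function_algebra S P" and V: "0 \<in> V" and Q: "thick UNIV Q" and cl: "comp_closed S Q P"
  shows "comp_closed S Q (deriv_class V S P)"
  unfolding comp_closed_def
proof (intro ballI allI impI)
  fix F and G :: "'a \<Rightarrow> 'q"
  assume F: "F \<in> Cinf Q" and G: "\<forall>p\<in>S. G p \<in> Q" "\<forall>b\<in>Basis. (\<lambda>p. G p \<bullet> b) \<in> deriv_class V S P"
  obtain F' where F': "deriv_along UNIV Q F F'" "\<And>v. (\<lambda>p. F' p v) \<in> Cinf Q"
    using smooth_class_derivative[OF Q falg_cont_class _ F] by auto
  from G(2) obtain g where g: "\<And>b. b \<in> Basis \<Longrightarrow> deriv_along V S (\<lambda>p. G p \<bullet> b) (g b)"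
    "\<And>b v. b \<in> Basis \<Longrightarrow> v \<in> V \<Longrightarrow> (\<lambda>p. g b p v) \<in> P"
    unfolding deriv_class_def mem_Collect_eq by metis
  have GP: "\<forall>b\<in>Basis. (\<lambda>p. G p \<bullet> b) \<in> P" using G(2) unfolding deriv_class_def by blast
  have d: "deriv_along V S (\<lambda>p. F (G p)) (\<lambda>p v. F' (G p) (\<Sum>b\<in>Basis. g b p v *\<^sub>R b))"
    using deriv_along_chain[OF F'(1) deriv_along_componentwise[OF g(1)]] G(1) by simp
  have "(\<lambda>p. F' (G p) (\<Sum>b\<in>Basis. g b p v *\<^sub>R b)) \<in> P" if v: "v \<in> V" for v
  proof (rule falg_cong[OF P])
    show "(\<lambda>p. \<Sum>b\<in>Basis. g b p v * F' (G p) b) \<in> P"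
    proof (intro falg_sum[OF P] falg_mult[OF P])
      show "(\<lambda>p. F' (G p) b) \<in> P" for b
        by (rule comp_closedD[OF cl F'(2)]) (use G(1) GP in auto)
    qed (use g v in auto)
  next
    fix p assume "p \<in> S"
    then have "linear (F' (G p))"
      using F'(1) G(1) has_derivative_linear unfolding deriv_along_def by blast
    then show "(\<Sum>b\<in>Basis. g b p v * F' (G p) b) = F' (G p) (\<Sum>b\<in>Basis. g b p v *\<^sub>R b)"
      by (simp add: linear_sum linear_cmul)
  qed
  moreover have "(\<lambda>p. F (G p)) \<in> P"
    by (rule comp_closedD[OF cl F]) (use G(1) GP in auto)
  ultimately show "(\<lambda>p. F (G p)) \<in> deriv_class V S P"
    unfolding deriv_class_def mem_Collect_eq
    by (intro conjI exI[of _ "\<lambda>p v. F' (G p) (\<Sum>b\<in>Basis. g b p v *\<^sub>R b)"] ballI d)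
qed

lemma comp_closed_funpow:
  assumes "function_algebra S P" "0 \<in> V" "thick UNIV Q" "comp_closed S Q P"
  shows "comp_closed S Q ((deriv_class V S ^^ k) P)"
  by (induction k) (use assms comp_closed_deriv_class[OF falg_funpow] in auto)

lemma comp_closed_smooth_class:
  assumes "function_algebra S P" "0 \<in> V" "thick UNIV Q" "comp_closed S Q P"
  shows "comp_closed S Q (smooth_class V S P)"
  unfolding comp_closed_def
proof (intro ballI allI impI)
  fix F and G :: "'a \<Rightarrow> 'b"
  assume F: "F \<in> Cinf Q" and G: "\<forall>p\<in>S. G p \<in> Q" "\<forall>b\<in>Basis. (\<lambda>p. G p \<bullet> b) \<in> smooth_class V S P"
  have "(\<lambda>p. F (G p)) \<in> (deriv_class V S ^^ k) P" for k
  proof -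
    have "\<forall>b\<in>Basis. (\<lambda>p. G p \<bullet> b) \<in> (deriv_class V S ^^ k) P"
      using G(2) unfolding smooth_class_def by blast
    then show ?thesis
      by (intro comp_closedD[OF comp_closed_funpow[OF assms, of k] F]) (use G(1) in auto)
  qed
  then show "(\<lambda>p. F (G p)) \<in> smooth_class V S P" unfolding smooth_class_def by blast
qed

lemmas falg_Cinf = falg_smooth_class[OF falg_cont_class UNIV_I]

lemma comp_closed_Cinf: "thick UNIV Q \<Longrightarrow> comp_closed S Q (Cinf S)"
  by (rule comp_closed_smooth_class[OF falg_cont_class UNIV_I _ comp_closed_cont_class])

lemma smooth_class_bounded_linear:
  assumes P: "function_algebra S P" "0 \<in> V" and f: "bounded_linear f" "f \<in> P"
  shows "f \<in> smooth_class V S P"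
proof (rule smooth_class_step[OF _ _ f(2)])
  show "deriv_along V S f (\<lambda>_. f)"
    using bounded_linear.has_derivative[OF f(1) has_derivative_ident] by (simp add: deriv_along_def)
  show "(\<lambda>p. f v) \<in> smooth_class V S P" for v using falg_const[OF falg_smooth_class[OF P]] .
qed

lemma Cinf_bounded_linear: "bounded_linear f \<Longrightarrow> f \<in> Cinf S"
  by (rule smooth_class_bounded_linear[OF falg_cont_class UNIV_I])
    (simp_all add: cont_class_def linear_continuous_on)

lemma thick_open: "open S \<Longrightarrow> thick UNIV S"
  unfolding thick_def
proof (intro ballI allI impI)
  fix p v :: 'a and e :: real assume p: "p \<in> S" and e: "e > 0" and S: "open S"
  obtain r where r: "r > 0" "ball p r \<subseteq> S" using S p openE by blast
  define d where "d = min (e/2) (r / (2 * (norm v + 1)))"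
  have d: "0 < d" "d < e" using e r by (auto simp: d_def add_nonneg_pos)
  have "d * norm v \<le> r / (2 * (norm v + 1)) * norm v"
    by (intro mult_right_mono) (auto simp: d_def)
  also have "\<dots> < r"
  proof -
    have "norm v < 2 * (norm v + 1)" by (smt (verit) norm_ge_zero)
    then show ?thesis using r by (simp add: divide_less_eq mult.commute add_nonneg_pos)
  qed
  finally have "p + d *\<^sub>R v \<in> S" using r d by (auto simp: dist_norm)
  then show "\<exists>d. 0 < \<bar>d\<bar> \<and> \<bar>d\<bar> < e \<and> p + d *\<^sub>R v \<in> S \<and> d *\<^sub>R v \<in> UNIV"
    using d by (intro exI[of _ d]) auto
qed

section \<open>The standard Gaussian measure\<close>

text \<open>
  Defined as an image of a product measure, so that Fubini's theorem reduces integration by parts to a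
  single coordinate.
\<close>

definition gauss :: "(real ^ 'n) measure" where
  "gauss = distr (Pi\<^sub>M UNIV (\<lambda>_. density lborel std_normal_density)) borel (\<lambda>f. \<chi> i. f i)"

abbreviation normal1 :: "real measure" where
  "normal1 \<equiv> density lborel std_normal_density"

lemma measurable_vec_lambda:
  "(\<lambda>f. \<chi> i. f i) \<in> borel_measurable (Pi\<^sub>M UNIV (\<lambda>_::'n::finite. normal1))"
  by (subst borel_measurable_euclidean_space) (auto simp: Basis_vec_def inner_axis)

interpretation normal1: prob_space normal1
  using prob_space_normal_density[of 1 0] by simp

interpretation normal_product: product_prob_space "\<lambda>_. normal1" UNIV
  by (simp add: product_prob_space_def product_prob_space_axioms_def product_sigma_finite_def
      normal1.prob_space_axioms normal1.sigma_finite_measure_axioms)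

lemma prob_space_gauss: "prob_space (gauss :: (real ^ 'n) measure)"
  unfolding gauss_def
  by (rule prob_space.prob_space_distr[OF prob_space_PiM[OF normal1.prob_space_axioms] measurable_vec_lambda])

interpretation gauss: prob_space "gauss :: (real ^ 'n) measure"
  by (rule prob_space_gauss)

lemma sets_gauss [measurable_cong, simp]: "sets gauss = sets borel"
  by (simp add: gauss_def)

lemma space_gauss [simp]: "space gauss = UNIV"
  by (simp add: gauss_def)

lemma continuous_measurable_gauss:
  fixes f :: "real ^ 'n \<Rightarrow> real"
  assumes "continuous_on UNIV f" shows "f \<in> borel_measurable gauss"
  using borel_measurable_continuous_onI[OF assms] by simp

lemma normal1_moment2:
  "integrable normal1 (\<lambda>s. s\<^sup>2)" "(\<integral>s. s\<^sup>2 \<partial>normal1) = 1"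
proof -
  have "has_bochner_integral lborel (\<lambda>x. std_normal_density x * x ^ (2 * 1)) (fact (2 * 1) / (2^1 * fact 1))"
    by (rule std_normal_moment_even)
  then have "has_bochner_integral lborel (\<lambda>x. std_normal_density x *\<^sub>R x\<^sup>2) 1" by simp
  then have "has_bochner_integral normal1 (\<lambda>s. s\<^sup>2) 1"
    by (intro has_bochner_integral_density) auto
  then show "integrable normal1 (\<lambda>s. s\<^sup>2)" "(\<integral>s. s\<^sup>2 \<partial>normal1) = 1"
    by (auto simp: has_bochner_integral_iff)
qed

lemma distr_gauss_component:
  "distr gauss borel (\<lambda>y. y $ i) = normal1"
proof -
  have "distr gauss borel (\<lambda>y. y $ i) = distr (Pi\<^sub>M UNIV (\<lambda>_. normal1)) borel ((\<lambda>y. y $ i) \<circ> (\<lambda>f. \<chi> i. f i))"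
    unfolding gauss_def by (rule distr_distr[OF _ measurable_vec_lambda]) simp
  also have "\<dots> = distr (Pi\<^sub>M UNIV (\<lambda>_. normal1)) normal1 (\<lambda>f. f i)"
    by (rule distr_cong) auto
  also have "\<dots> = normal1"
    by (rule distr_PiM_component) (auto intro: normal1.prob_space_axioms)
  finally show ?thesis .
qed

lemma gauss_component_moments:
  fixes i :: "'n::finite"
  shows "integrable gauss (\<lambda>y. (y $ i)\<^sup>2)" "integrable gauss (\<lambda>y. y $ i)"
    "(\<integral>y. \<bar>y $ i\<bar> \<partial>gauss) \<le> 1"
proof -
  have m: "(\<lambda>y. y $ i) \<in> measurable gauss borel" by simp
  show i2: "integrable gauss (\<lambda>y. (y $ i)\<^sup>2)"
    using normal1_moment2(1) integrable_distr_eq[OF m, of "\<lambda>s. s\<^sup>2"] by (simp add: distr_gauss_component)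
  have e2: "(\<integral>y. (y $ i)\<^sup>2 \<partial>gauss) = 1"
    using normal1_moment2(2) integral_distr[OF m, of "\<lambda>s. s\<^sup>2"] by (simp add: distr_gauss_component)
  have b: "\<bar>s\<bar> \<le> (1 + s\<^sup>2) / 2" for s :: real
    using zero_le_power2[of "\<bar>s\<bar> - 1"] by (simp add: power2_diff)
  have ib: "integrable gauss (\<lambda>y. (1 + (y $ i)\<^sup>2) / 2)" using i2 by simp
  show i1: "integrable gauss (\<lambda>y. y $ i)"
    by (rule Bochner_Integration.integrable_bound[OF ib]) (use b in \<open>auto simp: abs_of_nonneg add_nonneg_nonneg\<close>)
  have "(\<integral>y. \<bar>y $ i\<bar> \<partial>gauss) \<le> (\<integral>y. (1 + (y $ i)\<^sup>2) / 2 \<partial>gauss)"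
    by (rule integral_mono) (use i1 ib b in auto)
  also have "\<dots> = 1" using i2 e2 gauss.prob_space by simp
  finally show "(\<integral>y. \<bar>y $ i\<bar> \<partial>gauss) \<le> 1" .
qed

text \<open>
  The density satisfies \<open>\<phi>' s = - s * \<phi> s\<close>, so the difference of the two integrands is the derivative of
  \<open>\<phi> s * h s\<close>, which vanishes at both ends of the line.
\<close>

lemma stein_real:
  fixes h h' :: "real \<Rightarrow> real"
  assumes d: "\<And>s. (h has_real_derivative h' s) (at s)" and c: "continuous_on UNIV h'"
    and b: "\<And>s. \<bar>h s\<bar> \<le> C" "\<And>s. \<bar>h' s\<bar> \<le> C"
  shows "(\<integral>s. h s * s \<partial>normal1) = (\<integral>s. h' s \<partial>normal1)"
proof -
  let ?\<phi> = std_normal_density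
  have ch: "continuous_on UNIV h"
    by (intro continuous_at_imp_continuous_on ballI DERIV_isCont[OF d])
  have mh[measurable]: "h \<in> borel_measurable borel" "h' \<in> borel_measurable borel"
    using ch c borel_measurable_continuous_onI by auto
  have C: "0 \<le> C" using b(1)[of 0] by linarith
  have i0: "integrable lborel ?\<phi>" using integrable_normal_density[of 1 0] by simp
  have i1: "integrable lborel (\<lambda>s. ?\<phi> s * \<bar>s\<bar>)" using integrable_std_normal_moment_abs[of 1] by simp
  have I': "integrable lborel (\<lambda>s. ?\<phi> s * h' s)"
    by (rule Bochner_Integration.integrable_bound[OF integrable_mult_right[OF i0, of C]])
      (use b C in \<open>auto simp: abs_mult mult.commute intro!: AE_I2 mult_right_mono\<close>)
  have I: "integrable lborel (\<lambda>s. ?\<phi> s * (h s * s))"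
    by (rule Bochner_Integration.integrable_bound[OF integrable_mult_right[OF i1, of C]])
      (use b C in \<open>auto simp: abs_mult mult.assoc[symmetric] mult.commute[of C] mult.commute[of _ "std_normal_density _"]
        intro!: AE_I2 mult_right_mono mult_left_mono\<close>)
  let ?f = "\<lambda>s. ?\<phi> s * h' s - ?\<phi> s * (h s * s)"
  have d\<phi>: "(?\<phi> has_real_derivative - s * ?\<phi> s) (at s)" for s
    unfolding normal_density_def
    by (auto intro!: derivative_eq_intros simp: field_simps power2_eq_square)
  have c\<phi>: "continuous_on UNIV ?\<phi>" 
    by (intro continuous_at_imp_continuous_on ballI DERIV_isCont[OF d\<phi>])
  have lim: "((\<lambda>s. ?\<phi> s * h s) \<longlongrightarrow> 0) F" if "(?\<phi> \<longlongrightarrow> 0) F" for F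
  proof (rule Lim_null_comparison)
    show "\<forall>\<^sub>F s in F. norm (?\<phi> s * h s) \<le> ?\<phi> s * C"
      using b(1) by (auto simp: abs_mult intro!: mult_left_mono always_eventually)
    show "((\<lambda>s. ?\<phi> s * C) \<longlongrightarrow> 0) F" by (rule tendsto_mult_left_zero[OF that])
  qed
  have sq: "filterlim (\<lambda>s::real. - s\<^sup>2 / 2) at_bot at_top" "filterlim (\<lambda>s::real. - s\<^sup>2 / 2) at_bot at_bot"
  proof -
    have *: "filterlim (\<lambda>s::real. - s\<^sup>2 / 2) at_bot F" if "filterlim (\<lambda>s::real. s\<^sup>2) at_top F" for F
      using filterlim_tendsto_pos_mult_at_top[where f="\<lambda>_. 1/2" and g="\<lambda>s. s\<^sup>2" and c="1/2", OF _ _ that]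
      by (simp add: filterlim_uminus_at_bot)
    show "filterlim (\<lambda>s::real. - s\<^sup>2 / 2) at_bot at_top"
      using filterlim_pow_at_top[of 2 "\<lambda>s::real. s" at_top] * by (simp add: filterlim_ident)
    show "filterlim (\<lambda>s::real. - s\<^sup>2 / 2) at_bot at_bot"
      using filterlim_pow_at_bot_even[of 2 "\<lambda>s::real. s" at_bot] * by (simp add: filterlim_ident)
  qed
  have \<phi>lim: "(?\<phi> \<longlongrightarrow> 0) at_top" "(?\<phi> \<longlongrightarrow> 0) at_bot"
    unfolding std_normal_density_def
    by (rule tendsto_mult_right_zero[OF filterlim_compose[OF exp_at_bot sq(1)]],
        rule tendsto_mult_right_zero[OF filterlim_compose[OF exp_at_bot sq(2)]])
  have "(LBINT s=-\<infinity>..\<infinity>. ?f s) = 0 - 0"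
  proof (rule interval_integral_FTC_integrable)
    show "((\<lambda>s. ?\<phi> s * h s) has_vector_derivative ?f s) (at s)" for s
      using DERIV_mult[OF d\<phi> d, of s] by (simp add: has_real_derivative_iff_has_vector_derivative[symmetric] algebra_simps)
    show "isCont ?f s" for s
      using c c\<phi> ch by (auto intro!: continuous_intros simp: continuous_on_eq_continuous_at)
    show "set_integrable lborel (einterval (-\<infinity>) \<infinity>) ?f"
      using I I' by (simp add: set_integrable_def einterval_def)
    show "(((\<lambda>s. ?\<phi> s * h s) \<circ> real_of_ereal) \<longlongrightarrow> 0) (at_right (-\<infinity>))"
      using lim[OF \<phi>lim(2)] by (simp add: ereal_tendsto_simps)
    show "(((\<lambda>s. ?\<phi> s * h s) \<circ> real_of_ereal) \<longlongrightarrow> 0) (at_left \<infinity>)"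
      using lim[OF \<phi>lim(1)] by (simp add: ereal_tendsto_simps)
  qed simp
  then have "(\<integral>s. ?f s \<partial>lborel) = 0"
    by (simp add: interval_lebesgue_integral_def einterval_def set_lebesgue_integral_def)
  then have "(\<integral>s. ?\<phi> s * h' s \<partial>lborel) = (\<integral>s. ?\<phi> s * (h s * s) \<partial>lborel)"
    using I I' by simp
  then show ?thesis by (simp add: integral_density)
qed

text \<open>Gaussian integration by parts: this is how the heat semigroup trades the weight \<open>y $ i\<close>
  for a derivative.\<close>

lemma stein:
  fixes f g :: "real ^ 'n \<Rightarrow> real"
  assumes d: "\<And>y. ((\<lambda>s. f (y + s *\<^sub>R axis i 1)) has_real_derivative g y) (at 0)"
    and c: "continuous_on UNIV f" "continuous_on UNIV g"
    and b: "\<And>y. \<bar>f y\<bar> \<le> C" "\<And>y. \<bar>g y\<bar> \<le> C"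
  shows "(\<integral>y. f y * y $ i \<partial>gauss) = (\<integral>y. g y \<partial>gauss)"
proof -
  let ?M = "\<lambda>I. Pi\<^sub>M I (\<lambda>_::'n. normal1)"
  have C: "0 \<le> C" using b(1)[of 0] by linarith
  have [measurable]: "f \<in> borel_measurable borel" "g \<in> borel_measurable borel"
    using c borel_measurable_continuous_onI by auto
  have U: "insert i (UNIV - {i}) = UNIV" by auto
  have split: "(\<integral>y. k y \<partial>gauss) = (\<integral>x. (\<integral>s. k (\<chi> j. (x(i := s)) j) \<partial>normal1) \<partial>?M (UNIV - {i}))"
    if "integrable gauss k" for k :: "real ^ 'n \<Rightarrow> real"
  proof -
    have km: "k \<in> borel_measurable borel" using borel_measurable_integrable[OF that] by simp
    have I: "integrable (?M UNIV) (\<lambda>x. k (\<chi> j. x j))"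
      using that unfolding gauss_def by (subst (asm) integrable_distr_eq[OF measurable_vec_lambda km])
    have I': "integrable (?M (insert i (UNIV - {i}))) (\<lambda>x. k (\<chi> j. x j))" unfolding U by (rule I)
    have "(\<integral>y. k y \<partial>gauss) = (\<integral>x. k (\<chi> j. x j) \<partial>?M UNIV)"
      unfolding gauss_def by (rule integral_distr[OF measurable_vec_lambda km])
    also have "\<dots> = (\<integral>x. k (\<chi> j. x j) \<partial>?M (insert i (UNIV - {i})))" by (simp only: U)
    also have "\<dots> = (\<integral>x. (\<integral>s. k (\<chi> j. (x(i := s)) j) \<partial>normal1) \<partial>?M (UNIV - {i}))"
      by (rule normal_product.product_integral_insert) (use I' in auto)
    finally show ?thesis .
  qed
  have I1: "integrable gauss (\<lambda>y. f y * y $ i)"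
    by (rule Bochner_Integration.integrable_bound[OF integrable_mult_right[OF gauss_component_moments(2), of C]])
      (use b C in \<open>auto simp: abs_mult intro!: AE_I2 mult_right_mono\<close>)
  have I2: "integrable gauss g"
    by (rule gauss.integrable_const_bound[where B=C]) (use b in auto)
  have "(\<integral>s. f (\<chi> j. (x(i := s)) j) * s \<partial>normal1) = (\<integral>s. g (\<chi> j. (x(i := s)) j) \<partial>normal1)" for x
  proof (rule stein_real)
    define v where "v = (\<lambda>s. (\<chi> j. (x(i := s)) j) :: real ^ 'n)"
    have v: "v (s + h) = v s + h *\<^sub>R axis i 1" for s h
      by (auto simp: v_def vec_eq_iff axis_def)
    have veq: "v = (\<lambda>s. v 0 + s *\<^sub>R axis i 1)" 
    proof
      fix s show "v s = v 0 + s *\<^sub>R axis i 1" using v[of 0 s] unfolding add_0 .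
    qed
    have cv: "continuous_on UNIV v"
      by (subst veq) (intro continuous_intros)
    have "((\<lambda>h. f (v (h + s))) has_real_derivative g (v s)) (at 0)" for s
      using d[of "v s"] v[of s] by (simp add: add.commute)
    then have "((\<lambda>s. f (v s)) has_real_derivative g (v s)) (at s)" for s
      using DERIV_shift[of "\<lambda>s. f (v s)" "g (v s)" 0 s] by simp
    then show "((\<lambda>s. f (\<chi> j. (x(i := s)) j)) has_real_derivative g (\<chi> j. (x(i := s)) j)) (at s)" for s
      unfolding v_def .
    show "continuous_on UNIV (\<lambda>s. g (\<chi> j. (x(i := s)) j))"
      using continuous_on_compose2[OF c(2) cv subset_UNIV] unfolding v_def .
  qed (use b in auto)
  then show ?thesis using split[OF I1] split[OF I2] by simp
qed

lemma continuous_on_gauss_integral: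
  fixes F :: "'p::metric_space \<Rightarrow> real ^ 'n \<Rightarrow> real"
  assumes c: "continuous_on (A \<times> UNIV) (\<lambda>(p, y). F p y)"
    and w: "integrable gauss w" and b: "\<And>p y. p \<in> A \<Longrightarrow> \<bar>F p y\<bar> \<le> w y"
  shows "continuous_on A (\<lambda>p. \<integral>y. F p y \<partial>gauss)"
  unfolding continuous_on_sequentially
proof (intro allI ballI impI, elim conjE)
  fix X a assume a: "a \<in> A" and X: "\<forall>n. X n \<in> A" "X \<longlonglongrightarrow> a"
  have cy: "continuous_on UNIV (F p)" if "p \<in> A" for p
    using continuous_on_compose2[OF c continuous_on_Pair[OF continuous_on_const[of UNIV p] continuous_on_id]] that
    by auto
  have cp: "continuous_on A (\<lambda>p. F p y)" for y
    using continuous_on_compose2[OF c continuous_on_Pair[OF continuous_on_id continuous_on_const[of A y]]]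
    by auto
  have "(\<lambda>n. \<integral>y. F (X n) y \<partial>gauss) \<longlonglongrightarrow> (\<integral>y. F a y \<partial>gauss)"
  proof (rule integral_dominated_convergence[OF _ _ w])
    show "F a \<in> borel_measurable gauss" "\<And>n. F (X n) \<in> borel_measurable gauss"
      using cy a X by (auto intro: continuous_measurable_gauss)
    show "AE y in gauss. (\<lambda>n. F (X n) y) \<longlonglongrightarrow> F a y"
      using cp a X unfolding continuous_on_sequentially comp_def by auto
    show "AE y in gauss. norm (F (X n) y) \<le> w y" for n using b X by auto
  qed
  then show "((\<lambda>p. \<integral>y. F p y \<partial>gauss) \<circ> X) \<longlonglongrightarrow> (\<integral>y. F a y \<partial>gauss)" by (simp add: comp_def)
qed

lemma DERIV_gauss_integral:
  fixes F F' :: "real \<Rightarrow> real ^ 'n \<Rightarrow> real"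
  assumes d: "\<And>s y. ((\<lambda>s. F s y) has_real_derivative F' s y) (at s)"
    and m: "\<And>s. F s \<in> borel_measurable gauss" "\<And>s. F' s \<in> borel_measurable gauss"
    and i: "\<And>s. integrable gauss (F s)"
    and w: "integrable gauss w" and b: "\<And>s y. \<bar>F' s y\<bar> \<le> w y"
  shows "((\<lambda>s. \<integral>y. F s y \<partial>gauss) has_real_derivative (\<integral>y. F' s y \<partial>gauss)) (at s)"
  unfolding has_field_derivative_iff tendsto_at_iff_sequentially
proof (intro allI impI)
  fix X :: "nat \<Rightarrow> real" assume X: "\<forall>n. X n \<in> UNIV - {s}" "X \<longlonglongrightarrow> s"
  have "(\<lambda>n. \<integral>y. (F (X n) y - F s y) / (X n - s) \<partial>gauss) \<longlonglongrightarrow> (\<integral>y. F' s y \<partial>gauss)"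
  proof (rule integral_dominated_convergence[OF _ _ w])
    show "F' s \<in> borel_measurable gauss" "\<And>n. (\<lambda>y. (F (X n) y - F s y) / (X n - s)) \<in> borel_measurable gauss"
      using m by auto
    show "AE y in gauss. (\<lambda>n. (F (X n) y - F s y) / (X n - s)) \<longlonglongrightarrow> F' s y"
      using d[of _ s] X unfolding has_field_derivative_iff tendsto_at_iff_sequentially comp_def by auto
    show "AE y in gauss. norm ((F (X n) y - F s y) / (X n - s)) \<le> w y" for n
    proof (intro AE_I2)
      fix y
      have "norm (F (X n) y - F s y) \<le> w y * norm (X n - s)"
        by (rule field_differentiable_bound[of UNIV "\<lambda>s. F s y" "\<lambda>s. F' s y"])
          (use d b in \<open>auto\<close>)
      then show "norm ((F (X n) y - F s y) / (X n - s)) \<le> w y"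
        using X(1) by (simp add: pos_divide_le_eq)
    qed
  qed
  then show "((\<lambda>z. ((\<integral>y. F z y \<partial>gauss) - (\<integral>y. F s y \<partial>gauss)) / (z - s)) \<circ> X) \<longlonglongrightarrow> (\<integral>y. F' s y \<partial>gauss)"
    using i by (simp add: comp_def)
qed

section \<open>Continuous functions that are periodic in space\<close>

text \<open>
  Functions on the torus with a further parameter in \<open>C\<close>. In the applications \<open>C\<close> is a time interval, or
  a time interval times a set of values of the unknowns. For compact \<open>C\<close> these functions are bounded
  and uniformly continuous, which replaces compactness of the torus.
\<close>

definition cper :: "'c::real_normed_vector set \<Rightarrow> ((real ^ 'n) \<times> 'c \<Rightarrow> 'e::real_normed_vector) \<Rightarrow> bool" where
  "cper C f \<longleftrightarrow> continuous_on (UNIV \<times> C) f \<and>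
     (\<forall>x. \<forall>c\<in>C. \<forall>k. (\<forall>i. k $ i \<in> \<int>) \<longrightarrow> f (x + k, c) = f (x, c))"

lemma cper_cont: "cper C f \<Longrightarrow> continuous_on (UNIV \<times> C) f"
  by (simp add: cper_def)

lemma cper_per: "cper C f \<Longrightarrow> c \<in> C \<Longrightarrow> (\<And>i. k $ i \<in> \<int>) \<Longrightarrow> f (x + k, c) = f (x, c)"
  by (simp add: cper_def)

lemma cper_const: "cper C (\<lambda>_. c)"
  by (simp add: cper_def)

lemma cper_add: "cper C f \<Longrightarrow> cper C g \<Longrightarrow> cper C (\<lambda>p. f p + g p)"
  by (auto simp: cper_def intro!: continuous_intros)

lemma cper_diff: "cper C f \<Longrightarrow> cper C g \<Longrightarrow> cper C (\<lambda>p. f p - g p)"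
  by (auto simp: cper_def intro!: continuous_intros)

lemma cper_scaleR: "cper C f \<Longrightarrow> cper C (\<lambda>p. c *\<^sub>R f p)"
  by (auto simp: cper_def intro!: continuous_intros)

lemma cper_sum: "(\<And>i. i \<in> I \<Longrightarrow> cper C (f i)) \<Longrightarrow> cper C (\<lambda>p. \<Sum>i\<in>I. f i p)"
  by (auto simp: cper_def intro!: continuous_intros)

lemma cper_compose: "cper C f \<Longrightarrow> continuous_on UNIV g \<Longrightarrow> cper C (\<lambda>p. g (f p))"
  by (auto simp: cper_def intro: continuous_on_compose2)

lemma cper_cong:
  assumes "cper C f" "\<And>x c. c \<in> C \<Longrightarrow> f (x, c) = g (x, c)" shows "cper C g"
proof -
  have "continuous_on (UNIV \<times> C) g"
    using cper_cont[OF assms(1)] by (rule continuous_on_eq) (use assms(2) in auto)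
  then show ?thesis using assms unfolding cper_def by metis
qed

lemma cper_shift: "cper C f \<Longrightarrow> cper C (\<lambda>p. f (fst p + h, snd p))"
proof -
  assume f: "cper C f"
  have "continuous_on (UNIV \<times> C) (\<lambda>p. f (fst p + h, snd p))"
    by (rule continuous_on_compose2[OF cper_cont[OF f]]) (auto intro!: continuous_intros)
  moreover have "f (x + k + h, c) = f (x + h, c)" if "c \<in> C" "\<forall>i. k $ i \<in> \<int>" for x k c
    using cper_per[OF f that(1), of k "x + h"] that(2) by (simp add: add_ac)
  ultimately show ?thesis by (simp add: cper_def)
qed

lemma unit_cube_representative:
  fixes x :: "real ^ 'n"
  obtains k where "\<And>i. k $ i \<in> \<int>" "x + k \<in> cbox 0 1"
proof
  let ?k = "(\<chi> i. - of_int \<lfloor>x $ i\<rfloor>) :: real ^ 'n"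
  show "\<And>i. ?k $ i \<in> \<int>" by simp
  show "x + ?k \<in> cbox 0 1" unfolding mem_box_cart by (auto; linarith)
qed

lemma cper_bounded:
  assumes "compact C" "cper C f"
  obtains M where "M \<ge> 0" "\<And>x c. c \<in> C \<Longrightarrow> norm (f (x, c)) \<le> M"
proof -
  have "compact (f ` (cbox 0 1 \<times> C))"
    by (intro compact_continuous_image continuous_on_subset[OF cper_cont[OF assms(2)]]
        compact_Times assms compact_cbox) auto
  then obtain M where M: "\<And>y. y \<in> f ` (cbox 0 1 \<times> C) \<Longrightarrow> norm y \<le> M"
    using compact_imp_bounded bounded_iff by metis
  have "norm (f (x, c)) \<le> max M 0" if "c \<in> C" for x c
  proof -
    obtain k where k: "\<And>i. k $ i \<in> \<int>" "x + k \<in> cbox 0 1" using unit_cube_representative[of x] by blast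
    have "f (x, c) = f (x + k, c)" using cper_per[OF assms(2) that k(1)] by simp
    moreover have "norm (f (x + k, c)) \<le> M" using k(2) that by (intro M) auto
    ultimately show ?thesis by simp
  qed
  then show ?thesis using that[of "max M 0"] by simp
qed

text \<open>
  Of two nearby points, one is moved into the unit cube by an integer translation, and the same
  translation moves the other one into a slightly larger cube, where the function is uniformly continuous.
\<close>

lemma cper_uniform:
  fixes f :: "(real ^ 'n) \<times> 'c::real_normed_vector \<Rightarrow> 'e::real_normed_vector"
  assumes "compact C" "cper C f" "\<epsilon> > 0"
  obtains \<delta> where "\<delta> > 0"
    "\<And>x y c d. c \<in> C \<Longrightarrow> d \<in> C \<Longrightarrow> dist (x, c) (y, d) < \<delta> \<Longrightarrow> dist (f (x, c)) (f (y, d)) < \<epsilon>"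
proof -
  have "uniformly_continuous_on (cbox (-1) 2 \<times> C) f"
    by (intro compact_uniformly_continuous continuous_on_subset[OF cper_cont[OF assms(2)]]
        compact_Times assms compact_cbox) auto
  then obtain \<delta> where \<delta>: "\<delta> > 0" "\<And>p q. p \<in> cbox (-1) 2 \<times> C \<Longrightarrow> q \<in> cbox (-1) 2 \<times> C \<Longrightarrow>
      dist q p < \<delta> \<Longrightarrow> dist (f q) (f p) < \<epsilon>"
    using assms(3) unfolding uniformly_continuous_on_def by metis
  have "dist (f (x, c)) (f (y, d)) < \<epsilon>"
    if "c \<in> C" "d \<in> C" "dist (x, c) (y, d) < min \<delta> 1" for x y c d
  proof -
    obtain k where k: "\<And>i. k $ i \<in> \<int>" "x + k \<in> cbox 0 1" using unit_cube_representative[of x] by blast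
    have "dist x y \<le> dist (x, c) (y, d)" using dist_fst_le[of "(x, c)" "(y, d)"] by simp
    then have xy: "norm (x - y) < 1" using that(3) by (simp add: dist_norm)
    have "\<bar>x $ i - y $ i\<bar> < 1" for i
      using component_le_norm_cart[of "x - y" i] xy by simp
    moreover have "0 \<le> x $ i + k $ i" "x $ i + k $ i \<le> 1" for i
      using k(2) unfolding mem_box_cart by auto
    ultimately have "y + k \<in> cbox (-1) 2" "x + k \<in> cbox (-1) 2"
      unfolding mem_box_cart
      by (auto simp: abs_less_iff; smt (verit, best))+
    then have "dist (f (x + k, c)) (f (y + k, d)) < \<epsilon>"
      using \<delta>(2)[of "(y + k, d)" "(x + k, c)"] that by (auto simp: dist_Pair_Pair)
    then show ?thesis using cper_per[OF assms(2) that(1) k(1)] cper_per[OF assms(2) that(2) k(1)] by simp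
  qed
  then show ?thesis using that[of "min \<delta> 1"] \<delta>(1) by auto
qed

definition xderiv ::
  "real \<Rightarrow> ((real ^ 'n) \<times> real \<Rightarrow> 'e::real_normed_vector) \<Rightarrow> ((real ^ 'n) \<times> real \<Rightarrow> real ^ 'n \<Rightarrow> 'e) \<Rightarrow> bool" where
  "xderiv T f f' \<longleftrightarrow> (\<forall>x. \<forall>t\<in>{0..T}. ((\<lambda>y. f (y, t)) has_derivative f' (x, t)) (at x))"

lemma norm_linear_le_sum_Basis:
  fixes g :: "'a::euclidean_space \<Rightarrow> 'e::real_normed_vector"
  assumes "linear g" shows "norm (g h) \<le> (\<Sum>b\<in>Basis. norm (g b)) * norm h"
proof -
  have "g h = g (\<Sum>b\<in>Basis. (h \<bullet> b) *\<^sub>R b)" by (simp add: euclidean_representation)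
  also have "\<dots> = (\<Sum>b\<in>Basis. (h \<bullet> b) *\<^sub>R g b)" using assms by (simp add: linear_sum linear_cmul)
  finally have "norm (g h) \<le> (\<Sum>b\<in>Basis. norm ((h \<bullet> b) *\<^sub>R g b))" 
    using norm_sum[of "\<lambda>b. (h \<bullet> b) *\<^sub>R g b" Basis] by simp
  also have "\<dots> \<le> (\<Sum>b\<in>Basis. norm h * norm (g b))"
    by (intro sum_mono) (auto intro!: mult_right_mono Basis_le_norm)
  finally show ?thesis by (simp add: sum_distrib_left mult.commute)
qed

lemma cper_linear_uniform:
  fixes F :: "(real ^ 'n) \<times> 'c::real_normed_vector \<Rightarrow> 'a::euclidean_space \<Rightarrow> 'e::real_normed_vector"
  assumes C: "compact C" and c: "\<And>v. cper C (\<lambda>q. F q v)" and lin: "\<And>q. q \<in> UNIV \<times> C \<Longrightarrow> linear (F q)"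
    and e: "\<epsilon> > 0"
  obtains \<delta> where "\<delta> > 0"
    "\<And>q q'. q \<in> UNIV \<times> C \<Longrightarrow> q' \<in> UNIV \<times> C \<Longrightarrow> dist q q' < \<delta> \<Longrightarrow> onorm (F q - F q') \<le> \<epsilon>"
proof -
  let ?B = "Basis :: 'a set"
  let ?n = "real (card ?B)"
  have "card ?B > 0" by (rule DIM_positive)
  then have n0: "?n > 0" by (simp only: of_nat_0_less_iff)
  then have e': "\<epsilon> / ?n > 0" using e by simp
  have "\<exists>\<delta>>0. \<forall>x y. \<forall>c\<in>C. \<forall>d\<in>C. dist (x, c) (y, d) < \<delta> \<longrightarrow> dist (F (x, c) b) (F (y, d) b) < \<epsilon> / ?n" for b
    by (rule cper_uniform[OF C c[of b] e']) blast
  then obtain \<delta> where \<delta>: "\<And>b. \<delta> b > 0"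
    "\<And>b x y c d. c\<in>C \<Longrightarrow> d\<in>C \<Longrightarrow> dist (x, c) (y, d) < \<delta> b \<Longrightarrow> dist (F (x, c) b) (F (y, d) b) < \<epsilon> / ?n"
    by metis
  let ?d = "Min (\<delta> ` ?B)"
  have d0: "?d > 0" using \<delta>(1) by (subst Min_gr_iff) auto
  have "onorm (F q - F q') \<le> \<epsilon>" if q: "q \<in> UNIV \<times> C" "q' \<in> UNIV \<times> C" and d: "dist q q' < ?d" for q q'
  proof (rule onorm_le)
    fix v
    have "(\<Sum>b\<in>?B. norm (F q b - F q' b)) \<le> (\<Sum>b\<in>?B. \<epsilon> / ?n)"
    proof (rule sum_mono)
      fix b assume b: "b \<in> ?B"
      have "dist q q' < \<delta> b" using d b by auto
      then show "norm (F q b - F q' b) \<le> \<epsilon> / ?n"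
        using \<delta>(2)[of "snd q" "snd q'" "fst q" "fst q'" b] q by (auto simp: dist_norm)
    qed
    also have "\<dots> = \<epsilon>" using n0 by simp
    finally have "(\<Sum>b\<in>?B. norm ((F q - F q') b)) \<le> \<epsilon>" by simp
    moreover have "linear (F q - F q')"
      using lin[OF q(1)] lin[OF q(2)] by (simp add: fun_diff_def linear_compose_sub)
    ultimately show "norm ((F q - F q') v) \<le> \<epsilon> * norm v"
      using norm_linear_le_sum_Basis[of "F q - F q'" v]
      by (meson mult_right_mono norm_ge_zero order_trans)
  qed
  with d0 that show ?thesis by blast
qed

text \<open>Compactness of the torus makes the first-order Taylor expansion in \<open>x\<close> uniform on the strip.\<close>

lemma xderiv_uniform:
  fixes f :: "(real ^ 'n) \<times> real \<Rightarrow> 'e::euclidean_space"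
  assumes f: "xderiv T f f'" and c: "\<And>v. cper {0..T} (\<lambda>p. f' p v)" and e: "\<epsilon> > 0"
  obtains \<delta> where "\<delta> > 0" "\<And>h x t. norm h < \<delta> \<Longrightarrow> t \<in> {0..T} \<Longrightarrow>
    norm (f (x + h, t) - f (x, t) - f' (x, t) h) \<le> \<epsilon> * norm h"
proof -
  have lin: "linear (f' q)" if "q \<in> UNIV \<times> {0..T}" for q
    using has_derivative_linear[of "\<lambda>y. f (y, snd q)" "f' q" "at (fst q)"] f that by (auto simp: xderiv_def)
  obtain \<delta> where \<delta>: "\<delta> > 0"
    "\<And>q q'. q \<in> UNIV \<times> {0..T} \<Longrightarrow> q' \<in> UNIV \<times> {0..T} \<Longrightarrow> dist q q' < \<delta> \<Longrightarrow> onorm (f' q - f' q') \<le> \<epsilon>"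
    using cper_linear_uniform[OF compact_Icc c lin e] by blast
  have "norm (f (x + h, t) - f (x, t) - f' (x, t) h) \<le> \<epsilon> * norm h"
    if h: "norm h < \<delta>" and t: "t \<in> {0..T}" for h x t
  proof -
    have "norm (f (x + h, t) - f (x, t) - f' (x, t) (x + h - x)) \<le> norm (x + h - x) * \<epsilon>"
    proof (rule differentiable_bound_linearization[where S="closed_segment x (x + h)" and f="\<lambda>y. f (y, t)" and f'="\<lambda>y. f' (y, t)"])
      show "x + s *\<^sub>R (x + h - x) \<in> closed_segment x (x + h)" if "s \<in> {0..1}" for s
        using that by (auto simp: in_segment algebra_simps intro!: exI[of _ s])
      show "((\<lambda>y. f (y, t)) has_derivative f' (y, t)) (at y within closed_segment x (x + h))" for y
        using f t by (auto simp: xderiv_def intro: has_derivative_at_withinI)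
      show "onorm (f' (y, t) - f' (x, t)) \<le> \<epsilon>" if y: "y \<in> closed_segment x (x + h)" for y
        using dist_in_closed_segment(1)[OF y] h t by (intro \<delta>(2)) (auto simp: dist_norm dist_Pair_Pair)
    qed auto
    then show ?thesis by (simp add: mult.commute)
  qed
  with \<delta>(1) that show ?thesis by blast
qed

section \<open>Translation invariant operators\<close>

text \<open>
  The only facts about the heat semigroup that the fixed-point and the regularity arguments use:
  a bounded linear operator on the space of continuous periodic functions that commutes with
  translations in \<open>x\<close>, and hence with differentiation in \<open>x\<close>.
\<close>

locale invariant_operator =
  fixes T \<kappa> :: real and A :: "((real ^ 'n) \<times> real \<Rightarrow> 'e::euclidean_space) \<Rightarrow> (real ^ 'n) \<times> real \<Rightarrow> 'e"
  assumes T0: "0 \<le> T" and \<kappa>0: "0 \<le> \<kappa>"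
    and cper_op: "cper {0..T} f \<Longrightarrow> cper {0..T} (A f)"
    and linear_op: "cper {0..T} f \<Longrightarrow> cper {0..T} g \<Longrightarrow> t \<in> {0..T} \<Longrightarrow>
      A (\<lambda>q. f q + c *\<^sub>R g q) (x, t) = A f (x, t) + c *\<^sub>R A g (x, t)"
    and shift_op: "cper {0..T} f \<Longrightarrow> t \<in> {0..T} \<Longrightarrow>
      A (\<lambda>q. f (fst q + h, snd q)) (x, t) = A f (x + h, t)"
    and bound_op: "cper {0..T} f \<Longrightarrow> (\<And>y s. s \<in> {0..T} \<Longrightarrow> norm (f (y, s)) \<le> M) \<Longrightarrow> t \<in> {0..T} \<Longrightarrow>
      norm (A f (x, t)) \<le> \<kappa> * M"
begin

lemma diff_op:
  assumes "cper {0..T} f" "cper {0..T} g" "t \<in> {0..T}"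
  shows "A (\<lambda>q. f q - g q) (x, t) = A f (x, t) - A g (x, t)"
  using linear_op[OF assms, of "-1"] by simp

lemma cong_op:
  assumes f: "cper {0..T} f" and eq: "\<And>y s. s \<in> {0..T} \<Longrightarrow> f (y, s) = g (y, s)" and t: "t \<in> {0..T}"
  shows "A f (x, t) = A g (x, t)"
proof -
  have g: "cper {0..T} g" by (rule cper_cong[OF f eq])
  have "norm (A (\<lambda>q. f q - g q) (x, t)) \<le> \<kappa> * 0"
    by (rule bound_op[OF cper_diff[OF f g] _ t]) (use eq in auto)
  then show ?thesis using diff_op[OF f g t] by simp
qed

lemma bounded_linear_op:
  assumes f: "\<And>v. cper {0..T} (\<lambda>p. f' p v)" and lin: "\<And>y s. s \<in> {0..T} \<Longrightarrow> linear (f' (y, s))"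
    and t: "t \<in> {0..T}"
  shows "linear (\<lambda>v. A (\<lambda>q. f' q v) (x, t))"
proof (rule linearI)
  fix v w
  have "A (\<lambda>q. f' q (v + w)) (x, t) = A (\<lambda>q. f' q v + 1 *\<^sub>R f' q w) (x, t)"
    by (rule cong_op[OF f _ t]) (simp add: linear_add[OF lin])
  then show "A (\<lambda>q. f' q (v + w)) (x, t) = A (\<lambda>q. f' q v) (x, t) + A (\<lambda>q. f' q w) (x, t)"
    by (subst (asm) linear_op[OF f f t]) simp
  fix c
  have z: "A (\<lambda>q. 0) (x, t) = 0" using diff_op[OF cper_const cper_const t, of 0 0] by simp
  have "A (\<lambda>q. f' q (c *\<^sub>R v)) (x, t) = A (\<lambda>q. 0 + c *\<^sub>R f' q v) (x, t)"
    by (rule cong_op[OF f _ t]) (simp add: linear_cmul[OF lin])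
  then show "A (\<lambda>q. f' q (c *\<^sub>R v)) (x, t) = c *\<^sub>R A (\<lambda>q. f' q v) (x, t)"
    by (subst (asm) linear_op[OF cper_const f t]) (simp add: z)
qed

text \<open>
  The remainder of the first-order expansion of \<open>A f\<close> is \<open>A\<close> applied to that of \<open>f\<close>, which is uniformly
  small.
\<close>

lemma xderiv_op:
  assumes f: "cper {0..T} f" and d: "xderiv T f f'" and f': "\<And>v. cper {0..T} (\<lambda>p. f' p v)"
  shows "xderiv T (A f) (\<lambda>p v. A (\<lambda>q. f' q v) p)"
  unfolding xderiv_def has_derivative_at_alt
proof (intro allI ballI conjI impI)
  fix x :: "real ^ 'n" and t assume t: "t \<in> {0..T}"
  have lin: "linear (f' (y, s))" if "s \<in> {0..T}" for y s
    using d that has_derivative_linear unfolding xderiv_def by blast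
  show "bounded_linear (\<lambda>v. A (\<lambda>q. f' q v) (x, t))"
    using bounded_linear_op[OF f' lin t] by (rule linear_conv_bounded_linear[THEN iffD1])
  fix e :: real assume "e > 0"
  then have "e / (\<kappa> + 1) > 0" using \<kappa>0 by simp
  from xderiv_uniform[OF d f' this] obtain \<delta> where \<delta>: "\<delta> > 0" "\<And>h x t. norm h < \<delta> \<Longrightarrow> t \<in> {0..T} \<Longrightarrow>
    norm (f (x + h, t) - f (x, t) - f' (x, t) h) \<le> e / (\<kappa> + 1) * norm h" by blast
  have "norm (A f (y, t) - A f (x, t) - A (\<lambda>q. f' q (y - x)) (x, t)) \<le> e * norm (y - x)"
    if y: "norm (y - x) < \<delta>" for y
  proof -
    let ?h = "y - x"
    let ?s = "\<lambda>q. f (fst q + ?h, snd q)"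
    have s: "cper {0..T} ?s" by (rule cper_shift[OF f])
    have "A (\<lambda>q. (?s q - f q) - f' q ?h) (x, t) = A f (y, t) - A f (x, t) - A (\<lambda>q. f' q ?h) (x, t)"
      using diff_op[OF cper_diff[OF s f] f' t] diff_op[OF s f t] shift_op[OF f t, of ?h x] by simp
    moreover have "norm (A (\<lambda>q. (?s q - f q) - f' q ?h) (x, t)) \<le> \<kappa> * (e / (\<kappa> + 1) * norm ?h)"
      by (rule bound_op[OF cper_diff[OF cper_diff[OF s f] f'] _ t]) (use \<delta>(2)[OF y] in simp)
    moreover have "\<kappa> * (e / (\<kappa> + 1) * norm ?h) = \<kappa> / (\<kappa> + 1) * (e * norm ?h)" by simp
    moreover have "\<dots> \<le> 1 * (e * norm ?h)"
      by (intro mult_right_mono) (use \<kappa>0 \<open>e > 0\<close> in auto)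
    ultimately show ?thesis by simp
  qed
  then show "\<exists>d>0. \<forall>y. norm (y - x) < d \<longrightarrow>
     norm (A f (y, t) - A f (x, t) - A (\<lambda>q. f' q (y - x)) (x, t)) \<le> e * norm (y - x)"
    using \<delta>(1) by blast
qed

end

section \<open>The heat semigroup on the torus\<close>

definition gauss_average ::
  "(real ^ 'n \<Rightarrow> real) \<Rightarrow> ((real ^ 'n) \<times> real \<Rightarrow> real) \<Rightarrow> real ^ 'n \<Rightarrow> real \<Rightarrow> real \<Rightarrow> real" where
  "gauss_average w f x \<sigma> s = (\<integral>y. f (x + \<sigma> *\<^sub>R y, s) * w y \<partial>gauss)"

text \<open>
  With \<open>P\<^sub>\<tau> g x = E g (x + sqrt (2 * \<tau>) Y)\<close> for a standard Gaussian \<open>Y\<close>, the Duhamel integral of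
  \<open>P\<^sub>t\<^sub>-\<^sub>s (f (\<cdot>, s))\<close> over \<open>s \<in> {0..t}\<close> becomes \<open>duhamel_heat\<close> under \<open>s = t * (1 - r\<^sup>2)\<close>, and the
  one of \<open>\<partial>\<^sub>i P\<^sub>t\<^sub>-\<^sub>s (f (\<cdot>, s))\<close> becomes \<open>duhamel_grad i\<close>, where Gaussian integration by parts has
  moved the derivative to the weight \<open>y $ i\<close>. The same substitution removes the singularity
  \<open>(t - s) powr (-1/2)\<close> of the gradient of the heat kernel.
\<close>

definition duhamel ::
  "(real \<Rightarrow> real) \<Rightarrow> (real \<Rightarrow> real) \<Rightarrow> (real ^ 'n \<Rightarrow> real) \<Rightarrow> ((real ^ 'n) \<times> real \<Rightarrow> real) \<Rightarrow> (real ^ 'n) \<times> real \<Rightarrow> real" where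
  "duhamel a k w f p = a (snd p) * integral {0..1} (\<lambda>r. k r *
     gauss_average w f (fst p) (sqrt (2 * snd p) * r) (snd p * (1 - r\<^sup>2)))"

abbreviation duhamel_grad :: "'n \<Rightarrow> ((real ^ 'n) \<times> real \<Rightarrow> real) \<Rightarrow> (real ^ 'n) \<times> real \<Rightarrow> real" where
  "duhamel_grad i \<equiv> duhamel (\<lambda>t. sqrt (2 * t)) (\<lambda>_. 1) (\<lambda>y. y $ i)"

abbreviation duhamel_heat :: "((real ^ 'n) \<times> real \<Rightarrow> real) \<Rightarrow> (real ^ 'n) \<times> real \<Rightarrow> real" where
  "duhamel_heat \<equiv> duhamel (\<lambda>t. 2 * t) (\<lambda>r. r) (\<lambda>_. 1)"

definition heat_flow :: "((real ^ 'n) \<times> real \<Rightarrow> real) \<Rightarrow> (real ^ 'n) \<times> real \<Rightarrow> real" where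
  "heat_flow f p = gauss_average (\<lambda>_. 1) f (fst p) (sqrt (2 * snd p)) 0"

lemma duhamel_time:
  fixes t r :: real
  assumes "t \<in> {0..T}" "r \<in> {0..1}" shows "t * (1 - r\<^sup>2) \<in> {0..T}"
proof -
  have "0 \<le> 1 - r\<^sup>2" "1 - r\<^sup>2 \<le> 1" using assms(2) by (auto simp: power_le_one)
  then have "0 \<le> t * (1 - r\<^sup>2)" "t * (1 - r\<^sup>2) \<le> t * 1"
    using assms(1) by (auto intro!: mult_nonneg_nonneg mult_left_mono simp del: mult_1_right)
  then show ?thesis using assms(1) by auto
qed

context
  fixes T :: real and w :: "real ^ 'n \<Rightarrow> real"
  assumes T: "0 \<le> T" and w: "continuous_on UNIV w" "integrable gauss w"
begin

lemma cper_line_continuous: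
  assumes "cper {0..T} f" "s \<in> {0..T}"
  shows "continuous_on UNIV (\<lambda>y. f (x + \<sigma> *\<^sub>R y, s))"
  by (rule continuous_on_compose2[OF cper_cont[OF assms(1)]]) (use assms(2) in \<open>auto intro!: continuous_intros\<close>)

lemma integrable_gauss_average:
  assumes "cper {0..T} f" "s \<in> {0..T}"
  shows "integrable gauss (\<lambda>y. f (x + \<sigma> *\<^sub>R y, s) * w y)"
proof -
  obtain M where M: "M \<ge> 0" "\<And>x s. s \<in> {0..T} \<Longrightarrow> norm (f (x, s)) \<le> M"
    using cper_bounded[OF compact_Icc assms(1)] by blast
  have "(\<lambda>y. f (x + \<sigma> *\<^sub>R y, s) * w y) \<in> borel_measurable gauss"
    by (intro continuous_measurable_gauss continuous_on_mult cper_line_continuous assms w)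
  then show ?thesis
    by (rule Bochner_Integration.integrable_bound[OF integrable_mult_right[OF w(2), of M]])
      (use M assms(2) in \<open>auto simp: abs_mult intro!: AE_I2 mult_right_mono\<close>)
qed

lemma gauss_average_linear:
  assumes "cper {0..T} f" "cper {0..T} g" "s \<in> {0..T}"
  shows "gauss_average w (\<lambda>q. f q + c * g q) x \<sigma> s = gauss_average w f x \<sigma> s + c * gauss_average w g x \<sigma> s"
proof -
  have "gauss_average w (\<lambda>q. f q + c * g q) x \<sigma> s =
    (\<integral>y. f (x + \<sigma> *\<^sub>R y, s) * w y + c * (g (x + \<sigma> *\<^sub>R y, s) * w y) \<partial>gauss)"
    unfolding gauss_average_def by (simp add: algebra_simps)
  also have "\<dots> = gauss_average w f x \<sigma> s + c * gauss_average w g x \<sigma> s"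
    unfolding gauss_average_def
    using integrable_gauss_average[OF assms(1,3)] integrable_gauss_average[OF assms(2,3)] by simp
  finally show ?thesis .
qed

lemma gauss_average_bound:
  assumes "cper {0..T} f" "\<And>y. norm (f (y, s)) \<le> M" "s \<in> {0..T}"
  shows "norm (gauss_average w f x \<sigma> s) \<le> M * (\<integral>y. \<bar>w y\<bar> \<partial>gauss)"
proof -
  have "norm (gauss_average w f x \<sigma> s) \<le> (\<integral>y. norm (f (x + \<sigma> *\<^sub>R y, s) * w y) \<partial>gauss)"
    unfolding gauss_average_def by (rule integral_norm_bound)
  also have "\<dots> \<le> (\<integral>y. M * \<bar>w y\<bar> \<partial>gauss)"
    using integrable_norm[OF integrable_gauss_average[OF assms(1,3)]] w(2) assms(2)
    by (intro integral_mono) (auto simp: abs_mult intro!: mult_right_mono)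
  finally show ?thesis by simp
qed

lemma gauss_average_continuous:
  assumes f: "cper {0..T} f"
  shows "continuous_on (UNIV \<times> UNIV \<times> {0..T}) (\<lambda>(x, \<sigma>, s). gauss_average w f x \<sigma> s)"
proof -
  obtain M where M: "M \<ge> 0" "\<And>x s. s \<in> {0..T} \<Longrightarrow> norm (f (x, s)) \<le> M"
    using cper_bounded[OF compact_Icc f] by blast
  have "continuous_on (UNIV \<times> UNIV \<times> {0..T})
    (\<lambda>p. \<integral>y. (\<lambda>p y. f (fst p + fst (snd p) *\<^sub>R y, snd (snd p)) * w y) p y \<partial>gauss)"
  proof (rule continuous_on_gauss_integral)
    show "continuous_on ((UNIV \<times> UNIV \<times> {0..T}) \<times> UNIV)
       (\<lambda>(p, y). f (fst p + fst (snd p) *\<^sub>R y, snd (snd p)) * w y)"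
      unfolding case_prod_beta
      by (intro continuous_on_mult continuous_on_compose2[OF cper_cont[OF f]] continuous_on_compose2[OF w(1)])
        (auto intro!: continuous_intros)
    show "integrable gauss (\<lambda>y. M * \<bar>w y\<bar>)" using w(2) by simp
    show "\<bar>f (fst p + fst (snd p) *\<^sub>R y, snd (snd p)) * w y\<bar> \<le> M * \<bar>w y\<bar>"
      if "p \<in> UNIV \<times> UNIV \<times> {0..T}" for p y
      using that M by (auto simp: abs_mult intro!: mult_right_mono)
  qed
  then show ?thesis by (simp add: gauss_average_def case_prod_beta)
qed

lemma gauss_average_continuous_compose:
  assumes f: "cper {0..T} f" and "continuous_on A X" "continuous_on A \<sigma>" "continuous_on A s"
    and "\<And>p. p \<in> A \<Longrightarrow> s p \<in> {0..T}"
  shows "continuous_on A (\<lambda>p. gauss_average w f (X p) (\<sigma> p) (s p))"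
proof -
  have "continuous_on A (\<lambda>p. case (X p, \<sigma> p, s p) of (x, \<sigma>, s) \<Rightarrow> gauss_average w f x \<sigma> s)"
    by (rule continuous_on_compose2[OF gauss_average_continuous[OF f]])
      (use assms in \<open>auto intro!: continuous_intros\<close>)
  then show ?thesis by simp
qed

lemma gauss_average_periodic:
  assumes "cper {0..T} f" "s \<in> {0..T}" "\<And>i. k $ i \<in> \<int>"
  shows "gauss_average w f (x + k) \<sigma> s = gauss_average w f x \<sigma> s"
proof -
  have "f (x + k + \<sigma> *\<^sub>R y, s) = f (x + \<sigma> *\<^sub>R y, s)" for y
    using cper_per[OF assms, of "x + \<sigma> *\<^sub>R y"] by (simp add: add_ac)
  then show ?thesis unfolding gauss_average_def by simp
qed

lemma gauss_average_shift:
  "gauss_average w (\<lambda>q. f (fst q + h, snd q)) x \<sigma> s = gauss_average w f (x + h) \<sigma> s"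
  unfolding gauss_average_def by (simp add: add_ac)

lemma duhamel_invariant_operator:
  assumes a: "continuous_on {0..T} a" "\<And>t. t \<in> {0..T} \<Longrightarrow> \<bar>a t\<bar> \<le> \<kappa>"
    and k: "continuous_on {0..1} k" "\<And>r. r \<in> {0..1} \<Longrightarrow> \<bar>k r\<bar> \<le> 1"
    and w1: "(\<integral>y. \<bar>w y\<bar> \<partial>gauss) \<le> 1"
  shows "invariant_operator T \<kappa> (duhamel a k w)"
proof
  note s = duhamel_time
  have cr: "continuous_on {0..1} (\<lambda>r. k r * gauss_average w f x (sqrt (2 * t) * r) (t * (1 - r\<^sup>2)))"
    if "cper {0..T} f" "t \<in> {0..T}" for f x t
    by (intro continuous_on_mult k gauss_average_continuous_compose that continuous_intros s)
  show "0 \<le> T" by (rule T)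
  show "0 \<le> \<kappa>" using a(2)[of 0] T by auto
  fix f :: "(real ^ 'n) \<times> real \<Rightarrow> real" assume f: "cper {0..T} f"
  show "cper {0..T} (duhamel a k w f)"
    unfolding cper_def
  proof (intro conjI allI ballI impI)
    show "continuous_on (UNIV \<times> {0..T}) (duhamel a k w f)"
      unfolding duhamel_def
    proof (rule continuous_on_mult)
      show "continuous_on (UNIV \<times> {0..T}) (\<lambda>p. a (snd p))"
        by (rule continuous_on_compose2[OF a(1)]) (auto intro!: continuous_intros)
      have "continuous_on (UNIV \<times> {0..T}) (\<lambda>p. integral (cbox 0 1) (\<lambda>r. k r *
          gauss_average w f (fst p) (sqrt (2 * snd p) * r) (snd p * (1 - r\<^sup>2))))"
      proof (rule integral_continuous_on_param)
        show "continuous_on ((UNIV \<times> {0..T}) \<times> cbox 0 1) (\<lambda>(p, r). k r *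
          gauss_average w f (fst p) (sqrt (2 * snd p) * r) (snd p * (1 - r\<^sup>2)))"
          unfolding case_prod_beta
          by (intro continuous_on_mult continuous_on_compose2[OF k(1)] gauss_average_continuous_compose f
              continuous_intros s) auto
      qed
      then show "continuous_on (UNIV \<times> {0..T}) (\<lambda>p. integral {0..1} (\<lambda>r. k r *
          gauss_average w f (fst p) (sqrt (2 * snd p) * r) (snd p * (1 - r\<^sup>2))))" by simp
    qed
  next
    fix x k' :: "real ^ 'n" and t :: real assume "t \<in> {0..T}" "\<forall>i. k' $ i \<in> \<int>"
    then show "duhamel a k w f (x + k', t) = duhamel a k w f (x, t)"
      unfolding duhamel_def fst_conv snd_conv
      by (intro arg_cong2[where f="(*)"] refl integral_cong gauss_average_periodic[OF f] s) auto
  qed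
  fix x :: "real ^ 'n" and t assume t: "t \<in> {0..T}"
  show "duhamel a k w (\<lambda>q. f (fst q + h, snd q)) (x, t) = duhamel a k w f (x + h, t)" for h
    unfolding duhamel_def by (simp add: gauss_average_shift)
  show "norm (duhamel a k w f (x, t)) \<le> \<kappa> * M" if M: "\<And>y s. s \<in> {0..T} \<Longrightarrow> norm (f (y, s)) \<le> M" for M
  proof -
    have M0: "0 \<le> M" using M[of 0 0] T norm_ge_zero order_trans by force
    have "norm (integral {0..1} (\<lambda>r. k r * gauss_average w f x (sqrt (2 * t) * r) (t * (1 - r\<^sup>2)))) \<le> M * (1 - 0)"
    proof (rule integral_bound[OF _ cr[OF f t]])
      fix r :: real assume r: "r \<in> {0..1}"
      have "norm (gauss_average w f x (sqrt (2 * t) * r) (t * (1 - r\<^sup>2))) \<le> M * (\<integral>y. \<bar>w y\<bar> \<partial>gauss)"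
        by (rule gauss_average_bound[OF f M s[OF t r]]) (rule s[OF t r])
      also have "\<dots> \<le> M * 1" by (rule mult_left_mono[OF w1 M0])
      finally show "norm (k r * gauss_average w f x (sqrt (2 * t) * r) (t * (1 - r\<^sup>2))) \<le> M"
        using mult_mono[OF k(2)[OF r], of _ M] by (simp add: abs_mult)
    qed simp
    then show ?thesis
      unfolding duhamel_def using mult_mono[OF a(2)[OF t]] a(2)[OF t] by (auto simp: abs_mult intro!: mult_mono)
  qed
  fix g :: "(real ^ 'n) \<times> real \<Rightarrow> real" and c assume g: "cper {0..T} g"
  have "integral {0..1} (\<lambda>r. k r * gauss_average w (\<lambda>q. f q + c * g q) x (sqrt (2 * t) * r) (t * (1 - r\<^sup>2)))
    = integral {0..1} (\<lambda>r. k r * gauss_average w f x (sqrt (2 * t) * r) (t * (1 - r\<^sup>2))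
        + c * (k r * gauss_average w g x (sqrt (2 * t) * r) (t * (1 - r\<^sup>2))))"
    by (rule integral_cong, subst gauss_average_linear[OF f g s[OF t]], assumption)
      (simp add: distrib_left mult.left_commute)
  also have "\<dots> = integral {0..1} (\<lambda>r. k r * gauss_average w f x (sqrt (2 * t) * r) (t * (1 - r\<^sup>2)))
        + c * integral {0..1} (\<lambda>r. k r * gauss_average w g x (sqrt (2 * t) * r) (t * (1 - r\<^sup>2)))"
    using integrable_continuous_real[OF cr[OF f t]] integrable_continuous_real[OF cr[OF g t]]
    by (subst integral_add) (auto intro: integrable_on_mult_right)
  finally show "duhamel a k w (\<lambda>q. f q + c *\<^sub>R g q) (x, t) = duhamel a k w f (x, t) + c *\<^sub>R duhamel a k w g (x, t)"
    unfolding duhamel_def by (simp add: algebra_simps)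
qed

end

lemma prob_gauss [simp]: "measure gauss (UNIV :: (real ^ 'n) set) = 1"
  using gauss.prob_space by simp

lemma integrable_gauss_const: "integrable gauss (\<lambda>_. c::real)"
  by simp

lemma duhamel_grad_operator:
  assumes "0 \<le> T" shows "invariant_operator T (sqrt (2 * T)) (duhamel_grad i)"
  by (rule duhamel_invariant_operator[OF assms _ gauss_component_moments(2)])
    (auto intro!: continuous_intros gauss_component_moments)

lemma duhamel_heat_operator:
  assumes "0 \<le> T" shows "invariant_operator T (2 * T) (duhamel_heat :: ((real ^ 'n) \<times> real \<Rightarrow> real) \<Rightarrow> _)"
  by (rule duhamel_invariant_operator[OF assms _ integrable_gauss_const])
    (auto intro!: continuous_intros simp: gauss.prob_space)

lemma heat_flow_operator:
  assumes T: "0 \<le> T"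
  shows "invariant_operator T 1 (heat_flow :: ((real ^ 'n) \<times> real \<Rightarrow> real) \<Rightarrow> _)"
proof
  note W = T continuous_on_const integrable_gauss_const
  have z: "0 \<in> {0..T}" using T by simp
  fix f :: "(real ^ 'n) \<times> real \<Rightarrow> real" assume f: "cper {0..T} f"
  show "cper {0..T} (heat_flow f)"
    unfolding cper_def heat_flow_def fst_conv snd_conv
    by (intro conjI allI ballI impI gauss_average_periodic[OF W f z] gauss_average_continuous_compose[OF W f] continuous_intros)
      (use z in auto)
  fix x :: "real ^ 'n" and t assume t: "t \<in> {0..T}"
  show "heat_flow (\<lambda>q. f (fst q + h, snd q)) (x, t) = heat_flow f (x + h, t)" for h
    unfolding heat_flow_def by (simp add: gauss_average_shift[OF W])
  show "norm (heat_flow f (x, t)) \<le> 1 * M" if M: "\<And>y s. s \<in> {0..T} \<Longrightarrow> norm (f (y, s)) \<le> M" for M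
    using gauss_average_bound[OF T continuous_on_const integrable_gauss_const[of 1] f M[OF z] z,
        where x=x and \<sigma>="sqrt (2 * t)"]
    by (simp add: heat_flow_def)
  fix g :: "(real ^ 'n) \<times> real \<Rightarrow> real" and c assume g: "cper {0..T} g"
  show "heat_flow (\<lambda>q. f q + c *\<^sub>R g q) (x, t) = heat_flow f (x, t) + c *\<^sub>R heat_flow g (x, t)"
    using gauss_average_linear[OF W f g z] by (simp add: heat_flow_def)
qed (use T in auto)

lemma heat_flow_lower_bound:
  assumes T: "0 \<le> T" and f: "cper {0..T} f" and c: "\<And>y. c \<le> f (y, 0)"
  shows "c \<le> heat_flow f (x, t)"
proof -
  have z: "0 \<in> {0..T}" using T by simp
  have "c = (\<integral>y. c \<partial>(gauss :: (real ^ 'a) measure))" by (simp add: gauss.prob_space)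
  also have "\<dots> \<le> (\<integral>y. f (x + sqrt (2 * t) *\<^sub>R y, 0) * 1 \<partial>gauss)"
    by (rule integral_mono)
      (use c integrable_gauss_average[OF T continuous_on_const integrable_gauss_const f z, of x _ 1] in auto)
  finally show ?thesis by (simp add: heat_flow_def gauss_average_def)
qed

lemma xderiv_axis_DERIV:
  assumes "xderiv T f f'" "s \<in> {0..T}"
  shows "((\<lambda>h. f (x + h *\<^sub>R v, s)) has_real_derivative f' (x, s) v) (at 0)"
proof -
  have d: "((\<lambda>y. f (y, s)) has_derivative f' (x, s)) (at (x + 0 *\<^sub>R v))"
    using assms by (simp add: xderiv_def)
  have "((\<lambda>h. x + h *\<^sub>R v) has_derivative (\<lambda>h. h *\<^sub>R v)) (at 0)"
    by (auto intro!: derivative_eq_intros)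
  from has_derivative_compose[OF this d]
  have "((\<lambda>h. f (x + h *\<^sub>R v, s)) has_derivative (\<lambda>h. f' (x, s) (h *\<^sub>R v))) (at 0)" .
  then show ?thesis
    using linear_cmul[OF has_derivative_linear[OF d]]
    by (simp add: has_field_derivative_def mult.commute[of _ "f' _ _"])
qed

text \<open>
  One factor \<open>\<sigma>\<close> is gained against the weight \<open>y $ i\<close>, since \<open>y \<mapsto> f (x + \<sigma> *\<^sub>R y, s)\<close> has the derivative
  \<open>\<sigma> * \<partial>\<^sub>i f\<close>.
\<close>

lemma gauss_average_stein:
  fixes f :: "(real ^ 'n) \<times> real \<Rightarrow> real"
  assumes f: "cper {0..T} f" and d: "xderiv T f f'" and g: "cper {0..T} (\<lambda>p. f' p (axis i 1))"
    and s: "s \<in> {0..T}"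
  shows "gauss_average (\<lambda>y. y $ i) f x \<sigma> s = \<sigma> * gauss_average (\<lambda>_. 1) (\<lambda>p. f' p (axis i 1)) x \<sigma> s"
proof -
  have T: "0 \<le> T" using s by auto
  obtain M where M: "\<And>x s. s \<in> {0..T} \<Longrightarrow> norm (f (x, s)) \<le> M"
    using cper_bounded[OF compact_Icc f] by metis
  obtain N where N: "\<And>x s. s \<in> {0..T} \<Longrightarrow> norm (f' (x, s) (axis i 1)) \<le> N"
    using cper_bounded[OF compact_Icc g] by metis
  have "(\<integral>y. f (x + \<sigma> *\<^sub>R y, s) * y $ i \<partial>gauss) = (\<integral>y. \<sigma> * f' (x + \<sigma> *\<^sub>R y, s) (axis i 1) \<partial>gauss)"
  proof (rule stein)
    show "((\<lambda>h. f (x + \<sigma> *\<^sub>R (y + h *\<^sub>R axis i 1), s)) has_real_derivative \<sigma> * f' (x + \<sigma> *\<^sub>R y, s) (axis i 1)) (at 0)" for y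
    proof -
      have "((\<lambda>h. f (x + \<sigma> *\<^sub>R y + h *\<^sub>R (\<sigma> *\<^sub>R axis i 1), s)) has_real_derivative f' (x + \<sigma> *\<^sub>R y, s) (\<sigma> *\<^sub>R axis i 1)) (at 0)"
        by (rule xderiv_axis_DERIV[OF d s])
      moreover have "linear (f' (x + \<sigma> *\<^sub>R y, s))"
        using d s has_derivative_linear unfolding xderiv_def by blast
      ultimately show ?thesis by (simp add: linear_cmul algebra_simps)
    qed
    show "continuous_on UNIV (\<lambda>y. f (x + \<sigma> *\<^sub>R y, s))" "continuous_on UNIV (\<lambda>y. \<sigma> * f' (x + \<sigma> *\<^sub>R y, s) (axis i 1))"
      using cper_line_continuous[OF T continuous_on_const integrable_gauss_const f s]
        cper_line_continuous[OF T continuous_on_const integrable_gauss_const g s]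
      by (auto intro!: continuous_intros)
    have "\<bar>\<sigma>\<bar> * \<bar>f' (y, s) (axis i 1)\<bar> \<le> \<bar>\<sigma>\<bar> * N" for y
      using N[OF s, of y] by (intro mult_left_mono) auto
    then show "\<bar>\<sigma> * f' (x + \<sigma> *\<^sub>R y, s) (axis i 1)\<bar> \<le> max M (\<bar>\<sigma>\<bar> * N)" for y
      by (auto simp: abs_mult le_max_iff_disj)
    show "\<bar>f (x + \<sigma> *\<^sub>R y, s)\<bar> \<le> max M (\<bar>\<sigma>\<bar> * N)" for y
      using M[OF s, of "x + \<sigma> *\<^sub>R y"] by (auto simp: le_max_iff_disj)
  qed
  then show ?thesis by (simp add: gauss_average_def)
qed

text \<open>
  For a differentiable source, differentiating the kernel or the source gives the same result. The left
  side makes sense for continuous sources and has the small norm, the right side satisfies a heat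
  equation.
\<close>

lemma duhamel_grad_eq_heat:
  fixes f :: "(real ^ 'n) \<times> real \<Rightarrow> real"
  assumes f: "cper {0..T} f" and d: "xderiv T f f'" and g: "cper {0..T} (\<lambda>p. f' p (axis i 1))"
    and t: "t \<in> {0..T}"
  shows "duhamel_grad i f (x, t) = duhamel_heat (\<lambda>p. f' p (axis i 1)) (x, t)"
proof -
  let ?G = "\<lambda>r. gauss_average (\<lambda>_. 1) (\<lambda>p. f' p (axis i 1)) x (sqrt (2 * t) * r) (t * (1 - r\<^sup>2))"
  note s = duhamel_time[OF t]
  have "integral {0..1} (\<lambda>r. 1 * gauss_average (\<lambda>y. y $ i) f x (sqrt (2 * t) * r) (t * (1 - r\<^sup>2)))
    = integral {0..1} (\<lambda>r. sqrt (2 * t) * (r * ?G r))"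
    by (rule integral_cong, subst gauss_average_stein[OF f d g s], assumption) simp
  also have "\<dots> = sqrt (2 * t) * integral {0..1} (\<lambda>r. r * ?G r)" by simp
  finally show ?thesis using t by (simp add: duhamel_def)
qed

text \<open>
  The functions \<open>f\<close> with Laplacian \<open>l\<close> for which the heat equation will be verified; the continuity of
  all second derivatives is what permits the second integration by parts in \<open>gauss_average_DERIV\<close>.
\<close>

definition heat_class :: "real \<Rightarrow> ((real ^ 'n) \<times> real \<Rightarrow> real) \<Rightarrow> ((real ^ 'n) \<times> real \<Rightarrow> real) \<Rightarrow> bool" where
  "heat_class T f l \<longleftrightarrow> cper {0..T} f \<and> (\<exists>f' f''. xderiv T f f' \<and> (\<forall>v. cper {0..T} (\<lambda>p. f' p v)) \<and>
     (\<forall>v. xderiv T (\<lambda>p. f' p v) (f'' v)) \<and> (\<forall>v w. cper {0..T} (\<lambda>p. f'' v p w)) \<and>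
     (\<forall>p. l p = (\<Sum>i\<in>UNIV. f'' (axis i 1) p (axis i 1))))"

lemma heat_class_laplacian_cper: "heat_class T f l \<Longrightarrow> cper {0..T} l"
  unfolding heat_class_def fun_eq_iff[symmetric] by (auto intro!: cper_sum)

text \<open>
  Differentiation under the integral produces \<open>E (Df (x + \<sigma> Y) \<cdot> Y)\<close>, and Stein's identity in each
  coordinate turns this into \<open>\<sigma> * E (\<Delta>f (x + \<sigma> Y))\<close>. With \<open>\<sigma> = sqrt (2 * \<tau>)\<close> this is the heat equation.
\<close>

lemma gauss_average_DERIV:
  fixes f :: "(real ^ 'n) \<times> real \<Rightarrow> real"
  assumes f: "heat_class T f l" and s: "s \<in> {0..T}"
  shows "((\<lambda>\<sigma>. gauss_average (\<lambda>_. 1) f x \<sigma> s) has_real_derivative \<sigma> * gauss_average (\<lambda>_. 1) l x \<sigma> s) (at \<sigma>)"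
proof -
  have T: "0 \<le> T" using s by auto
  obtain f' f'' where F: "cper {0..T} f" "xderiv T f f'" "\<And>v. cper {0..T} (\<lambda>p. f' p v)"
      "\<And>v. xderiv T (\<lambda>p. f' p v) (f'' v)" "\<And>v w. cper {0..T} (\<lambda>p. f'' v p w)"
      "l = (\<lambda>p. \<Sum>i\<in>UNIV. f'' (axis i 1) p (axis i 1))"
    using f unfolding heat_class_def by (auto simp: fun_eq_iff)
  note W = T continuous_on_const integrable_gauss_const[of 1]
  have lin: "linear (f' (y, s))" for y
    using F(2) s has_derivative_linear unfolding xderiv_def by blast
  have rep: "f' (y, s) v = (\<Sum>i\<in>UNIV. f' (y, s) (axis i 1) * v $ i)" for y v
  proof -
    have "f' (y, s) v = f' (y, s) (\<Sum>i\<in>UNIV. v $ i *\<^sub>R axis i 1)"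
      by (simp add: basis_expansion scalar_mult_eq_scaleR[symmetric])
    then show ?thesis by (simp add: linear_sum[OF lin] linear_cmul[OF lin] mult.commute)
  qed
  have "\<exists>M. M \<ge> 0 \<and> (\<forall>y. \<bar>f' (y, s) (axis i 1)\<bar> \<le> M)" for i
    using cper_bounded[OF compact_Icc F(3)[of "axis i 1"]] s by (metis real_norm_def)
  then obtain M where M: "\<And>i. M i \<ge> 0" "\<And>i y. \<bar>f' (y, s) (axis i 1)\<bar> \<le> M i" by metis
  have ci: "continuous_on UNIV (\<lambda>y. f' (x + \<sigma> *\<^sub>R y, s) (axis i 1) * y $ i)" for \<sigma> i
    by (intro continuous_on_mult cper_line_continuous[OF W F(3) s] continuous_intros)
  have "((\<lambda>\<sigma>. \<integral>y. f (x + \<sigma> *\<^sub>R y, s) \<partial>gauss) has_real_derivative (\<integral>y. f' (x + \<sigma> *\<^sub>R y, s) y \<partial>gauss)) (at \<sigma>)"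
  proof (rule DERIV_gauss_integral)
    show "((\<lambda>\<sigma>. f (x + \<sigma> *\<^sub>R y, s)) has_real_derivative f' (x + \<sigma> *\<^sub>R y, s) y) (at \<sigma>)" for \<sigma> y
      using xderiv_axis_DERIV[OF F(2) s, of "x + \<sigma> *\<^sub>R y" y]
        DERIV_shift[of "\<lambda>\<sigma>. f (x + \<sigma> *\<^sub>R y, s)" _ 0 \<sigma>] by (simp add: algebra_simps)
    show "(\<lambda>y. f (x + \<sigma> *\<^sub>R y, s)) \<in> borel_measurable gauss" for \<sigma>
      by (intro continuous_measurable_gauss cper_line_continuous[OF W F(1) s])
    show "(\<lambda>y. f' (x + \<sigma> *\<^sub>R y, s) y) \<in> borel_measurable gauss" for \<sigma>
      by (subst rep) (intro continuous_measurable_gauss continuous_on_sum ci)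
    show "integrable gauss (\<lambda>y. f (x + \<sigma> *\<^sub>R y, s))" for \<sigma>
      using integrable_gauss_average[OF W F(1) s] by simp
    show "integrable gauss (\<lambda>y. \<Sum>i\<in>UNIV. M i * \<bar>y $ i\<bar>)"
      by (intro Bochner_Integration.integrable_sum integrable_mult_right integrable_abs gauss_component_moments(2))
    show "\<bar>f' (x + \<sigma> *\<^sub>R y, s) y\<bar> \<le> (\<Sum>i\<in>UNIV. M i * \<bar>y $ i\<bar>)" for \<sigma> y
      by (subst rep, rule order_trans[OF sum_abs])
        (use M(2) in \<open>auto simp: abs_mult intro!: sum_mono mult_right_mono\<close>)
  qed
  also have "(\<integral>y. f' (x + \<sigma> *\<^sub>R y, s) y \<partial>gauss) = (\<Sum>i\<in>UNIV. gauss_average (\<lambda>y. y $ i) (\<lambda>p. f' p (axis i 1)) x \<sigma> s)"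
    unfolding gauss_average_def
    by (subst rep, subst Bochner_Integration.integral_sum)
      (auto intro!: integrable_gauss_average[OF T _ gauss_component_moments(2) F(3) s] continuous_intros)
  also have "\<dots> = (\<Sum>i\<in>UNIV. \<sigma> * gauss_average (\<lambda>_. 1) (\<lambda>p. f'' (axis i 1) p (axis i 1)) x \<sigma> s)"
    using gauss_average_stein[OF F(3) F(4) F(5) s] by simp
  also have "\<dots> = \<sigma> * gauss_average (\<lambda>_. 1) l x \<sigma> s"
  proof -
    have "(\<Sum>i\<in>UNIV. gauss_average (\<lambda>_. 1) (\<lambda>p. f'' (axis i 1) p (axis i 1)) x \<sigma> s) = gauss_average (\<lambda>_. 1) l x \<sigma> s"
      unfolding gauss_average_def F(6)
      using integrable_gauss_average[OF W F(5) s] by simp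
    then show ?thesis by (simp add: sum_distrib_left[symmetric])
  qed
  finally show ?thesis by (simp add: gauss_average_def)
qed

lemma gauss_average_time_derivative:
  fixes f :: "(real ^ 'n) \<times> real \<Rightarrow> real"
  assumes f: "heat_class T f l" and s: "s \<in> {0..T}" and \<tau>: "0 < \<tau>"
  shows "((\<lambda>\<tau>. gauss_average (\<lambda>_. 1) f x (sqrt (2 * \<tau>)) s) has_vector_derivative
    gauss_average (\<lambda>_. 1) l x (sqrt (2 * \<tau>)) s) (at \<tau>)"
proof -
  have "((\<lambda>\<tau>. sqrt (2 * \<tau>)) has_real_derivative 1 / sqrt (2 * \<tau>)) (at \<tau>)"
    using \<tau> by (auto intro!: derivative_eq_intros simp: field_simps)
  from DERIV_chain2[OF gauss_average_DERIV[OF f s] this]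
  show ?thesis using \<tau> by (simp add: has_real_derivative_iff_has_vector_derivative)
qed

text \<open>
  One-sided derivatives at the end points come for free when the derivative extends continuously: at
  elapsed time zero the formula for \<open>\<tau> \<mapsto> sqrt (2 * \<tau>)\<close> is not differentiable, but the heat flow is.
\<close>

lemma DERIV_closed_interval:
  fixes f :: "real \<Rightarrow> real"
  assumes f: "continuous_on {a..b} f" and f': "continuous_on {a..b} f'" and "finite S"
    and d: "\<And>x. x \<in> {a<..<b} - S \<Longrightarrow> (f has_vector_derivative f' x) (at x)" and x: "x \<in> {a..b}"
  shows "(f has_vector_derivative f' x) (at x within {a..b})"
proof -
  have int: "(f' has_integral f u - f a) {a..u}" if "u \<in> {a..b}" for u
    by (rule fundamental_theorem_of_calculus_interior_strong[OF \<open>finite S\<close>])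
      (use that d in \<open>auto intro: continuous_on_subset[OF f]\<close>)
  have "((\<lambda>u. f a + integral {a..u} f') has_vector_derivative 0 + f' x) (at x within {a..b})"
    by (intro has_vector_derivative_add has_vector_derivative_const integral_has_vector_derivative f' x)
  then have "((\<lambda>u. f a + integral {a..u} f') has_vector_derivative f' x) (at x within {a..b})" by simp
  then show ?thesis
    by (rule has_vector_derivative_transform[OF x, rotated]) (use integral_unique[OF int] in auto)
qed

text \<open>Differentiation of a convolution in time that is only continuous in its second argument, so
  that the derivative must fall on the first one. Extending \<open>g\<close> linearly to negative times
  turns the integral into a \<open>C\<^sup>1\<close> function of its upper limit and of \<open>t\<close> separately.\<close>

lemma DERIV_time_convolution:
  fixes g l :: "real \<Rightarrow> real \<Rightarrow> real"
  assumes T: "0 \<le> T"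
    and g: "continuous_on ({0..T} \<times> {0..T}) (\<lambda>(\<tau>, s). g \<tau> s)"
    and l: "continuous_on ({0..T} \<times> {0..T}) (\<lambda>(\<tau>, s). l \<tau> s)"
    and d: "\<And>\<tau> s. s \<in> {0..T} \<Longrightarrow> 0 < \<tau> \<Longrightarrow> \<tau> < T \<Longrightarrow> ((\<lambda>\<tau>. g \<tau> s) has_vector_derivative l \<tau> s) (at \<tau>)"
    and t: "t \<in> {0..T}"
  shows "((\<lambda>t. integral {0..t} (\<lambda>s. g (t - s) s)) has_vector_derivative
    g 0 t + integral {0..t} (\<lambda>s. l (t - s) s)) (at t within {0..T})"
proof -
  define gg where "gg \<tau> s = g (max \<tau> 0) s + min \<tau> 0 * l 0 s" for \<tau> s
  define ll where "ll \<tau> s = l (max \<tau> 0) s" for \<tau> s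
  have cg: "continuous_on A (\<lambda>p. g (\<sigma> p) (s p))" and cl: "continuous_on A (\<lambda>p. l (\<sigma> p) (s p))"
    if "continuous_on A \<sigma>" "continuous_on A s" "\<And>p. p \<in> A \<Longrightarrow> \<sigma> p \<in> {0..T} \<and> s p \<in> {0..T}"
    for A :: "'z::topological_space set" and \<sigma> s
    using continuous_on_compose2[OF g continuous_on_Pair[OF that(1,2)]]
      continuous_on_compose2[OF l continuous_on_Pair[OF that(1,2)]] that(3)
    by (simp_all add: image_subset_iff)
  have cgg: "continuous_on A (\<lambda>p. gg (\<sigma> p) (s p))" and cll: "continuous_on A (\<lambda>p. ll (\<sigma> p) (s p))"
    if "continuous_on A \<sigma>" "continuous_on A s" "\<And>p. p \<in> A \<Longrightarrow> \<sigma> p \<in> {-T..T} \<and> s p \<in> {0..T}"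
    for A :: "'z::topological_space set" and \<sigma> s
    unfolding gg_def ll_def using that T
    by (auto intro!: continuous_intros cg cl)
  have dgg: "((\<lambda>\<tau>. gg \<tau> s) has_vector_derivative ll \<tau> s) (at \<tau> within {-T..T})"
    if s: "s \<in> {0..T}" and \<tau>: "\<tau> \<in> {-T..T}" for \<tau> s
  proof -
    have der: "((\<lambda>\<tau>. gg \<tau> s) has_vector_derivative ll \<tau> s) (at \<tau>)" if "\<tau> \<in> {-T<..<T} - {0}" for \<tau>
    proof (cases "\<tau> > 0")
      case True
      then have "((\<lambda>\<tau>. g \<tau> s) has_vector_derivative ll \<tau> s) (at \<tau>)"
        using d[OF s True] that by (simp add: ll_def)
      then show ?thesis
        by (rule has_vector_derivative_transform_within_open[where S="{0<..}"]) (use True in \<open>auto simp: gg_def\<close>)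
    next
      case False
      have "((\<lambda>\<tau>. g 0 s + \<tau> * l 0 s) has_vector_derivative ll \<tau> s) (at \<tau>)"
        using False that by (auto simp: ll_def intro!: derivative_eq_intros)
      then show ?thesis
        by (rule has_vector_derivative_transform_within_open[where S="{..<0}"]) (use False that in \<open>auto simp: gg_def\<close>)
    qed
    show ?thesis
      by (rule DERIV_closed_interval[where S="{0}"]) (use der s \<tau> in \<open>auto intro!: cgg cll continuous_intros\<close>)
  qed
  let ?J = "\<lambda>\<tau> t. integral {0..\<tau>} (\<lambda>s. ll (t - s) s)"
  have Jeq: "?J \<tau> t = \<tau> * integral (cbox 0 1) (\<lambda>r. ll (t - \<tau> * r) (\<tau> * r))" if "\<tau> \<in> {0..T}" "t \<in> {0..T}" for \<tau> t
  proof -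
    have "((\<lambda>r. \<tau> *\<^sub>R ll (t - \<tau> * r) (\<tau> * r)) has_integral (integral {\<tau> * 0..\<tau> * 1} (\<lambda>s. ll (t - s) s))) {0..1}"
    proof (rule has_integral_substitution[where c=0 and d=\<tau>])
      show "continuous_on {0..\<tau>} (\<lambda>s. ll (t - s) s)"
        by (rule cll) (use that in \<open>auto intro!: continuous_intros\<close>)
      show "((\<lambda>r. \<tau> * r) has_real_derivative \<tau>) (at x within {0..1})" for x
        by (auto intro!: derivative_eq_intros)
    qed (use that in \<open>auto simp: mult_left_le\<close>)
    from integral_unique[OF this] show ?thesis by simp
  qed
  have cJ: "continuous_on ({0..T} \<times> {0..T}) (\<lambda>(\<tau>, t). ?J \<tau> t)"
  proof -
    have "continuous_on ({0..T} \<times> {0..T}) (\<lambda>p. fst p * integral (cbox 0 1) (\<lambda>r. ll (snd p - fst p * r) (fst p * r)))"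
    proof (intro continuous_on_mult continuous_on_fst continuous_on_id integral_continuous_on_param)
      have *: "0 \<le> \<tau> * r \<and> \<tau> * r \<le> T" if "\<tau> \<in> {0..T}" "r \<in> {0..1}" for \<tau> r
        using that mult_mono[of \<tau> T r 1] by auto
      have **: "- T \<le> t' - \<tau> * r \<and> t' - \<tau> * r \<le> T" if "\<tau> \<in> {0..T}" "r \<in> {0..1}" "t' \<in> {0..T}" for \<tau> r t'
        using *[OF that(1,2)] that(3) by auto
      show "continuous_on (({0..T} \<times> {0..T}) \<times> cbox 0 1) (\<lambda>(p, r). ll (snd p - fst p * r) (fst p * r))"
        unfolding case_prod_beta
        by (rule cll) (use * ** in \<open>auto intro!: continuous_intros\<close>)
    qed
    then show ?thesis
      by (rule continuous_on_eq) (use Jeq in \<open>auto simp: case_prod_beta\<close>)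
  qed
  have "((\<lambda>(\<tau>, t). integral {0..\<tau>} (\<lambda>s. gg (t - s) s)) has_derivative
      (\<lambda>(a, b). a *\<^sub>R gg (t - t) t + blinfun_apply (blinfun_scaleR_left (?J t t)) b)) (at (t, t) within {0..T} \<times> {0..T})"
  proof (rule has_derivative_partialsI[where fy="\<lambda>\<tau> t. blinfun_scaleR_left (?J \<tau> t)"])
    show "((\<lambda>\<tau>. integral {0..\<tau>} (\<lambda>s. gg (t - s) s)) has_derivative (\<lambda>a. a *\<^sub>R gg (t - t) t)) (at t within {0..T})"
      unfolding has_vector_derivative_def[symmetric]
      by (rule integral_has_vector_derivative[OF cgg t]) (use t in \<open>auto intro!: continuous_intros\<close>)
    show "((\<lambda>t. integral {0..\<tau>} (\<lambda>s. gg (t - s) s)) has_derivative blinfun_apply (blinfun_scaleR_left (?J \<tau> t'))) (at t' within {0..T})"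
      if \<tau>: "\<tau> \<in> {0..T}" and t': "t' \<in> {0..T}" for \<tau> t'
    proof -
      have "((\<lambda>t. integral (cbox 0 \<tau>) (\<lambda>s. gg (t - s) s)) has_vector_derivative integral (cbox 0 \<tau>) (\<lambda>s. ll (t' - s) s)) (at t' within {0..T})"
      proof (rule leibniz_rule_vector_derivative[OF _ _ _ t'])
        show "((\<lambda>t. gg (t - s) s) has_vector_derivative ll (t - s) s) (at t within {0..T})"
          if "t \<in> {0..T}" "s \<in> cbox 0 \<tau>" for t s
        proof -
          have "(((\<lambda>\<tau>. gg \<tau> s) \<circ> (\<lambda>t. t - s)) has_vector_derivative 1 *\<^sub>R ll (t - s) s) (at t within {0..T})"
          proof (rule vector_diff_chain_within)
            show "((\<lambda>t. t - s) has_vector_derivative 1) (at t within {0..T})"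
              by (auto intro!: derivative_eq_intros)
            show "((\<lambda>\<tau>. gg \<tau> s) has_vector_derivative ll (t - s) s) (at (t - s) within (\<lambda>t. t - s) ` {0..T})"
              by (rule has_vector_derivative_within_subset[OF dgg]) (use that \<tau> in auto)
          qed
          then show ?thesis by (simp add: comp_def)
        qed
        show "(\<lambda>s. gg (t - s) s) integrable_on cbox 0 \<tau>" if "t \<in> {0..T}" for t
          by (rule integrable_continuous, rule cgg) (use that \<tau> in \<open>auto intro!: continuous_intros\<close>)
        show "continuous_on ({0..T} \<times> cbox 0 \<tau>) (\<lambda>(t, s). ll (t - s) s)"
          unfolding case_prod_beta
          by (rule cll) (use \<tau> in \<open>auto intro!: continuous_intros\<close>)
      qed simp
      then show ?thesis by (simp add: has_vector_derivative_def)
    qed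
    have "continuous_on ({0..T} \<times> {0..T}) (\<lambda>p. blinfun_scaleR_left (case p of (\<tau>, t) \<Rightarrow> ?J \<tau> t) :: real \<Rightarrow>\<^sub>L real)"
      by (rule bounded_linear.continuous_on[OF bounded_linear_blinfun_scaleR_left cJ])
    then show "continuous (at (t, t) within {0..T} \<times> {0..T}) (\<lambda>(\<tau>, t). blinfun_scaleR_left (?J \<tau> t) :: real \<Rightarrow>\<^sub>L real)"
      using t by (auto simp: continuous_on_eq_continuous_within case_prod_unfold)
  qed (use t in auto)
  note main = this
  have "((\<lambda>t. (t, t)) has_derivative (\<lambda>h. (h, h))) (at t within {0..T})"
    by (auto intro!: derivative_eq_intros)
  from has_derivative_in_compose[OF this has_derivative_subset[OF main]]
  have "((\<lambda>t. integral {0..t} (\<lambda>s. gg (t - s) s)) has_vector_derivative gg 0 t + ?J t t) (at t within {0..T})"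
    by (auto simp: has_vector_derivative_def algebra_simps image_subset_iff)
  moreover have "integral {0..t} (\<lambda>s. gg (t - s) s) = integral {0..t} (\<lambda>s. g (t - s) s)" for t
    by (rule integral_cong) (auto simp: gg_def)
  moreover have "?J t t = integral {0..t} (\<lambda>s. l (t - s) s)"
    by (rule integral_cong) (auto simp: ll_def)
  ultimately show ?thesis by (simp add: gg_def)
qed


lemma gauss_average_0: "gauss_average (\<lambda>_. 1) f x 0 s = f (x, s)"
  by (simp add: gauss_average_def)

lemma heat_flow_time_derivative:
  assumes f: "heat_class T f l" and t: "t \<in> {0..T}"
  shows "((\<lambda>t. heat_flow f (x, t)) has_vector_derivative heat_flow l (x, t)) (at t within {0..T})"
proof -
  have T: "0 \<le> T" and z: "0 \<in> {0..T}" using t by auto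
  note W = T continuous_on_const integrable_gauss_const[of 1]
  have cf: "cper {0..T} f" using f by (simp add: heat_class_def)
  show ?thesis
    unfolding heat_flow_def fst_conv snd_conv
  proof (rule DERIV_closed_interval[where S="{}"])
    show "continuous_on {0..T} (\<lambda>\<tau>. gauss_average (\<lambda>_. 1) f x (sqrt (2 * \<tau>)) 0)"
      "continuous_on {0..T} (\<lambda>\<tau>. gauss_average (\<lambda>_. 1) l x (sqrt (2 * \<tau>)) 0)"
      by (intro gauss_average_continuous_compose[OF W] cf heat_class_laplacian_cper[OF f] continuous_intros z)+
    show "((\<lambda>\<tau>. gauss_average (\<lambda>_. 1) f x (sqrt (2 * \<tau>)) 0) has_vector_derivative
        gauss_average (\<lambda>_. 1) l x (sqrt (2 * \<tau>)) 0) (at \<tau>)" if "\<tau> \<in> {0<..<T} - {}" for \<tau>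
      by (rule gauss_average_time_derivative[OF f z]) (use that in auto)
  qed (use t in auto)
qed

lemma duhamel_heat_eq_convolution:
  assumes f: "cper {0..T} f" and t: "t \<in> {0..T}"
  shows "duhamel_heat f (x, t) = integral {0..t} (\<lambda>s. gauss_average (\<lambda>_. 1) f x (sqrt (2 * (t - s))) s)"
proof -
  have T: "0 \<le> T" using t by auto
  note W = T continuous_on_const integrable_gauss_const[of 1]
  let ?F = "\<lambda>s. gauss_average (\<lambda>_. 1) f x (sqrt (2 * (t - s))) s"
  let ?g = "\<lambda>r. t * (1 - r\<^sup>2)"
  have cF: "continuous_on {0..t} ?F"
    by (intro gauss_average_continuous_compose[OF W f] continuous_intros) (use t in auto)
  have g01: "?g r \<in> {0..t}" if "r \<in> {0..1}" for r
    by (rule duhamel_time[OF _ that]) (use t in auto)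
  have "((\<lambda>r. (- 2 * t * r) *\<^sub>R ?F (?g r)) has_integral (integral {?g 0..?g 1} ?F - integral {?g 1..?g 0} ?F)) {0..1}"
  proof (rule has_integral_substitution_general[where s="{}" and c=0 and d=t])
    show "(?g has_real_derivative - 2 * t * r) (at r within {0..1})" for r
      by (auto intro!: derivative_eq_intros)
    show "continuous_on {0..t} ?F" by (rule cF)
  qed (use g01 in \<open>auto intro!: continuous_intros\<close>)
  moreover have "integral {?g 0..?g 1} ?F = 0"
    using t by (cases "t = 0") auto
  ultimately have "((\<lambda>r. (- 2 * t * r) *\<^sub>R ?F (?g r)) has_integral - integral {0..t} ?F) {0..1}" by simp
  moreover have "(- 2 * t * r) *\<^sub>R ?F (?g r) = (- 2 * t) * (r * gauss_average (\<lambda>_. 1) f x (sqrt (2 * t) * r) (t * (1 - r\<^sup>2)))"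
    if "r \<in> {0..1}" for r
  proof -
    have "sqrt (2 * (t - t * (1 - r\<^sup>2))) = sqrt (2 * t) * r"
      using that by (simp add: algebra_simps real_sqrt_mult)
    then show ?thesis by simp
  qed
  ultimately have "((\<lambda>r. (- 2 * t) * (r * gauss_average (\<lambda>_. 1) f x (sqrt (2 * t) * r) (t * (1 - r\<^sup>2)))) has_integral - integral {0..t} ?F) {0..1}"
    by (subst (asm) has_integral_cong) auto
  then have "integral {0..1} (\<lambda>r. (- 2 * t) * (r * gauss_average (\<lambda>_. 1) f x (sqrt (2 * t) * r) (t * (1 - r\<^sup>2)))) = - integral {0..t} ?F"
    by (rule integral_unique)
  then show ?thesis unfolding duhamel_def by simp
qed

lemma duhamel_heat_time_derivative:
  assumes f: "heat_class T f l" and t: "t \<in> {0..T}"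
  shows "((\<lambda>t. duhamel_heat f (x, t)) has_vector_derivative f (x, t) + duhamel_heat l (x, t)) (at t within {0..T})"
proof -
  have T: "0 \<le> T" using t by auto
  note W = T continuous_on_const integrable_gauss_const[of 1]
  have cf: "cper {0..T} f" using f by (simp add: heat_class_def)
  note cl = heat_class_laplacian_cper[OF f]
  let ?g = "\<lambda>\<tau> s. gauss_average (\<lambda>_. 1) f x (sqrt (2 * \<tau>)) s"
  let ?l = "\<lambda>\<tau> s. gauss_average (\<lambda>_. 1) l x (sqrt (2 * \<tau>)) s"
  have "((\<lambda>t. integral {0..t} (\<lambda>s. ?g (t - s) s)) has_vector_derivative
    ?g 0 t + integral {0..t} (\<lambda>s. ?l (t - s) s)) (at t within {0..T})"
  proof (rule DERIV_time_convolution[OF T _ _ _ t])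
    show "continuous_on ({0..T} \<times> {0..T}) (\<lambda>(\<tau>, s). ?g \<tau> s)" "continuous_on ({0..T} \<times> {0..T}) (\<lambda>(\<tau>, s). ?l \<tau> s)"
      unfolding case_prod_beta
      by (intro gauss_average_continuous_compose[OF W] cf cl continuous_intros; auto)+
    show "((\<lambda>\<tau>. ?g \<tau> s) has_vector_derivative ?l \<tau> s) (at \<tau>)" if "s \<in> {0..T}" "0 < \<tau>" for \<tau> s
      by (rule gauss_average_time_derivative[OF f that])
  qed
  then have "((\<lambda>t. integral {0..t} (\<lambda>s. ?g (t - s) s)) has_vector_derivative
    f (x, t) + duhamel_heat l (x, t)) (at t within {0..T})"
    by (simp add: gauss_average_0 duhamel_heat_eq_convolution[OF cl t])
  then show ?thesis
    by (rule has_vector_derivative_transform[OF t, rotated]) (use duhamel_heat_eq_convolution[OF cf] in auto)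
qed

section \<open>Fixed points and their regularity in space\<close>

text \<open>
  Picard iteration. Only functions in a ball around \<open>g\<close> are admitted, because the nonlinearities are
  controlled only for values near those of the data.
\<close>

lemma contraction_fixed_point:
  fixes \<Phi> :: "((real ^ 'n) \<times> real \<Rightarrow> 'e::banach) \<Rightarrow> (real ^ 'n) \<times> real \<Rightarrow> 'e"
  assumes \<theta>: "0 \<le> \<theta>" "\<theta> < 1" and r: "0 \<le> r" and g: "cper {0..T} g"
    and ball: "\<And>f. cper {0..T} f \<Longrightarrow> (\<And>p. p \<in> UNIV \<times> {0..T} \<Longrightarrow> norm (f p - g p) \<le> r) \<Longrightarrow>
      cper {0..T} (\<Phi> f) \<and> (\<forall>p\<in>UNIV \<times> {0..T}. norm (\<Phi> f p - g p) \<le> r)"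
    and contr: "\<And>f1 f2 \<delta>. cper {0..T} f1 \<Longrightarrow> cper {0..T} f2 \<Longrightarrow>
      (\<And>p. p \<in> UNIV \<times> {0..T} \<Longrightarrow> norm (f1 p - g p) \<le> r) \<Longrightarrow>
      (\<And>p. p \<in> UNIV \<times> {0..T} \<Longrightarrow> norm (f2 p - g p) \<le> r) \<Longrightarrow>
      (\<And>p. p \<in> UNIV \<times> {0..T} \<Longrightarrow> norm (f1 p - f2 p) \<le> \<delta>) \<Longrightarrow>
      (\<forall>p\<in>UNIV \<times> {0..T}. norm (\<Phi> f1 p - \<Phi> f2 p) \<le> \<theta> * \<delta>)"
  obtains f where "cper {0..T} f" "\<And>p. p \<in> UNIV \<times> {0..T} \<Longrightarrow> norm (f p - g p) \<le> r"
    "\<And>p. p \<in> UNIV \<times> {0..T} \<Longrightarrow> \<Phi> f p = f p"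
proof -
  let ?S = "UNIV \<times> {0..T} :: ((real ^ 'n) \<times> real) set"
  define F where "F n = (\<Phi> ^^ n) g" for n
  have F: "cper {0..T} (F n) \<and> (\<forall>p\<in>?S. norm (F n p - g p) \<le> r)" for n
  proof (induction n)
    case (Suc n)
    have "cper {0..T} (\<Phi> (F n)) \<and> (\<forall>p\<in>?S. norm (\<Phi> (F n) p - g p) \<le> r)"
      by (rule ball) (use Suc in auto)
    then show ?case by (simp add: F_def)
  qed (use g r in \<open>simp add: F_def\<close>)
  define D where "D n p = F (Suc n) p - F n p" for n p
  have D: "norm (D n p) \<le> \<theta> ^ n * r" if "p \<in> ?S" for n p
    using that
  proof (induction n arbitrary: p)
    case 0 then show ?case using F[of 1] by (auto simp: D_def F_def)
  next
    case (Suc n)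
    have "\<forall>p\<in>?S. norm (\<Phi> (F (Suc n)) p - \<Phi> (F n) p) \<le> \<theta> * (\<theta> ^ n * r)"
      by (rule contr) (use F Suc.IH in \<open>auto simp: D_def\<close>)
    from bspec[OF this Suc.prems] show ?case by (simp add: D_def F_def mult.assoc)
  qed
  have sm: "summable (\<lambda>n. \<theta> ^ n * r)" using \<theta> by (intro summable_mult2 summable_geometric) simp
  have ul: "uniform_limit ?S (\<lambda>n p. \<Sum>i<n. D i p) (\<lambda>p. suminf (\<lambda>i. D i p)) sequentially"
    by (rule Weierstrass_m_test[OF D sm])
  have tele: "(\<Sum>i<n. D i p) = F n p - g p" for n p
    using sum_lessThan_telescope[of "\<lambda>i. F i p" n] unfolding D_def by (simp add: F_def[of 0])
  define f where "f p = g p + suminf (\<lambda>i. D i p)" for p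
  have lim: "uniform_limit ?S F f sequentially"
  proof -
    have "uniform_limit ?S (\<lambda>n p. g p + (\<Sum>i<n. D i p)) f sequentially"
      unfolding f_def[abs_def] by (intro uniform_limit_add uniform_limit_const ul)
    then show ?thesis by (simp add: tele)
  qed
  have fc: "cper {0..T} f"
    unfolding cper_def
  proof (intro conjI allI ballI impI)
    show "continuous_on ?S f"
      by (rule uniform_limit_theorem[OF _ lim]) (use F in \<open>auto intro!: always_eventually cper_cont\<close>)
    fix x k :: "real ^ 'n" and t assume "t \<in> {0..T}" "\<forall>i. k $ i \<in> \<int>"
    then have "F n (x + k, t) = F n (x, t)" "g (x + k, t) = g (x, t)" for n
      using cper_per[of "{0..T}" "F n" t k x] cper_per[OF g, of t k x] F by auto
    then show "f (x + k, t) = f (x, t)" by (simp add: f_def D_def)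
  qed
  have fb: "norm (f p - g p) \<le> r" if "p \<in> ?S" for p
  proof (rule LIMSEQ_le_const2)
    show "(\<lambda>n. norm (F n p - g p)) \<longlonglongrightarrow> norm (f p - g p)"
      by (intro tendsto_intros tendsto_uniform_limitI[OF lim that])
  qed (use F that in auto)
  have "\<Phi> f p = f p" if p: "p \<in> ?S" for p
  proof (rule LIMSEQ_unique)
    show "(\<lambda>n. F (Suc n) p) \<longlonglongrightarrow> f p"
      by (rule LIMSEQ_Suc[OF tendsto_uniform_limitI[OF lim p]])
    show "(\<lambda>n. F (Suc n) p) \<longlonglongrightarrow> \<Phi> f p"
    proof (rule LIMSEQ_I)
      fix e :: real assume e: "e > 0"
      then have "\<forall>\<^sub>F n in sequentially. \<forall>p\<in>?S. dist (F n p) (f p) < e / 2"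
        using uniform_limitD[OF lim, of "e / 2"] by simp
      then obtain N where N: "\<And>n p. n \<ge> N \<Longrightarrow> p \<in> ?S \<Longrightarrow> dist (F n p) (f p) < e / 2"
        unfolding eventually_sequentially by blast
      have "norm (F (Suc n) p - \<Phi> f p) < e" if n: "n \<ge> N" for n
      proof -
        have "\<forall>p\<in>?S. norm (\<Phi> (F n) p - \<Phi> f p) \<le> \<theta> * (e / 2)"
          by (rule contr) (use F fc fb N[OF n] in \<open>auto simp: dist_norm less_imp_le\<close>)
        from bspec[OF this p] have "norm (F (Suc n) p - \<Phi> f p) \<le> \<theta> * (e / 2)" by (simp add: F_def)
        also have "\<dots> \<le> 1 * (e / 2)" using \<theta> e by (intro mult_right_mono) auto
        also have "\<dots> < e" using e by simp
        finally show ?thesis .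
      qed
      then show "\<exists>no. \<forall>n\<ge>no. norm (F (Suc n) p - \<Phi> f p) < e" by blast
    qed
  qed
  with fc fb that show ?thesis by blast
qed

text \<open>
  Apply the improvement to the supremum of \<open>norm (E p)\<close>; the crude bound \<open>M0\<close> serves to make it finite.
\<close>

lemma self_improving_bound:
  fixes E :: "'p \<Rightarrow> 'e::real_normed_vector"
  assumes q: "0 \<le> q" "q < 1" and bdd: "\<And>p. p \<in> S \<Longrightarrow> norm (E p) \<le> M0"
    and step: "\<And>M p. (\<And>p. p \<in> S \<Longrightarrow> norm (E p) \<le> M) \<Longrightarrow> p \<in> S \<Longrightarrow> norm (E p) \<le> a + q * M"
    and p: "p \<in> S"
  shows "norm (E p) \<le> a / (1 - q)"
proof -
  let ?M = "SUP p\<in>S. norm (E p)"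
  have up: "norm (E p) \<le> ?M" if "p \<in> S" for p
    by (rule cSUP_upper[OF that]) (use bdd in \<open>auto simp: bdd_above_def\<close>)
  have "?M \<le> a + q * ?M"
    by (rule cSUP_least) (use p step[OF up] in auto)
  then have "?M \<le> a / (1 - q)" using q by (simp add: field_simps)
  then show ?thesis using up[OF p] by simp
qed

lemma linear_Basis_sum:
  fixes f :: "'a::euclidean_space \<Rightarrow> 'b::real_vector"
  assumes "linear f" shows "f v = (\<Sum>b\<in>Basis. (v \<bullet> b) *\<^sub>R f b)"
proof -
  have "f v = f (\<Sum>b\<in>Basis. (v \<bullet> b) *\<^sub>R b)" by (simp add: euclidean_representation)
  then show ?thesis using assms by (simp add: linear_sum linear_cmul)
qed

lemma cper_linear_apply:
  fixes B :: "(real ^ 'n) \<times> real \<Rightarrow> 'e::euclidean_space \<Rightarrow> 'd::euclidean_space"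
  assumes B: "\<And>e. cper {0..T} (\<lambda>p. B p e)" "\<And>x t. t \<in> {0..T} \<Longrightarrow> linear (B (x, t))"
    and z: "cper {0..T} z"
  shows "cper {0..T} (\<lambda>p. B p (z p))"
proof (rule cper_cong)
  show "cper {0..T} (\<lambda>p. \<Sum>b\<in>Basis. (z p \<bullet> b) *\<^sub>R B p b)"
  proof (rule cper_sum)
    fix b :: 'e
    have "cper {0..T} (\<lambda>p. z p \<bullet> b)" by (rule cper_compose[OF z]) (intro continuous_intros)
    with B(1)[of b] show "cper {0..T} (\<lambda>p. (z p \<bullet> b) *\<^sub>R B p b)"
      by (auto simp: cper_def intro!: continuous_intros)
  qed
  fix x t assume "t \<in> {0..T}"
  then show "(\<Sum>b\<in>Basis. (z (x, t) \<bullet> b) *\<^sub>R B (x, t) b) = B (x, t) (z (x, t))"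
    using linear_Basis_sum[OF B(2)] by metis
qed

context invariant_operator
begin

lemma zero_op: "t \<in> {0..T} \<Longrightarrow> A (\<lambda>_. 0) (x, t) = 0"
  using diff_op[OF cper_const cper_const, of t 0 0] by simp

lemma sum_op:
  assumes "finite I" "\<And>i. i \<in> I \<Longrightarrow> cper {0..T} (f i)" "t \<in> {0..T}"
  shows "A (\<lambda>p. \<Sum>i\<in>I. c i *\<^sub>R f i p) (x, t) = (\<Sum>i\<in>I. c i *\<^sub>R A (f i) (x, t))"
  using assms(1,2)
proof (induction I rule: finite_induct)
  case empty then show ?case using zero_op[OF assms(3)] by simp
next
  case (insert i I)
  have "A (\<lambda>p. \<Sum>i\<in>insert i I. c i *\<^sub>R f i p) (x, t) = A (\<lambda>p. (\<Sum>i\<in>I. c i *\<^sub>R f i p) + c i *\<^sub>R f i p) (x, t)"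
    using insert.hyps by (simp add: add.commute)
  also have "\<dots> = A (\<lambda>p. \<Sum>i\<in>I. c i *\<^sub>R f i p) (x, t) + c i *\<^sub>R A (f i) (x, t)"
    by (rule linear_op[OF cper_sum[OF cper_scaleR] _ assms(3)]) (use insert in auto)
  also have "\<dots> = (\<Sum>i\<in>insert i I. c i *\<^sub>R A (f i) (x, t))"
    using insert by (simp add: add.commute)
  finally show ?case .
qed

text \<open>
  Provides the candidate for a derivative of a fixed point, as the solution of the differentiated equation.
  The radius \<open>r\<close> is the one for which the ball around zero is mapped into itself.
\<close>

lemma linear_fixed_point:
  assumes g: "cper {0..T} g" and R: "cper {0..T} R"
    and B: "\<And>e. cper {0..T} (\<lambda>p. B p e)" "\<And>x t. t \<in> {0..T} \<Longrightarrow> linear (B (x, t))"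
    and L: "\<And>x t e. t \<in> {0..T} \<Longrightarrow> norm (B (x, t) e) \<le> L * norm e" "0 \<le> L" "\<kappa> * L < 1"
  obtains \<zeta> where "cper {0..T} \<zeta>"
    "\<And>x t. t \<in> {0..T} \<Longrightarrow> \<zeta> (x, t) = g (x, t) + A (\<lambda>p. R p + B p (\<zeta> p)) (x, t)"
proof -
  obtain G where G: "G \<ge> 0" "\<And>x t. t \<in> {0..T} \<Longrightarrow> norm (g (x, t)) \<le> G"
    using cper_bounded[OF compact_Icc g] by blast
  obtain \<rho> where \<rho>: "\<rho> \<ge> 0" "\<And>x t. t \<in> {0..T} \<Longrightarrow> norm (R (x, t)) \<le> \<rho>"
    using cper_bounded[OF compact_Icc R] by blast
  define r where "r = (G + \<kappa> * \<rho>) / (1 - \<kappa> * L)"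
  have r: "0 \<le> r" "G + \<kappa> * (\<rho> + L * r) = r"
  proof -
    show "0 \<le> r" unfolding r_def using G \<rho> \<kappa>0 L by (intro divide_nonneg_pos) auto
    have "r * (1 - \<kappa> * L) = G + \<kappa> * \<rho>" unfolding r_def using L(3) by simp
    then show "G + \<kappa> * (\<rho> + L * r) = r" by (simp add: algebra_simps)
  qed
  define \<Phi> where "\<Phi> \<zeta> p = g p + A (\<lambda>p. R p + B p (\<zeta> p)) p" for \<zeta> p
  have cB: "cper {0..T} (\<lambda>p. R p + B p (\<zeta> p))" if "cper {0..T} \<zeta>" for \<zeta>
    by (rule cper_add[OF R cper_linear_apply[OF B that]])
  show ?thesis
  proof (rule contraction_fixed_point[of "\<kappa> * L" r T "\<lambda>_. 0" \<Phi>])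
    show "0 \<le> \<kappa> * L" "\<kappa> * L < 1" "0 \<le> r" using \<kappa>0 L r by auto
    show "cper {0..T} (\<lambda>_. 0 :: 'e)" by (rule cper_const)
  next
    fix f :: "(real ^ 'n) \<times> real \<Rightarrow> 'e"
    assume f: "cper {0..T} f" and ball: "\<And>p. p \<in> UNIV \<times> {0..T} \<Longrightarrow> norm (f p - 0) \<le> r"
    have fr: "norm (f (x, t)) \<le> r" if "t \<in> {0..T}" for x t using ball[of "(x, t)"] that by simp
    have RB: "norm (R (y, s) + B (y, s) (f (y, s))) \<le> \<rho> + L * r" if s: "s \<in> {0..T}" for y s
      by (rule norm_triangle_mono[OF \<rho>(2)[OF s] order_trans[OF L(1)[OF s] mult_left_mono[OF fr[OF s] L(2)]]])
    have "norm (\<Phi> f (x, t)) \<le> G + \<kappa> * (\<rho> + L * r)" if t: "t \<in> {0..T}" for x t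
      unfolding \<Phi>_def by (rule norm_triangle_mono[OF G(2)[OF t] bound_op[OF cB[OF f] RB t]])
    then have "norm (\<Phi> f p - 0) \<le> r" if "p \<in> UNIV \<times> {0..T}" for p
      unfolding r(2) using that by (cases p) simp
    moreover have "cper {0..T} (\<Phi> f)"
      unfolding \<Phi>_def[abs_def] by (rule cper_add[OF g cper_op[OF cB[OF f]]])
    ultimately show "cper {0..T} (\<Phi> f) \<and> (\<forall>p\<in>UNIV \<times> {0..T}. norm (\<Phi> f p - 0) \<le> r)" by blast
  next
    fix f1 f2 :: "(real ^ 'n) \<times> real \<Rightarrow> 'e" and \<delta>
    assume f: "cper {0..T} f1" "cper {0..T} f2"
      and close: "\<And>p. p \<in> UNIV \<times> {0..T} \<Longrightarrow> norm (f1 p - f2 p) \<le> \<delta>"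
    have d: "norm (f1 (x, t) - f2 (x, t)) \<le> \<delta>" if "t \<in> {0..T}" for x t using close[of "(x, t)"] that by simp
    have "norm (\<Phi> f1 (x, t) - \<Phi> f2 (x, t)) \<le> \<kappa> * (L * \<delta>)" if t: "t \<in> {0..T}" for x t
    proof -
      have "\<Phi> f1 (x, t) - \<Phi> f2 (x, t) = A (\<lambda>p. (R p + B p (f1 p)) - (R p + B p (f2 p))) (x, t)"
        unfolding \<Phi>_def diff_op[OF cB[OF f(1)] cB[OF f(2)] t] by (rule add_diff_cancel_left)
      also have "norm \<dots> \<le> \<kappa> * (L * \<delta>)"
      proof (rule bound_op[OF cper_diff[OF cB[OF f(1)] cB[OF f(2)]] _ t])
        fix y s assume s: "s \<in> {0..T}"
        have "norm (B (y, s) (f1 (y, s) - f2 (y, s))) \<le> L * \<delta>"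
          by (rule order_trans[OF L(1)[OF s] mult_left_mono[OF d[OF s] L(2)]])
        then show "norm (R (y, s) + B (y, s) (f1 (y, s)) - (R (y, s) + B (y, s) (f2 (y, s)))) \<le> L * \<delta>"
          by (simp add: linear_diff[OF B(2)[OF s]])
      qed
      finally show ?thesis .
    qed
    then show "\<forall>p\<in>UNIV \<times> {0..T}. norm (\<Phi> f1 p - \<Phi> f2 p) \<le> \<kappa> * L * \<delta>"
      by (metis mem_Times_iff mult.assoc prod.collapse)
  next
    fix f assume fc: "cper {0..T} f" and f: "\<And>p. p \<in> UNIV \<times> {0..T} \<Longrightarrow> \<Phi> f p = f p"
    have "f (x, t) = g (x, t) + A (\<lambda>p. R p + B p (f p)) (x, t)" if "t \<in> {0..T}" for x t
      using f[of "(x, t)"] that unfolding \<Phi>_def by simp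
    from that[OF fc this] show thesis .
  qed
qed

text \<open>
  A solution of \<open>z = g + A n\<close> gains a derivative in \<open>x\<close> as soon as the increments of \<open>n\<close> are, up to
  a small error, linear in those of \<open>z\<close> with a coefficient \<open>B\<close> for which \<open>\<zeta> \<mapsto> A (B \<zeta>)\<close> is
  a contraction. The candidate \<open>Z\<close> solves the differentiated equation; because \<open>A\<close> commutes with
  translations, the remainder \<open>z (x + h) - z x - Z x h\<close> solves a contractive equation with right-hand
  side \<open>o (norm h)\<close>.
\<close>

lemma xderiv_fixed_point:
  assumes z: "cper {0..T} z" and n: "cper {0..T} n" and g: "cper {0..T} g"
    and eq: "\<And>x t. t \<in> {0..T} \<Longrightarrow> z (x, t) = g (x, t) + A n (x, t)"
    and dg: "xderiv T g g'" and g': "\<And>v. cper {0..T} (\<lambda>p. g' p v)"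
    and R: "\<And>v. cper {0..T} (\<lambda>p. R p v)" "\<And>x t. t \<in> {0..T} \<Longrightarrow> linear (R (x, t))"
    and B: "\<And>e. cper {0..T} (\<lambda>p. B p e)" "\<And>x t. t \<in> {0..T} \<Longrightarrow> linear (B (x, t))"
    and L: "\<And>x t e. t \<in> {0..T} \<Longrightarrow> norm (B (x, t) e) \<le> L * norm e" "0 \<le> L" "\<kappa> * L < 1"
    and exp: "\<And>\<epsilon>. \<epsilon> > 0 \<Longrightarrow> \<exists>\<delta>>0. \<forall>h x t. norm h < \<delta> \<longrightarrow> t \<in> {0..T} \<longrightarrow>
      norm (n (x + h, t) - n (x, t) - R (x, t) h - B (x, t) (z (x + h, t) - z (x, t)))
        \<le> \<epsilon> * (norm h + norm (z (x + h, t) - z (x, t)))"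
  obtains Z where "xderiv T z Z" "\<And>v. cper {0..T} (\<lambda>p. Z p v)"
    "\<And>x t v. t \<in> {0..T} \<Longrightarrow> Z (x, t) v = g' (x, t) v + A (\<lambda>p. R p v + B p (Z p v)) (x, t)"
proof -
  have ling: "linear (g' (x, t))" if "t \<in> {0..T}" for x t
    using dg that has_derivative_linear unfolding xderiv_def by blast
  define sol where "sol b \<zeta> \<longleftrightarrow> cper {0..T} \<zeta> \<and>
    (\<forall>x. \<forall>t\<in>{0..T}. \<zeta> (x, t) = g' (x, t) b + A (\<lambda>p. R p b + B p (\<zeta> p)) (x, t))" for b \<zeta>
  have "\<exists>\<zeta>. sol b \<zeta>" for b
    by (rule linear_fixed_point[OF g' R(1) B L, of b b]) (auto simp: sol_def)
  then obtain \<zeta> where "\<And>b. sol b (\<zeta> b)" by metis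
  then have \<zeta>: "\<And>b. cper {0..T} (\<zeta> b)"
    "\<And>b x t. t \<in> {0..T} \<Longrightarrow> \<zeta> b (x, t) = g' (x, t) b + A (\<lambda>p. R p b + B p (\<zeta> b p)) (x, t)"
    by (auto simp: sol_def)
  define Z where "Z p v = (\<Sum>b\<in>Basis. (v \<bullet> b) *\<^sub>R \<zeta> b p)" for p and v :: "real ^ 'n"
  have Zc: "cper {0..T} (\<lambda>p. Z p v)" for v
    unfolding Z_def by (intro cper_sum cper_scaleR \<zeta>)
  have Zlin: "linear (Z p)" for p
    unfolding Z_def by (intro linearI) (simp_all add: inner_add_left scaleR_add_left sum.distrib scaleR_sum_right)
  have cRB: "cper {0..T} (\<lambda>p. R p v + B p (Z p v))" for v
    by (rule cper_add[OF R(1) cper_linear_apply[OF B Zc]])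
  have Zeq: "Z (x, t) v = g' (x, t) v + A (\<lambda>p. R p v + B p (Z p v)) (x, t)" if t: "t \<in> {0..T}" for x t v
  proof -
    have c: "cper {0..T} (\<lambda>p. R p b + B p (\<zeta> b p))" for b
      by (rule cper_add[OF R(1) cper_linear_apply[OF B \<zeta>(1)]])
    have "A (\<lambda>p. R p v + B p (Z p v)) (x, t) = A (\<lambda>p. \<Sum>b\<in>Basis. (v \<bullet> b) *\<^sub>R (R p b + B p (\<zeta> b p))) (x, t)"
    proof (rule cong_op[OF cRB _ t])
      fix y s assume s: "s \<in> {0..T}"
      have "R (y, s) v = (\<Sum>b\<in>Basis. (v \<bullet> b) *\<^sub>R R (y, s) b)"
        by (rule linear_Basis_sum[OF R(2)[OF s]])
      then show "R (y, s) v + B (y, s) (Z (y, s) v) = (\<Sum>b\<in>Basis. (v \<bullet> b) *\<^sub>R (R (y, s) b + B (y, s) (\<zeta> b (y, s))))"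
        unfolding Z_def
        by (simp add: linear_sum[OF B(2)[OF s]] linear_cmul[OF B(2)[OF s]] scaleR_add_right sum.distrib)
    qed
    also have "\<dots> = (\<Sum>b\<in>Basis. (v \<bullet> b) *\<^sub>R A (\<lambda>p. R p b + B p (\<zeta> b p)) (x, t))"
      by (rule sum_op[OF finite_Basis c t])
    finally have 1: "A (\<lambda>p. R p v + B p (Z p v)) (x, t) = \<dots>" .
    have 2: "g' (x, t) v = (\<Sum>b\<in>Basis. (v \<bullet> b) *\<^sub>R g' (x, t) b)"
      by (rule linear_Basis_sum[OF ling[OF t]])
    show ?thesis
      unfolding 1 2 Z_def[of "(x, t)"] \<zeta>(2)[OF t] by (simp add: scaleR_add_right sum.distrib)
  qed
  have "\<exists>m. m \<ge> 0 \<and> (\<forall>x. \<forall>t\<in>{0..T}. norm (\<zeta> b (x, t)) \<le> m)" for b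
    using cper_bounded[OF compact_Icc \<zeta>(1)] by metis
  then obtain m where m: "\<And>b. m b \<ge> 0" "\<And>b x t. t \<in> {0..T} \<Longrightarrow> norm (\<zeta> b (x, t)) \<le> m b" by metis
  define \<mu> where "\<mu> = (\<Sum>b\<in>(Basis :: (real ^ 'n) set). m b)"
  have \<mu>0: "0 \<le> \<mu>" unfolding \<mu>_def using m by (intro sum_nonneg) auto
  have Zb: "norm (Z (x, t) v) \<le> \<mu> * norm v" if t: "t \<in> {0..T}" for x t v
  proof -
    have Zbasis: "Z (x, t) b = \<zeta> b (x, t)" if "b \<in> Basis" for b
      unfolding Z_def using that by (simp add: inner_Basis if_distrib[of "\<lambda>r. r *\<^sub>R _"] sum.delta cong: if_cong)
    have "(\<Sum>b\<in>Basis. norm (Z (x, t) b)) \<le> \<mu>"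
      unfolding \<mu>_def using m(2)[OF t] Zbasis by (intro sum_mono) simp
    then show ?thesis
      using norm_linear_le_sum_Basis[OF Zlin, of "(x, t)" v] mult_right_mono[OF _ norm_ge_zero] order_trans by blast
  qed
  define \<theta> where "\<theta> = \<kappa> * L"
  have \<theta>: "0 \<le> \<theta>" "\<theta> < 1" using \<kappa>0 L by (auto simp: \<theta>_def)
  have "xderiv T z Z"
    unfolding xderiv_def has_derivative_at_alt
  proof (intro allI ballI conjI impI)
    fix x :: "real ^ 'n" and t assume t: "t \<in> {0..T}"
    show "bounded_linear (Z (x, t))" using Zlin by (rule linear_conv_bounded_linear[THEN iffD1])
    fix e :: real assume e: "e > 0"
    \<comment> \<open>The expansion error contains the unknown remainder itself; \<open>\<epsilon>\<close> is chosen so that absorbing it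
      leaves a contraction factor of at most \<open>(1 + \<theta>) / 2\<close>, with final error \<open>e * norm h\<close>.\<close>
    define c where "c = 1 + \<kappa> + \<kappa> * \<mu>"
    have c: "c \<ge> 1" using \<kappa>0 \<mu>0 by (simp add: c_def)
    define \<epsilon> where "\<epsilon> = min ((1 - \<theta>) / (2 * (\<kappa> + 1))) (e * (1 - \<theta>) / (2 * c))"
    have \<epsilon>: "\<epsilon> > 0" using \<theta> \<kappa>0 e c by (simp add: \<epsilon>_def)
    have \<epsilon>1: "\<kappa> * \<epsilon> \<le> (1 - \<theta>) / 2"
    proof -
      have "\<kappa> * \<epsilon> \<le> (\<kappa> + 1) * ((1 - \<theta>) / (2 * (\<kappa> + 1)))"
        using \<kappa>0 \<epsilon> by (intro mult_mono) (auto simp: \<epsilon>_def)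
      also have "\<dots> = (1 - \<theta>) / 2" using \<kappa>0 by (simp add: field_simps)
      finally show ?thesis .
    qed
    have \<epsilon>2: "\<epsilon> * c \<le> e * (1 - \<theta>) / 2"
    proof -
      have "\<epsilon> * c \<le> (e * (1 - \<theta>) / (2 * c)) * c" using c by (intro mult_right_mono) (auto simp: \<epsilon>_def)
      then show ?thesis using c by simp
    qed
    obtain \<delta>1 where \<delta>1: "\<delta>1 > 0" "\<And>h x t. norm h < \<delta>1 \<Longrightarrow> t \<in> {0..T} \<Longrightarrow>
      norm (g (x + h, t) - g (x, t) - g' (x, t) h) \<le> \<epsilon> * norm h"
      using xderiv_uniform[OF dg g' \<epsilon>] by blast
    obtain \<delta>2 where \<delta>2: "\<delta>2 > 0" "\<And>h x t. norm h < \<delta>2 \<Longrightarrow> t \<in> {0..T} \<Longrightarrow>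
      norm (n (x + h, t) - n (x, t) - R (x, t) h - B (x, t) (z (x + h, t) - z (x, t)))
        \<le> \<epsilon> * (norm h + norm (z (x + h, t) - z (x, t)))"
      using exp[OF \<epsilon>] by blast
    have "norm (z (y, t) - z (x, t) - Z (x, t) (y - x)) \<le> e * norm (y - x)" if y: "norm (y - x) < min \<delta>1 \<delta>2" for y
    proof -
      define h where "h = y - x"
      have h: "norm h < \<delta>1" "norm h < \<delta>2" using y by (auto simp: h_def)
      let ?sh = "\<lambda>f p. f (fst p + h, snd p)"
      define E where "E p = ?sh z p - z p - Z p h" for p
      have cE: "cper {0..T} E" unfolding E_def by (intro cper_diff cper_shift z Zc)
      obtain M0 where M0: "\<And>x t. t \<in> {0..T} \<Longrightarrow> norm (E (x, t)) \<le> M0"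
        using cper_bounded[OF compact_Icc cE] by metis
      let ?I = "\<lambda>p. (?sh n p - n p) - (R p h + B p (Z p h))"
      have cI: "cper {0..T} ?I" by (intro cper_diff cper_shift n cRB)
      have Eeq: "E (x, t) = (g (x + h, t) - g (x, t) - g' (x, t) h) + A ?I (x, t)" if t: "t \<in> {0..T}" for x t
        unfolding E_def using eq[OF t] Zeq[OF t, of x h]
          diff_op[OF cper_diff[OF cper_shift[OF n] n] cRB t, of h h x] diff_op[OF cper_shift[OF n] n t, of h x] shift_op[OF n t, of h x]
        by simp
      let ?a = "\<epsilon> * c * norm h" and ?q = "\<theta> + \<kappa> * \<epsilon>"
      have q: "0 \<le> ?q" "?q \<le> (1 + \<theta>) / 2" "?q < 1" using \<theta> \<epsilon> \<epsilon>1 \<kappa>0 by (auto simp: field_simps)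
      have "norm (E (x, t)) \<le> ?a / (1 - ?q)"
      proof (rule self_improving_bound[where S="UNIV \<times> {0..T}"])
        show "norm (E p) \<le> M0" if "p \<in> UNIV \<times> {0..T}" for p using that M0 by force
        fix M and p :: "(real ^ 'n) \<times> real"
        assume "\<And>p. p \<in> UNIV \<times> {0..T} \<Longrightarrow> norm (E p) \<le> M" and "p \<in> UNIV \<times> {0..T}"
        then obtain x t where M: "\<And>x t. t \<in> {0..T} \<Longrightarrow> norm (E (x, t)) \<le> M" and p: "p = (x, t)" and t: "t \<in> {0..T}"
          by (cases p) force
        have "norm (?I (y, s)) \<le> \<epsilon> * (norm h + (M + \<mu> * norm h)) + L * M" if s: "s \<in> {0..T}" for y s
        proof -
          let ?D = "z (y + h, s) - z (y, s)"
          have DE: "?D = E (y, s) + Z (y, s) h" by (simp add: E_def)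
          have "?I (y, s) = (n (y + h, s) - n (y, s) - R (y, s) h - B (y, s) ?D) + B (y, s) (E (y, s))"
            unfolding DE by (simp add: linear_add[OF B(2)[OF s]])
          also have "norm \<dots> \<le> \<epsilon> * (norm h + norm ?D) + L * norm (E (y, s))"
            by (rule norm_triangle_mono[OF \<delta>2(2)[OF h(2) s] L(1)[OF s]])
          also have "\<dots> \<le> \<epsilon> * (norm h + (M + \<mu> * norm h)) + L * M"
            using norm_triangle_mono[OF M[OF s] Zb[OF s], of y y h] \<epsilon> L(2) M[OF s, of y]
            by (intro add_mono mult_left_mono) (auto simp: DE)
          finally show ?thesis .
        qed
        then have "norm (A ?I (x, t)) \<le> \<kappa> * (\<epsilon> * (norm h + (M + \<mu> * norm h)) + L * M)"
          by (rule bound_op[OF cI _ t])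
        then have "norm (E (x, t)) \<le> \<epsilon> * norm h + \<kappa> * (\<epsilon> * (norm h + (M + \<mu> * norm h)) + L * M)"
          unfolding Eeq[OF t] by (rule norm_triangle_mono[OF \<delta>1(2)[OF h(1) t]])
        also have "\<dots> = ?a + ?q * M" unfolding c_def \<theta>_def by (simp add: algebra_simps)
        finally show "norm (E p) \<le> ?a + ?q * M" unfolding p .
      qed (use q t in auto)
      also have "\<dots> \<le> ?a / ((1 - \<theta>) / 2)"
      proof (rule divide_left_mono)
        show "(1 - \<theta>) / 2 \<le> 1 - ?q" using q(2) by (simp add: field_simps)
        show "0 \<le> ?a" using \<epsilon> c by simp
        show "0 < (1 - ?q) * ((1 - \<theta>) / 2)" using q(3) \<theta> by (intro mult_pos_pos) auto
      qed
      also have "\<dots> \<le> (e * (1 - \<theta>) / 2 * norm h) / ((1 - \<theta>) / 2)"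
        using \<epsilon>2 \<theta> by (intro divide_right_mono mult_right_mono) auto
      also have "\<dots> = e * norm h" using \<theta> by simp
      finally show ?thesis by (simp add: E_def h_def)
    qed
    then show "\<exists>d>0. \<forall>y. norm (y - x) < d \<longrightarrow> norm (z (y, t) - z (x, t) - Z (x, t) (y - x)) \<le> e * norm (y - x)"
      using \<delta>1(1) \<delta>2(1) by (intro exI[of _ "min \<delta>1 \<delta>2"]) auto
  qed
  then show ?thesis using that Zc Zeq by blast
qed

end

abbreviation strip :: "real \<Rightarrow> ((real ^ 'n) \<times> real) set" where
  "strip T \<equiv> UNIV \<times> {0..T}"

abbreviation xdirs :: "((real ^ 'n) \<times> real) set" where
  "xdirs \<equiv> UNIV \<times> {0}"

lemma deriv_along_imp_xderiv:
  assumes "deriv_along xdirs (strip T) f f'"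
  shows "xderiv T f (\<lambda>p v. f' p (v, 0))"
  unfolding xderiv_def
proof (intro allI ballI)
  fix x :: "real ^ 'a" and t assume t: "t \<in> {0..T}"
  have 1: "((\<lambda>y. (y, t)) has_derivative (\<lambda>v. (v, 0))) (at x)"
    by (auto intro!: derivative_eq_intros)
  have "(f has_derivative f' (x, t)) (at (x, t) within {q \<in> strip T. q - (x, t) \<in> xdirs})"
    using assms t by (simp add: deriv_along_def)
  then have "(f has_derivative f' (x, t)) (at (x, t) within range (\<lambda>y. (y, t)))"
    by (rule has_derivative_subset) (use t in auto)
  from has_derivative_in_compose[OF 1 this]
  show "((\<lambda>y. f (y, t)) has_derivative (\<lambda>v. f' (x, t) (v, 0))) (at x)" .
qed

lemma xderiv_imp_deriv_along:
  assumes "xderiv T f f'"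
  shows "deriv_along xdirs (strip T) f (\<lambda>p w. f' p (fst w))"
  unfolding deriv_along_def
proof
  fix p :: "(real ^ 'a) \<times> real" assume p: "p \<in> strip T"
  obtain x t where xt: "p = (x, t)" "t \<in> {0..T}" using p by (cases p) auto
  have "((\<lambda>y. f (y, t)) has_derivative f' (x, t)) (at (fst p))"
    using assms xt by (simp add: xderiv_def)
  from has_derivative_compose[OF has_derivative_fst[OF has_derivative_ident] this]
  have "((\<lambda>q. f (fst q, t)) has_derivative (\<lambda>w. f' p (fst w))) (at p within {q \<in> strip T. q - p \<in> xdirs})"
    using xt by simp
  then show "(f has_derivative (\<lambda>w. f' p (fst w))) (at p within {q \<in> strip T. q - p \<in> xdirs})"
    by (rule has_derivative_cong_within) (use xt in \<open>auto simp: zero_prod_def\<close>)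
qed

lemma thick_xdirs: "thick xdirs (strip T)"
  unfolding thick_def
proof (intro ballI allI impI)
  fix p v :: "(real ^ 'a) \<times> real" and e :: real
  assume "p \<in> strip T" "v \<in> xdirs" "0 < e"
  then show "\<exists>d. 0 < \<bar>d\<bar> \<and> \<bar>d\<bar> < e \<and> p + d *\<^sub>R v \<in> strip T \<and> d *\<^sub>R v \<in> xdirs"
    by (intro exI[of _ "e / 2"]) auto
qed

lemma xderiv_unique:
  assumes "xderiv T f f'" "xderiv T f f''" "t \<in> {0..T}"
  shows "f' (x, t) = f'' (x, t)"
  using assms has_derivative_unique unfolding xderiv_def by blast

lemma xderiv_inner: "xderiv T f f' \<Longrightarrow> xderiv T (\<lambda>p. f p \<bullet> b) (\<lambda>p v. f' p v \<bullet> b)"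
  unfolding xderiv_def by (auto intro!: derivative_intros)

lemma xderiv_componentwise:
  fixes f :: "(real ^ 'n) \<times> real \<Rightarrow> 'e::euclidean_space"
  assumes "\<And>b. b \<in> Basis \<Longrightarrow> xderiv T (\<lambda>p. f p \<bullet> b) (f' b)"
  shows "xderiv T f (\<lambda>p v. \<Sum>b\<in>Basis. f' b p v *\<^sub>R b)"
  unfolding xderiv_def
proof (intro allI ballI)
  fix x :: "real ^ 'n" and t assume t: "t \<in> {0..T}"
  show "((\<lambda>y. f (y, t)) has_derivative (\<lambda>v. \<Sum>b\<in>Basis. f' b (x, t) v *\<^sub>R b)) (at x)"
    by (subst has_derivative_componentwise_within)
      (use assms t in \<open>auto simp: inner_sum_left inner_Basis if_distrib sum.If_cases xderiv_def cong: if_cong\<close>)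
qed

lemma cper_xderiv:
  fixes f :: "(real ^ 'n) \<times> real \<Rightarrow> 'e::real_normed_vector"
  assumes f: "cper {0..T} f" and d: "xderiv T f f'" and c: "continuous_on (strip T) (\<lambda>p. f' p v)"
  shows "cper {0..T} (\<lambda>p. f' p v)"
  unfolding cper_def
proof (intro conjI c allI ballI impI)
  fix x k :: "real ^ 'n" and t assume t: "t \<in> {0..T}" and k: "\<forall>i. k $ i \<in> \<int>"
  have "((\<lambda>y. f (y, t)) has_derivative f' (x + k, t)) (at (x + k))"
    using d t by (simp add: xderiv_def)
  moreover have "((\<lambda>y. y + k) has_derivative (\<lambda>v. v)) (at x)" by (auto intro!: derivative_eq_intros)
  ultimately have "((\<lambda>y. f (y + k, t)) has_derivative f' (x + k, t)) (at x)"
    using has_derivative_compose by blast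
  then have "((\<lambda>y. f (y, t)) has_derivative f' (x + k, t)) (at x)"
    using cper_per[OF f t, of k] k by simp
  then have "f' (x + k, t) = f' (x, t)"
    using d t has_derivative_unique unfolding xderiv_def by blast
  then show "f' (x + k, t) v = f' (x, t) v" by simp
qed

text \<open>
  Existence and continuity on the strip of the \<open>x\<close>-derivatives up to order \<open>j\<close>.
\<close>

definition xreg :: "real \<Rightarrow> nat \<Rightarrow> ((real ^ 'n) \<times> real \<Rightarrow> 'e::euclidean_space) \<Rightarrow> bool" where
  "xreg T j f \<longleftrightarrow> (\<forall>b\<in>Basis. (\<lambda>p. f p \<bullet> b) \<in> (deriv_class xdirs (strip T) ^^ j) (cont_class (strip T)))"

lemma falg_xclass: "function_algebra (strip T) ((deriv_class xdirs (strip T) ^^ j) (cont_class (strip T)))"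
  by (rule falg_funpow[OF falg_cont_class]) (simp add: zero_prod_def)

lemma xreg_0: "xreg T 0 f \<longleftrightarrow> continuous_on (strip T) f"
  unfolding xreg_def by (subst continuous_on_componentwise) (simp add: cont_class_def)

lemma xreg_Suc_imp: "xreg T (Suc j) f \<Longrightarrow> xreg T j f"
  unfolding xreg_def by (auto simp: deriv_class_def)

lemma xreg_imp_continuous: "xreg T j f \<Longrightarrow> continuous_on (strip T) f"
  by (induction j) (auto simp: xreg_0 dest: xreg_Suc_imp)

lemma xreg_cong:
  assumes "xreg T j f" "\<And>x t. t \<in> {0..T} \<Longrightarrow> f (x, t) = g (x, t)" shows "xreg T j g"
  unfolding xreg_def
proof
  fix b :: 'b assume "b \<in> Basis"
  then have "(\<lambda>p. f p \<bullet> b) \<in> (deriv_class xdirs (strip T) ^^ j) (cont_class (strip T))"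
    using assms(1) by (simp add: xreg_def)
  then show "(\<lambda>p. g p \<bullet> b) \<in> (deriv_class xdirs (strip T) ^^ j) (cont_class (strip T))"
    by (rule falg_cong[OF falg_xclass]) (use assms(2) in auto)
qed

lemma xreg_add: "xreg T j f \<Longrightarrow> xreg T j g \<Longrightarrow> xreg T j (\<lambda>p. f p + g p)"
  unfolding xreg_def by (simp add: inner_add_left falg_add[OF falg_xclass])

lemma xreg_sum: "(\<And>i. i \<in> I \<Longrightarrow> xreg T j (f i)) \<Longrightarrow> finite I \<Longrightarrow> xreg T j (\<lambda>p. \<Sum>i\<in>I. f i p)"
  unfolding xreg_def by (auto simp: inner_sum_left intro!: falg_sum[OF falg_xclass])

lemma xreg_scaleR: "xreg T j c \<Longrightarrow> xreg T j f \<Longrightarrow> xreg T j (\<lambda>p. (c p :: real) *\<^sub>R f p)"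
  unfolding xreg_def by (auto intro!: falg_mult[OF falg_xclass])

lemma xreg_inner: "xreg T j f \<Longrightarrow> b \<in> Basis \<Longrightarrow> xreg T j (\<lambda>p. f p \<bullet> b)"
  unfolding xreg_def by simp

lemma xreg_componentwise: "(\<And>b. b \<in> Basis \<Longrightarrow> xreg T j (\<lambda>p. f p \<bullet> b)) \<Longrightarrow> xreg T j f"
  unfolding xreg_def by simp

lemma xreg_SucI:
  fixes f :: "(real ^ 'n) \<times> real \<Rightarrow> 'e::euclidean_space"
  assumes c: "continuous_on (strip T) f" and d: "xderiv T f f'" and r: "\<And>v. xreg T j (\<lambda>p. f' p v)"
  shows "xreg T (Suc j) f"
  unfolding xreg_def
proof
  fix b :: 'e assume b: "b \<in> Basis"
  let ?X = "\<lambda>i. (deriv_class xdirs (strip T) ^^ i) (cont_class (strip T))"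
  have D: "deriv_along xdirs (strip T) (\<lambda>p. f p \<bullet> b) (\<lambda>p w. f' p (fst w) \<bullet> b)"
    by (rule xderiv_imp_deriv_along[OF xderiv_inner[OF d]])
  have step: "(\<lambda>p. f p \<bullet> b) \<in> ?X (Suc i)" if "(\<lambda>p. f p \<bullet> b) \<in> ?X i" "\<And>v. xreg T i (\<lambda>p. f' p v)" for i
  proof -
    have "(\<lambda>p. f' p (fst w) \<bullet> b) \<in> ?X i" for w :: "(real ^ 'n) \<times> real"
      by (rule bspec[OF that(2)[of "fst w", unfolded xreg_def] b])
    then have "(\<lambda>p. f p \<bullet> b) \<in> deriv_class xdirs (strip T) (?X i)"
      by (rule deriv_classI[OF that(1) D])
    then show ?thesis by simp
  qed
  show "(\<lambda>p. f p \<bullet> b) \<in> ?X (Suc j)"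
    using r
  proof (induction j)
    case 0
    have "continuous_on (strip T) (\<lambda>p. f p \<bullet> b)" by (intro continuous_intros c)
    then show ?case by (intro step[OF _ 0]) (simp add: cont_class_def)
  next
    case (Suc j)
    show ?case by (rule step[OF Suc.IH[OF xreg_Suc_imp[OF Suc.prems]] Suc.prems])
  qed
qed

lemma xreg_SucE:
  fixes f :: "(real ^ 'n) \<times> real \<Rightarrow> 'e::euclidean_space"
  assumes "xreg T (Suc j) f"
  obtains f' where "xderiv T f f'" "\<And>v. xreg T j (\<lambda>p. f' p v)"
proof -
  let ?X = "(deriv_class xdirs (strip T) ^^ j) (cont_class (strip T))"
  define der where "der b D \<longleftrightarrow> deriv_along xdirs (strip T) (\<lambda>p. f p \<bullet> b) D \<and> (\<forall>v\<in>xdirs. (\<lambda>p. D p v) \<in> ?X)" for b D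
  have "\<exists>D. der b D" if b: "b \<in> Basis" for b
  proof -
    have "(\<lambda>p. f p \<bullet> b) \<in> deriv_class xdirs (strip T) ?X"
      using bspec[OF assms[unfolded xreg_def] b] unfolding funpow.simps comp_apply .
    then show ?thesis unfolding der_def by (rule deriv_classD)
  qed
  then obtain D where D': "\<And>b. b \<in> Basis \<Longrightarrow> der b (D b)" by metis
  have D: "\<And>b. b \<in> Basis \<Longrightarrow> deriv_along xdirs (strip T) (\<lambda>p. f p \<bullet> b) (D b)"
    "\<And>b v. b \<in> Basis \<Longrightarrow> v \<in> xdirs \<Longrightarrow> (\<lambda>p. D b p v) \<in> ?X"
    by (rule conjunct1[OF D'[unfolded der_def]], assumption,
        rule bspec[OF conjunct2[OF D'[unfolded der_def]]])
  let ?f' = "\<lambda>p v. \<Sum>b\<in>Basis. D b p (v, 0) *\<^sub>R b"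
  have "xderiv T f ?f'"
    by (rule xderiv_componentwise[OF deriv_along_imp_xderiv[OF D(1)]])
  moreover have "xreg T j (\<lambda>p. ?f' p v)" for v
    unfolding xreg_def
    by (auto simp: inner_sum_left inner_Basis if_distrib sum.If_cases intro!: D(2) cong: if_cong)
  ultimately show ?thesis using that by blast
qed

lemma xreg_xderiv:
  assumes "xreg T (Suc j) f" "xderiv T f f'" shows "xreg T j (\<lambda>p. f' p v)"
proof -
  obtain f'' where f'': "xderiv T f f''" "\<And>v. xreg T j (\<lambda>p. f'' p v)" using xreg_SucE[OF assms(1)] by blast
  show ?thesis by (rule xreg_cong[OF f''(2)[of v]]) (simp add: xderiv_unique[OF assms(2) f''(1)])
qed

context invariant_operator
begin

text \<open>
  Differentiating \<open>z = g + A (R + B z)\<close> in the direction \<open>v\<close> gives an equation of the same form, with the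
  same operator \<open>B\<close> and the source \<open>\<partial>R + (\<partial>B) z\<close>. The smallness condition is therefore the same at
  every order, and induction on \<open>j\<close> applies both to \<open>z\<close> and to its derivative.
\<close>

lemma xreg_linear_fixed_point:
  assumes B: "\<And>e. cper {0..T} (\<lambda>p. B p e)" "\<And>x t. t \<in> {0..T} \<Longrightarrow> linear (B (x, t))"
    and L: "\<And>x t e. t \<in> {0..T} \<Longrightarrow> norm (B (x, t) e) \<le> L * norm e" "0 \<le> L" "\<kappa> * L < 1"
    and "cper {0..T} z" "cper {0..T} g" "cper {0..T} R"
    and "\<And>x t. t \<in> {0..T} \<Longrightarrow> z (x, t) = g (x, t) + A (\<lambda>p. R p + B p (z p)) (x, t)"
    and "xreg T j g" "xreg T j R" "\<And>e. xreg T j (\<lambda>p. B p e)"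
  shows "xreg T j z"
  using assms(6-)
proof (induction j arbitrary: z g R)
  case 0
  then show ?case using cper_cont by (auto simp: xreg_0)
next
  case (Suc j)
  note z = Suc.prems(1) and g = Suc.prems(2) and R = Suc.prems(3) and eq = Suc.prems(4)
  obtain g' where g': "xderiv T g g'" "\<And>v. xreg T j (\<lambda>p. g' p v)" using xreg_SucE[OF Suc.prems(5)] by blast
  obtain R' where R': "xderiv T R R'" "\<And>v. xreg T j (\<lambda>p. R' p v)" using xreg_SucE[OF Suc.prems(6)] by blast
  have "\<exists>B'. xderiv T (\<lambda>p. B p e) B' \<and> (\<forall>v. xreg T j (\<lambda>p. B' p v))" for e
    by (rule xreg_SucE[OF Suc.prems(7)]) blast
  then obtain B' where B': "\<And>e. xderiv T (\<lambda>p. B p e) (B' e)" "\<And>e v. xreg T j (\<lambda>p. B' e p v)" by metis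
  note per = cper_xderiv[OF _ _ xreg_imp_continuous]
  have g'c: "cper {0..T} (\<lambda>p. g' p v)" and R'c: "cper {0..T} (\<lambda>p. R' p v)" and B'c: "cper {0..T} (\<lambda>p. B' e p v)" for v e
    by (rule per[OF g g'], rule per[OF R R'], rule per[OF B(1) B'])
  define Q where "Q p v = R' p v + (\<Sum>b\<in>Basis. (z p \<bullet> b) *\<^sub>R B' b p v)" for p v
  have zb: "cper {0..T} (\<lambda>p. z p \<bullet> b)" for b by (rule cper_compose[OF z]) (intro continuous_intros)
  have Qc: "cper {0..T} (\<lambda>p. Q p v)" for v
  proof -
    have "cper {0..T} (\<lambda>p. (z p \<bullet> b) *\<^sub>R B' b p v)" for b
      using zb[of b] B'c[of b v] by (auto simp: cper_def intro!: continuous_intros)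
    then show ?thesis unfolding Q_def by (intro cper_add R'c cper_sum)
  qed
  have linR': "linear (R' (x, t))" and linB': "linear (B' e (x, t))" if "t \<in> {0..T}" for x t e
    using R'(1) B'(1) that has_derivative_linear unfolding xderiv_def by blast+
  have Qlin: "linear (Q (x, t))" if "t \<in> {0..T}" for x t
    unfolding Q_def
    by (intro linear_compose_add linR'[OF that] linear_compose_sum ballI linear_compose_scale_right linB'[OF that])
  obtain Mz where Mz: "Mz \<ge> 0" "\<And>x t. t \<in> {0..T} \<Longrightarrow> norm (z (x, t)) \<le> Mz"
    using cper_bounded[OF compact_Icc z] by blast
  let ?d = "real DIM('e)"
  have d1: "?d \<ge> 1" using DIM_positive[where 'a='e] by linarith
  obtain Z where Z: "xderiv T z Z" "\<And>v. cper {0..T} (\<lambda>p. Z p v)"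
    "\<And>x t v. t \<in> {0..T} \<Longrightarrow> Z (x, t) v = g' (x, t) v + A (\<lambda>p. Q p v + B p (Z p v)) (x, t)"
  proof (rule xderiv_fixed_point[OF z cper_add[OF R cper_linear_apply[OF B z]] g eq g'(1) g'c Qc Qlin B L])
    fix \<epsilon> :: real assume \<epsilon>: "\<epsilon> > 0"
    define c where "c = \<epsilon> / (1 + ?d * Mz)"
    have e1: "c > 0" using \<epsilon> Mz(1) d1 by (simp add: c_def add_pos_nonneg)
    have c\<epsilon>: "c * (1 + ?d * Mz) = \<epsilon>"
      using add_pos_nonneg[OF zero_less_one mult_nonneg_nonneg[of ?d Mz]] Mz(1) by (simp add: c_def)
    obtain \<delta>R where \<delta>R: "\<delta>R > 0" "\<And>h x t. norm h < \<delta>R \<Longrightarrow> t \<in> {0..T} \<Longrightarrow>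
      norm (R (x + h, t) - R (x, t) - R' (x, t) h) \<le> c * norm h"
      using xderiv_uniform[OF R'(1) R'c e1] by blast
    have "\<exists>\<delta>>0. \<forall>h x. \<forall>t\<in>{0..T}. norm h < \<delta> \<longrightarrow>
      norm (B (x + h, t) b - B (x, t) b - B' b (x, t) h) \<le> c * norm h" for b
      by (rule xderiv_uniform[OF B'(1)[of b] B'c e1]) blast
    then obtain \<delta>B where \<delta>B: "\<And>b. \<delta>B b > 0" "\<And>b h x t. norm h < \<delta>B b \<Longrightarrow> t \<in> {0..T} \<Longrightarrow>
      norm (B (x + h, t) b - B (x, t) b - B' b (x, t) h) \<le> c * norm h" by metis
    have "\<exists>k>0. \<forall>x. \<forall>t\<in>{0..T}. \<forall>h. norm (B' b (x, t) h) \<le> k * norm h" for b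
    proof -
      have "\<exists>m. m \<ge> 0 \<and> (\<forall>x. \<forall>t\<in>{0..T}. norm (B' b (x, t) c) \<le> m)" for c
        by (rule cper_bounded[OF compact_Icc B'c[of b c]]) blast
      then obtain m where m: "\<And>c. m c \<ge> 0" "\<And>c x t. t \<in> {0..T} \<Longrightarrow> norm (B' b (x, t) c) \<le> m c" by metis
      have "norm (B' b (x, t) h) \<le> ((\<Sum>c\<in>Basis. m c) + 1) * norm h" if "t \<in> {0..T}" for x t h
      proof -
        have "(\<Sum>c\<in>Basis. norm (B' b (x, t) c)) \<le> (\<Sum>c\<in>Basis. m c) + 1"
          using sum_mono[of Basis "\<lambda>c. norm (B' b (x, t) c)" m] m(2)[OF that] by simp
        from mult_right_mono[OF this norm_ge_zero] norm_linear_le_sum_Basis[OF linB'[OF that], of b x h]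
        show ?thesis by (rule order_trans[rotated])
      qed
      moreover have "(\<Sum>c\<in>Basis. m c) + 1 > 0" using m(1) by (simp add: add_nonneg_pos sum_nonneg)
      ultimately show ?thesis by blast
    qed
    then obtain k where k: "\<And>b. k b > 0" "\<And>b x t h. t \<in> {0..T} \<Longrightarrow> norm (B' b (x, t) h) \<le> k b * norm h" by metis
    define \<delta> where "\<delta> = Min (insert \<delta>R ((\<lambda>b. min (\<delta>B b) (\<epsilon> / (?d * k b))) ` Basis))"
    have \<delta>0: "\<delta> > 0" unfolding \<delta>_def using \<delta>R(1) \<delta>B(1) k(1) \<epsilon> d1 by (subst Min_gr_iff) auto
    have \<delta>le: "\<delta> \<le> \<delta>R" "\<And>b. b \<in> Basis \<Longrightarrow> \<delta> \<le> \<delta>B b" "\<And>b. b \<in> Basis \<Longrightarrow> \<delta> \<le> \<epsilon> / (?d * k b)"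
    proof -
      show "\<delta> \<le> \<delta>R" unfolding \<delta>_def by (intro Min_le) auto
      have "\<delta> \<le> min (\<delta>B b) (\<epsilon> / (?d * k b))" if "b \<in> Basis" for b
        unfolding \<delta>_def using that by (intro Min_le) auto
      then show "\<delta> \<le> \<delta>B b" "\<delta> \<le> \<epsilon> / (?d * k b)" if "b \<in> Basis" for b using that by auto
    qed
    have "norm (R (x + h, t) + B (x + h, t) (z (x + h, t)) - (R (x, t) + B (x, t) (z (x, t))) - Q (x, t) h
        - B (x, t) (z (x + h, t) - z (x, t))) \<le> \<epsilon> * (norm h + norm (z (x + h, t) - z (x, t)))"
      (is "norm ?E \<le> _") if h: "norm h < \<delta>" and t: "t \<in> {0..T}" for h x t
    proof -
      let ?z = "z (x, t)" and ?w = "z (x + h, t)"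
      have rep: "B (y, t) v = (\<Sum>b\<in>Basis. (v \<bullet> b) *\<^sub>R B (y, t) b)" for y v
        by (rule linear_Basis_sum[OF B(2)[OF t]])
      \<comment> \<open>Product rule: the expansion of \<open>B\<close> is tested against the shifted value of \<open>z\<close>, which leaves
        a term of order \<open>norm h\<close> times the increment of \<open>z\<close>.\<close>
      have "?E = (R (x + h, t) - R (x, t) - R' (x, t) h)
        + ((\<Sum>b\<in>Basis. (?w \<bullet> b) *\<^sub>R B (x + h, t) b) - (\<Sum>b\<in>Basis. (?z \<bullet> b) *\<^sub>R B (x, t) b)
          - (\<Sum>b\<in>Basis. (?z \<bullet> b) *\<^sub>R B' b (x, t) h) - (\<Sum>b\<in>Basis. ((?w - ?z) \<bullet> b) *\<^sub>R B (x, t) b))"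
        unfolding Q_def rep[symmetric] by (simp add: algebra_simps)
      also have "\<dots> = (R (x + h, t) - R (x, t) - R' (x, t) h)
        + ((\<Sum>b\<in>Basis. (?w \<bullet> b) *\<^sub>R (B (x + h, t) b - B (x, t) b - B' b (x, t) h))
          + (\<Sum>b\<in>Basis. ((?w - ?z) \<bullet> b) *\<^sub>R B' b (x, t) h))"
        unfolding sum_subtractf[symmetric] sum.distrib[symmetric]
        by (intro arg_cong2[where f="(+)"] refl sum.cong) (simp add: inner_diff_left algebra_simps)
      finally have E: "?E = \<dots>" .
      have i1: "norm (\<Sum>b\<in>Basis. (?w \<bullet> b) *\<^sub>R (B (x + h, t) b - B (x, t) b - B' b (x, t) h))
        \<le> (\<Sum>b\<in>(Basis::'e set). Mz * (c * norm h))"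
      proof (rule order_trans[OF norm_sum sum_mono])
        fix b :: 'e assume b: "b \<in> Basis"
        have "\<bar>?w \<bullet> b\<bar> \<le> Mz" using Basis_le_norm[OF b, of ?w] Mz(2)[OF t, of "x + h"] by linarith
        then show "norm ((?w \<bullet> b) *\<^sub>R (B (x + h, t) b - B (x, t) b - B' b (x, t) h)) \<le> Mz * (c * norm h)"
          unfolding norm_scaleR using \<delta>B(2)[of h b t x] h \<delta>le(2)[OF b] t Mz(1) by (intro mult_mono) auto
      qed
      have i2: "norm (\<Sum>b\<in>Basis. ((?w - ?z) \<bullet> b) *\<^sub>R B' b (x, t) h) \<le> (\<Sum>b\<in>(Basis::'e set). norm (?w - ?z) * (\<epsilon> / ?d))"
      proof (rule order_trans[OF norm_sum sum_mono])
        fix b :: 'e assume b: "b \<in> Basis"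
        have "norm (B' b (x, t) h) \<le> k b * norm h" by (rule k(2)[OF t])
        also have "\<dots> \<le> k b * (\<epsilon> / (?d * k b))" using k(1)[of b] \<delta>le(3)[OF b] h by (intro mult_left_mono) auto
        also have "\<dots> = \<epsilon> / ?d" using k(1)[of b] by simp
        finally show "norm (((?w - ?z) \<bullet> b) *\<^sub>R B' b (x, t) h) \<le> norm (?w - ?z) * (\<epsilon> / ?d)"
          unfolding norm_scaleR real_norm_def[symmetric] using Basis_le_norm[OF b, of "?w - ?z"] by (intro mult_mono) auto
      qed
      have i3: "norm (R (x + h, t) - R (x, t) - R' (x, t) h) \<le> c * norm h"
        using \<delta>R(2)[of h t x] h \<delta>le(1) t by auto
      have "norm ?E \<le> c * norm h + ((\<Sum>b\<in>(Basis::'e set). Mz * (c * norm h))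
          + (\<Sum>b\<in>(Basis::'e set). norm (?w - ?z) * (\<epsilon> / ?d)))"
        unfolding E by (rule norm_triangle_mono[OF i3 norm_triangle_mono[OF i1 i2]])
      also have "\<dots> = (c * (1 + ?d * Mz)) * norm h + norm (?w - ?z) * \<epsilon>"
        using d1 by (simp add: algebra_simps)
      also have "\<dots> = \<epsilon> * (norm h + norm (?w - ?z))"
        unfolding c\<epsilon> by (simp add: algebra_simps)
      finally show ?thesis .
    qed
    then show "\<exists>\<delta>>0. \<forall>h x t. norm h < \<delta> \<longrightarrow> t \<in> {0..T} \<longrightarrow>
      norm (R (x + h, t) + B (x + h, t) (z (x + h, t)) - (R (x, t) + B (x, t) (z (x, t))) - Q (x, t) h
        - B (x, t) (z (x + h, t) - z (x, t))) \<le> \<epsilon> * (norm h + norm (z (x + h, t) - z (x, t)))"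
      using \<delta>0 by blast
  next
    fix Z assume "xderiv T z Z" "\<And>v. cper {0..T} (\<lambda>p. Z p v)"
      "\<And>x t v. t \<in> {0..T} \<Longrightarrow> Z (x, t) v = g' (x, t) v + A (\<lambda>p. Q p v + B p (Z p v)) (x, t)"
    then show thesis by (rule that)
  qed
  have zj: "xreg T j z"
    by (rule Suc.IH[OF z g R eq xreg_Suc_imp[OF Suc.prems(5)] xreg_Suc_imp[OF Suc.prems(6)] xreg_Suc_imp[OF Suc.prems(7)]])
  have Qj: "xreg T j (\<lambda>p. Q p v)" for v
    unfolding Q_def by (intro xreg_add R' xreg_sum xreg_scaleR xreg_inner zj B' finite_Basis)
  have "xreg T j (\<lambda>p. Z p v)" for v
    by (rule Suc.IH[OF Z(2) g'c Qc Z(3) g'(2) Qj xreg_Suc_imp[OF Suc.prems(7)]])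
  then show ?case by (rule xreg_SucI[OF cper_cont[OF z] Z(1)])
qed

end

lemma zero_xdirs: "0 \<in> xdirs"
  by (simp add: zero_prod_def)

lemma bounded_linear_xclass:
  assumes "bounded_linear f"
  shows "f \<in> (deriv_class xdirs (strip T) ^^ j) (cont_class (strip T))"
proof -
  have "f \<in> smooth_class xdirs (strip T) (cont_class (strip T))"
    by (rule smooth_class_bounded_linear[OF falg_cont_class zero_xdirs assms])
      (simp add: cont_class_def linear_continuous_on[OF assms])
  then show ?thesis unfolding smooth_class_def by simp
qed

lemma xreg_compose:
  fixes F :: "(real ^ 'n) \<times> real \<times> 'e::euclidean_space \<Rightarrow> real"
  assumes F: "F \<in> Cinf Q" and Q: "thick UNIV Q" and z: "xreg T j z"
    and zQ: "\<And>x t. t \<in> {0..T} \<Longrightarrow> (x, t, z (x, t)) \<in> Q"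
  shows "xreg T j (\<lambda>p. F (fst p, snd p, z p))"
proof -
  let ?X = "(deriv_class xdirs (strip T) ^^ j) (cont_class (strip T))"
  let ?G = "\<lambda>p. (fst p, snd p, z p)"
  have "(\<lambda>p. F (?G p)) \<in> ?X"
  proof (rule comp_closedD[OF comp_closed_funpow[OF falg_cont_class zero_xdirs Q comp_closed_cont_class] F])
    show "?G p \<in> Q" if "p \<in> strip T" for p using zQ[of "snd p" "fst p"] that by auto
    fix b :: "(real ^ 'n) \<times> real \<times> 'e" assume "b \<in> Basis"
    then consider i where "i \<in> Basis" "b = (i, 0, 0)" | "b = (0, 1, 0)" | i where "i \<in> Basis" "b = (0, 0, i)"
      by (auto simp: Basis_prod_def zero_prod_def)
    then show "(\<lambda>p. ?G p \<bullet> b) \<in> ?X"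
    proof cases
      case 1
      then show ?thesis
        using bounded_linear_xclass[of "\<lambda>p. fst p \<bullet> i" j T]
          bounded_linear_compose[OF bounded_linear_inner_left bounded_linear_fst, of i] by simp
    next
      case 2
      then show ?thesis using bounded_linear_xclass[OF bounded_linear_snd, of j T] by simp
    next
      case 3
      then show ?thesis using bspec[OF z[unfolded xreg_def], of i] by simp
    qed
  qed
  then show ?thesis by (simp add: xreg_def)
qed

lemma Cinf_vector_derivative:
  fixes N :: "'q::real_normed_vector \<Rightarrow> 'e::euclidean_space"
  assumes N: "\<And>b. b \<in> Basis \<Longrightarrow> (\<lambda>q. N q \<bullet> b) \<in> Cinf Q" and Q: "thick UNIV Q"
  obtains N' where "deriv_along UNIV Q N N'" "\<And>v b. b \<in> Basis \<Longrightarrow> (\<lambda>q. N' q v \<bullet> b) \<in> Cinf Q"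
proof -
  define der where "der b D \<longleftrightarrow> deriv_along UNIV Q (\<lambda>q. N q \<bullet> b) D \<and> (\<forall>v. (\<lambda>q. D q v) \<in> Cinf Q)" for b D
  have "\<exists>D. der b D" if b: "b \<in> Basis" for b
    by (rule smooth_class_derivative[OF Q falg_cont_class UNIV_I N[OF b]]) (auto simp: der_def)
  then obtain D where D': "\<And>b. b \<in> Basis \<Longrightarrow> der b (D b)" by metis
  have D: "\<And>b. b \<in> Basis \<Longrightarrow> deriv_along UNIV Q (\<lambda>q. N q \<bullet> b) (D b)"
    by (rule conjunct1[OF D'[unfolded der_def]])
  have D2: "(\<lambda>q. D b q v) \<in> Cinf Q" if "b \<in> Basis" for b v
    using conjunct2[OF D'[OF that, unfolded der_def]] by (rule spec)
  have "deriv_along UNIV Q N (\<lambda>q v. \<Sum>b\<in>Basis. D b q v *\<^sub>R b)"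
    by (rule deriv_along_componentwise[OF D])
  moreover have "(\<lambda>q. (\<Sum>b\<in>Basis. D b q v *\<^sub>R b) \<bullet> c) \<in> Cinf Q" if "c \<in> Basis" for v c
    using D2[OF that, of v] that
    by (simp add: inner_sum_left inner_Basis if_distrib sum.If_cases cong: if_cong)
  ultimately show ?thesis by (rule that)
qed

lemma periodic_deriv_along:
  fixes N :: "(real ^ 'n) \<times> 'c::real_normed_vector \<Rightarrow> 'e::real_normed_vector"
  assumes d: "deriv_along UNIV (UNIV \<times> C) N N'" and th: "thick UNIV ((UNIV :: (real ^ 'n) set) \<times> C)"
    and per: "\<And>x c. c \<in> C \<Longrightarrow> N (x + k, c) = N (x, c)" and c: "c \<in> C"
  shows "N' (x + k, c) v = N' (x, c) v"
proof -
  let ?Q = "(UNIV :: (real ^ 'n) set) \<times> C" and ?G = "\<lambda>q::(real ^ 'n) \<times> 'c. q + (k, 0)"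
  have G: "deriv_along UNIV ?Q ?G (\<lambda>_ v. v)"
    unfolding deriv_along_def by (auto intro!: derivative_eq_intros)
  have GQ: "?G q \<in> ?Q" if "q \<in> ?Q" for q using that by auto
  have "deriv_along UNIV ?Q (\<lambda>q. N (?G q)) (\<lambda>q v. N' (?G q) v)"
    by (rule deriv_along_chain[OF d G GQ])
  note shifted = this[unfolded deriv_along_def]
  have "deriv_along UNIV ?Q N (\<lambda>q v. N' (?G q) v)"
    unfolding deriv_along_def
  proof
    fix p :: "(real ^ 'n) \<times> 'c" assume p: "p \<in> ?Q"
    note der = bspec[OF shifted p]
    show "(N has_derivative (\<lambda>v. N' (?G p) v)) (at p within {q \<in> ?Q. q - p \<in> UNIV})"
    proof (rule has_derivative_cong_within[OF der])
      fix q assume "q \<in> {q \<in> ?Q. q - p \<in> UNIV}"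
      then show "N (?G q) = N q" using per[of "snd q" "fst q"] by (cases q) auto
    qed (use p in simp)
  qed
  from deriv_along_unique[OF th this d, of "(x, c)" v] c show ?thesis by simp
qed

lemma uniform_expansion:
  fixes N :: "(real ^ 'n) \<times> 'c::euclidean_space \<Rightarrow> 'e::real_normed_vector"
  assumes C: "compact C" "convex C"
    and d: "\<And>q. q \<in> UNIV \<times> C \<Longrightarrow> (N has_derivative N' q) (at q within UNIV \<times> C)"
    and c: "\<And>v. cper C (\<lambda>q. N' q v)" and e: "\<epsilon> > 0"
  obtains \<delta> where "\<delta> > 0" "\<And>q0 q1. q0 \<in> UNIV \<times> C \<Longrightarrow> q1 \<in> UNIV \<times> C \<Longrightarrow> norm (q1 - q0) < \<delta> \<Longrightarrow>
    norm (N q1 - N q0 - N' q0 (q1 - q0)) \<le> \<epsilon> * norm (q1 - q0)"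
proof -
  obtain \<delta> where \<delta>: "\<delta> > 0"
    "\<And>q q'. q \<in> UNIV \<times> C \<Longrightarrow> q' \<in> UNIV \<times> C \<Longrightarrow> dist q q' < \<delta> \<Longrightarrow> onorm (N' q - N' q') \<le> \<epsilon>"
    using cper_linear_uniform[OF C(1) c has_derivative_linear[OF d] e] by blast
  have cv: "convex ((UNIV :: (real ^ 'n) set) \<times> C)" by (intro convex_Times C) simp
  have "norm (N q1 - N q0 - N' q0 (q1 - q0)) \<le> \<epsilon> * norm (q1 - q0)"
    if q: "q0 \<in> UNIV \<times> C" "q1 \<in> UNIV \<times> C" and h: "norm (q1 - q0) < \<delta>" for q0 q1
  proof -
    have seg: "closed_segment q0 q1 \<subseteq> UNIV \<times> C" by (rule closed_segment_subset[OF q cv])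
    have "norm (N q1 - N q0 - N' q0 (q1 - q0)) \<le> norm (q1 - q0) * \<epsilon>"
    proof (rule differentiable_bound_linearization[where S="closed_segment q0 q1" and f=N and f'=N'])
      show "q0 + s *\<^sub>R (q1 - q0) \<in> closed_segment q0 q1" if "s \<in> {0..1}" for s
        using that by (auto simp: in_segment algebra_simps intro!: exI[of _ s])
      show "(N has_derivative N' y) (at y within closed_segment q0 q1)" if "y \<in> closed_segment q0 q1" for y
        by (rule has_derivative_subset[OF d seg]) (use that seg in auto)
      show "onorm (N' y - N' q0) \<le> \<epsilon>" if y: "y \<in> closed_segment q0 q1" for y
      proof (rule \<delta>(2)[OF _ q(1)])
        show "y \<in> UNIV \<times> C" using seg y by (rule subsetD)
        show "dist y q0 < \<delta>"
          using dist_in_closed_segment(1)[OF y] h by (simp add: dist_norm norm_minus_commute)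
      qed
    qed auto
    then show ?thesis by (simp add: mult.commute)
  qed
  with \<delta>(1) that show ?thesis by blast
qed

lemma norm_Pair3_le:
  fixes h :: "'a::real_normed_vector" and d :: "'b::real_normed_vector"
  shows "norm (h, 0::real, d) \<le> norm h + norm d"
proof -
  have "norm (h, 0::real, d) \<le> norm h + norm (0::real, d)" by (rule norm_Pair_le)
  also have "norm (0::real, d) = norm d" by (simp add: norm_Pair)
  finally show ?thesis .
qed

lemma cper_graph:
  fixes z :: "(real ^ 'n) \<times> real \<Rightarrow> 'e::euclidean_space"
  assumes F: "cper ({0..T} \<times> K) F" and z: "cper {0..T} z" and zK: "\<And>x t. t \<in> {0..T} \<Longrightarrow> z (x, t) \<in> K"
  shows "cper {0..T} (\<lambda>p. F (fst p, snd p, z p))"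
  unfolding cper_def
proof (intro conjI allI ballI impI)
  show "continuous_on (strip T) (\<lambda>p. F (fst p, snd p, z p))"
    by (rule continuous_on_compose2[OF cper_cont[OF F]])
      (use zK in \<open>auto intro!: continuous_intros cper_cont[OF z]\<close>)
  fix x k :: "real ^ 'n" and t assume t: "t \<in> {0..T}" and k: "\<forall>i. k $ i \<in> \<int>"
  then show "F (fst (x + k, t), snd (x + k, t), z (x + k, t)) = F (fst (x, t), snd (x, t), z (x, t))"
    using cper_per[OF F, of "(t, z (x, t))" k x] cper_per[OF z t, of k x] zK[OF t] by simp
qed

text \<open>
  The first derivative is obtained directly from the nonlinear equation and solves the linearised one, with
  coefficients \<open>N' (x, t, z)\<close> that are as regular as \<open>z\<close>. By the linear theory the derivative then has
  the regularity of \<open>z\<close>, so that \<open>z\<close> has one derivative more.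
\<close>

lemma (in invariant_operator) xreg_nonlinear_fixed_point:
  fixes N :: "(real ^ 'n) \<times> real \<times> 'e \<Rightarrow> 'e"
  assumes z: "cper {0..T} z" and zK: "\<And>x t. t \<in> {0..T} \<Longrightarrow> z (x, t) \<in> K"
    and K: "compact K" "convex K" and g: "cper {0..T} g" "\<And>j. xreg T j g"
    and eq: "\<And>x t. t \<in> {0..T} \<Longrightarrow> z (x, t) = g (x, t) + A (\<lambda>p. N (fst p, snd p, z p)) (x, t)"
    and Q: "thick UNIV Q" "UNIV \<times> {0..T} \<times> K \<subseteq> Q"
    and N: "cper ({0..T} \<times> K) N" "deriv_along UNIV Q N N'"
      "\<And>v b. b \<in> Basis \<Longrightarrow> (\<lambda>q. N' q v \<bullet> b) \<in> Cinf Q" "\<And>v. cper ({0..T} \<times> K) (\<lambda>q. N' q v)"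
    and L: "\<And>x t e \<zeta>. t \<in> {0..T} \<Longrightarrow> e \<in> K \<Longrightarrow> norm (N' (x, t, e) (0, 0, \<zeta>)) \<le> L * norm \<zeta>"
      "0 \<le> L" "\<kappa> * L < 1"
  shows "xreg T j z"
proof -
  let ?N' = "\<lambda>p. N' (fst p, snd p, z p)"
  have N'c: "cper {0..T} (\<lambda>p. ?N' p v)" for v by (rule cper_graph[OF N(4) z zK])
  have Nd: "(N has_derivative N' q) (at q within UNIV \<times> {0..T} \<times> K)" if "q \<in> UNIV \<times> {0..T} \<times> K" for q
    by (rule has_derivative_subset[where s=Q]) (use N(2) Q(2) that in \<open>auto simp: deriv_along_def\<close>)
  have lin: "linear (?N' (x, t))" if "t \<in> {0..T}" for x t
    using Nd[of "(x, t, z (x, t))"] zK[OF that] that has_derivative_linear by auto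
  let ?R = "\<lambda>p v. ?N' p (v, 0, 0)" and ?B = "\<lambda>p \<zeta>. ?N' p (0, 0, \<zeta>)"
  have linR: "linear (?R (x, t))" and linB: "linear (?B (x, t))" if "t \<in> {0..T}" for x t
    using linear_compose[OF _ lin[OF that], of "\<lambda>v. (v, 0, 0)" x] linear_compose[OF _ lin[OF that], of "\<lambda>v. (0, 0, v)" x]
    by (auto simp: comp_def linear_iff)
  obtain g' where g': "xderiv T g g'" "\<And>v. xreg T 0 (\<lambda>p. g' p v)" using xreg_SucE[OF g(2)[of "Suc 0"]] by blast
  have g'j: "xreg T j (\<lambda>p. g' p v)" for j v by (rule xreg_xderiv[OF g(2) g'(1)])
  have g'c: "cper {0..T} (\<lambda>p. g' p v)" for v
    by (rule cper_xderiv[OF g(1) g'(1) xreg_imp_continuous[OF g'(2)]])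
  have LB: "norm (?B (x, t) e) \<le> L * norm e" if "t \<in> {0..T}" for x t e
    using L(1)[OF that zK[OF that]] by simp
  obtain Z where Z: "xderiv T z Z" "\<And>v. cper {0..T} (\<lambda>p. Z p v)"
    "\<And>x t v. t \<in> {0..T} \<Longrightarrow> Z (x, t) v = g' (x, t) v + A (\<lambda>p. ?R p v + ?B p (Z p v)) (x, t)"
  proof (rule xderiv_fixed_point[OF z cper_graph[OF N(1) z zK] g(1) eq g'(1) g'c N'c linR N'c linB LB L(2,3)])
    fix \<epsilon> :: real assume \<epsilon>: "\<epsilon> > 0"
    obtain \<delta> where \<delta>: "\<delta> > 0" "\<And>q0 q1. q0 \<in> UNIV \<times> {0..T} \<times> K \<Longrightarrow> q1 \<in> UNIV \<times> {0..T} \<times> K \<Longrightarrow> norm (q1 - q0) < \<delta> \<Longrightarrow>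
      norm (N q1 - N q0 - N' q0 (q1 - q0)) \<le> \<epsilon> * norm (q1 - q0)"
    proof (rule uniform_expansion[OF compact_Times[OF compact_Icc K(1)] convex_Times[OF convex_real_interval(5) K(2)] Nd N(4) \<epsilon>])
      fix \<delta> :: real assume "\<delta> > 0" "\<And>q0 q1. q0 \<in> UNIV \<times> {0..T} \<times> K \<Longrightarrow> q1 \<in> UNIV \<times> {0..T} \<times> K \<Longrightarrow> norm (q1 - q0) < \<delta> \<Longrightarrow>
        norm (N q1 - N q0 - N' q0 (q1 - q0)) \<le> \<epsilon> * norm (q1 - q0)"
      then show thesis by (rule that)
    qed
    have "\<delta> / 2 > 0" using \<delta>(1) by simp
    obtain \<delta>' where \<delta>': "\<delta>' > 0"
      "\<And>x y c d. c \<in> {0..T} \<Longrightarrow> d \<in> {0..T} \<Longrightarrow> dist (x, c) (y, d) < \<delta>' \<Longrightarrow> dist (z (x, c)) (z (y, d)) < \<delta> / 2"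
      by (rule cper_uniform[OF compact_Icc z \<open>\<delta> / 2 > 0\<close>]) blast
    have "norm (N (x + h, t, z (x + h, t)) - N (x, t, z (x, t)) - ?R (x, t) h - ?B (x, t) (z (x + h, t) - z (x, t)))
        \<le> \<epsilon> * (norm h + norm (z (x + h, t) - z (x, t)))" if h: "norm h < min \<delta>' (\<delta> / 2)" and t: "t \<in> {0..T}" for h x t
    proof -
      let ?D = "z (x + h, t) - z (x, t)"
      have eqd: "(x + h, t, z (x + h, t)) - (x, t, z (x, t)) = (h, 0, ?D)" by simp
      have "dist (x + h, t) (x, t) = norm h" by (simp add: dist_Pair_Pair dist_norm)
      then have "norm ?D < \<delta> / 2" using \<delta>'(2)[OF t t, of "x + h" x] h by (simp add: dist_norm)
      then have sm: "norm (h, 0::real, ?D) < \<delta>" using norm_Pair3_le[of h ?D] h by auto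
      have "N' (x, t, z (x, t)) (h, 0, ?D) = ?R (x, t) h + ?B (x, t) ?D"
        using linear_add[OF lin[OF t], of x "(h, 0, 0)" "(0, 0, ?D)"] by simp
      then have "norm (N (x + h, t, z (x + h, t)) - N (x, t, z (x, t)) - ?R (x, t) h - ?B (x, t) ?D) \<le> \<epsilon> * norm (h, 0::real, ?D)"
        using \<delta>(2)[of "(x, t, z (x, t))" "(x + h, t, z (x + h, t))"] zK[OF t] t sm unfolding eqd by (simp add: algebra_simps)
      also have "\<dots> \<le> \<epsilon> * (norm h + norm ?D)" using norm_Pair3_le \<epsilon> by (intro mult_left_mono) auto
      finally show ?thesis .
    qed
    then show "\<exists>\<delta>>0. \<forall>h x t. norm h < \<delta> \<longrightarrow> t \<in> {0..T} \<longrightarrow>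
      norm (N (fst (x + h, t), snd (x + h, t), z (x + h, t)) - N (fst (x, t), snd (x, t), z (x, t))
        - ?R (x, t) h - ?B (x, t) (z (x + h, t) - z (x, t))) \<le> \<epsilon> * (norm h + norm (z (x + h, t) - z (x, t)))"
      using \<delta>(1) \<delta>'(1) by (intro exI[of _ "min \<delta>' (\<delta> / 2)"]) simp
  next
    fix Z assume "xderiv T z Z" "\<And>v. cper {0..T} (\<lambda>p. Z p v)"
      "\<And>x t v. t \<in> {0..T} \<Longrightarrow> Z (x, t) v = g' (x, t) v + A (\<lambda>p. ?R p v + ?B p (Z p v)) (x, t)"
    then show thesis by (rule that)
  qed
  show ?thesis
  proof (induction j)
    case 0
    then show ?case using cper_cont[OF z] by (simp add: xreg_0)
  next
    case (Suc j)
    have N'j: "xreg T j (\<lambda>p. ?N' p v)" for v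
      by (rule xreg_componentwise, rule xreg_compose[OF N(3) Q(1) Suc]) (use zK Q(2) in auto)
    have "xreg T j (\<lambda>p. Z p v)" for v
      by (rule xreg_linear_fixed_point[where B="?B", OF N'c linB LB L(2,3) Z(2) g'c N'c Z(3) g'j N'j N'j])
    then show ?case by (rule xreg_SucI[OF cper_cont[OF z] Z(1)])
  qed
qed

section \<open>Regularity in time\<close>

abbreviation Ck :: "nat \<Rightarrow> real \<Rightarrow> ((real ^ 'n) \<times> real \<Rightarrow> real) set" where
  "Ck k T \<equiv> (deriv_class UNIV (strip T) ^^ k) (cont_class (strip T))"

definition tderiv :: "real \<Rightarrow> ((real ^ 'n) \<times> real \<Rightarrow> real) \<Rightarrow> ((real ^ 'n) \<times> real \<Rightarrow> real) \<Rightarrow> bool" where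
  "tderiv T f g \<longleftrightarrow> (\<forall>x. \<forall>t\<in>{0..T}. ((\<lambda>s. f (x, s)) has_vector_derivative g (x, t)) (at t within {0..T}))"

lemma falg_Ck: "function_algebra (strip T) (Ck k T)"
  by (rule falg_funpow[OF falg_cont_class UNIV_I])

lemma Ck_continuous: "f \<in> Ck k T \<Longrightarrow> continuous_on (strip T) f"
proof (induction k)
  case (Suc k)
  then have "f \<in> deriv_class UNIV (strip T) (Ck k T)" by simp
  then have "f \<in> Ck k T" by (rule subsetD[OF deriv_class_subset])
  then show ?case by (rule Suc.IH)
qed (simp add: cont_class_def)

text \<open>
  Differentiate \<open>f (x, \<tau>) = f (x, 0) + \<integral>\<^sub>0\<^sup>\<tau> g (x, s) ds\<close> in \<open>x\<close> under the integral sign.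
\<close>

lemma tderiv_xderiv_commute:
  assumes f: "xderiv T f f'" "tderiv T f g" and g: "xderiv T g g'" and c: "continuous_on (strip T) g"
    "continuous_on (strip T) (\<lambda>p. g' p v)"
  shows "tderiv T (\<lambda>p. f' p v) (\<lambda>p. g' p v)"
  unfolding tderiv_def
proof (intro allI ballI)
  fix x :: "real ^ 'a" and t assume t: "t \<in> {0..T}"
  have "f' (x, \<tau>) v = f' (x, 0) v + integral {0..\<tau>} (\<lambda>s. g' (x, s) v)" if \<tau>: "\<tau> \<in> {0..T}" for \<tau>
  proof -
    have line: "f (x + h *\<^sub>R v, \<tau>) = f (x + h *\<^sub>R v, 0) + integral (cbox 0 \<tau>) (\<lambda>s. g (x + h *\<^sub>R v, s))" for h
    proof -
      have "((\<lambda>s. g (x + h *\<^sub>R v, s)) has_integral f (x + h *\<^sub>R v, \<tau>) - f (x + h *\<^sub>R v, 0)) {0..\<tau>}"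
      proof (rule fundamental_theorem_of_calculus)
        fix s assume s: "s \<in> {0..\<tau>}"
        have "((\<lambda>s. f (x + h *\<^sub>R v, s)) has_vector_derivative g (x + h *\<^sub>R v, s)) (at s within {0..T})"
          using f(2) s \<tau> by (simp add: tderiv_def)
        then show "((\<lambda>s. f (x + h *\<^sub>R v, s)) has_vector_derivative g (x + h *\<^sub>R v, s)) (at s within {0..\<tau>})"
          by (rule has_vector_derivative_within_subset) (use \<tau> in auto)
      qed (use \<tau> in auto)
      then show ?thesis by (simp add: integral_unique)
    qed
    have d0: "((\<lambda>h. f (x + h *\<^sub>R v, \<tau>)) has_vector_derivative f' (x, \<tau>) v) (at 0)"
      using xderiv_axis_DERIV[OF f(1) \<tau>] by (simp add: has_real_derivative_iff_has_vector_derivative)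
    have d1: "((\<lambda>h. f (x + h *\<^sub>R v, 0)) has_vector_derivative f' (x, 0) v) (at 0)"
      using xderiv_axis_DERIV[OF f(1), of 0 x v] \<tau> by (simp add: has_real_derivative_iff_has_vector_derivative)
    have "((\<lambda>h. integral (cbox 0 \<tau>) (\<lambda>s. g (x + h *\<^sub>R v, s))) has_vector_derivative
       integral (cbox 0 \<tau>) (\<lambda>s. g' (x + 0 *\<^sub>R v, s) v)) (at 0 within UNIV)"
    proof (rule leibniz_rule_vector_derivative)
      fix h s :: real assume "s \<in> cbox 0 \<tau>"
      then have s: "s \<in> {0..T}" using \<tau> by auto
      have "((\<lambda>k. g (x + h *\<^sub>R v + k *\<^sub>R v, s)) has_real_derivative g' (x + h *\<^sub>R v, s) v) (at 0)"
        by (rule xderiv_axis_DERIV[OF g s])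
      then show "((\<lambda>h. g (x + h *\<^sub>R v, s)) has_vector_derivative g' (x + h *\<^sub>R v, s) v) (at h within UNIV)"
        using DERIV_shift[of "\<lambda>h. g (x + h *\<^sub>R v, s)" "g' (x + h *\<^sub>R v, s) v" 0 h]
        by (simp add: has_real_derivative_iff_has_vector_derivative algebra_simps)
    next
      show "(\<lambda>s. g (x + h *\<^sub>R v, s)) integrable_on cbox 0 \<tau>" for h
        by (rule integrable_continuous, rule continuous_on_compose2[OF c(1)]) (use \<tau> in \<open>auto intro!: continuous_intros\<close>)
      show "continuous_on (UNIV \<times> cbox 0 \<tau>) (\<lambda>(h, s). g' (x + h *\<^sub>R v, s) v)"
        unfolding case_prod_beta
        by (rule continuous_on_compose2[OF c(2)]) (use \<tau> in \<open>auto intro!: continuous_intros\<close>)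
    qed auto
    then have d2: "((\<lambda>h. f (x + h *\<^sub>R v, 0) + integral (cbox 0 \<tau>) (\<lambda>s. g (x + h *\<^sub>R v, s))) has_vector_derivative
       f' (x, 0) v + integral (cbox 0 \<tau>) (\<lambda>s. g' (x, s) v)) (at 0)"
      using d1 by (intro has_vector_derivative_add) simp_all
    from vector_derivative_unique_at[OF d0 d2[folded line]] show ?thesis by simp
  qed
  note formula = this
  have "continuous_on {0..T} (\<lambda>s. g' (x, s) v)"
    by (rule continuous_on_compose2[OF c(2)]) (auto intro!: continuous_intros)
  from integral_has_vector_derivative[OF this t]
  have "((\<lambda>\<tau>. f' (x, 0) v + integral {0..\<tau>} (\<lambda>s. g' (x, s) v)) has_vector_derivative 0 + g' (x, t) v) (at t within {0..T})"
    by (intro has_vector_derivative_add has_vector_derivative_const)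
  then have "((\<lambda>\<tau>. f' (x, 0) v + integral {0..\<tau>} (\<lambda>s. g' (x, s) v)) has_vector_derivative g' (x, t) v) (at t within {0..T})"
    by simp
  then show "((\<lambda>s. f' (x, s) v) has_vector_derivative g' (x, t) v) (at t within {0..T})"
    by (rule has_vector_derivative_transform[OF t, rotated]) (rule formula)
qed

text \<open>
  Differentiability in \<open>x\<close> and a continuous time derivative give differentiability in all variables, also
  at the boundary times.
\<close>

lemma Ck_Suc_partials:
  assumes f: "f \<in> Ck k T" and x: "xderiv T f f'" "\<And>v. (\<lambda>p. f' p v) \<in> Ck k T"
    and t: "tderiv T f g" "g \<in> Ck k T"
  shows "f \<in> Ck (Suc k) T"
proof -
  have "f \<in> deriv_class UNIV (strip T) (Ck k T)"
  proof (rule deriv_classI[OF f])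
    show "deriv_along UNIV (strip T) f (\<lambda>p w. f' p (fst w) + snd w * g p)"
      unfolding deriv_along_def
    proof
      fix p :: "(real ^ 'a) \<times> real" assume "p \<in> strip T"
      then obtain x t where p: "p = (x, t)" "t \<in> {0..T}" by (cases p) auto
      have "((\<lambda>(x, t). f (x, t)) has_derivative (\<lambda>(a, b). f' (x, t) a + blinfun_apply (blinfun_scaleR_left (g (x, t))) b))
        (at (x, t) within UNIV \<times> {0..T})"
      proof (rule has_derivative_partialsI[where fy="\<lambda>x t. blinfun_scaleR_left (g (x, t))"])
        show "((\<lambda>x. f (x, t)) has_derivative f' (x, t)) (at x)"
          using assms(2) p(2) by (simp add: xderiv_def)
        show "((\<lambda>t. f (x, t)) has_derivative blinfun_apply (blinfun_scaleR_left (g (x, t)))) (at t within {0..T})"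
          if "t \<in> {0..T}" for x t
          using assms(4) that by (simp add: tderiv_def has_vector_derivative_def)
        have "continuous_on (UNIV \<times> {0..T}) (\<lambda>p. blinfun_scaleR_left (g p) :: real \<Rightarrow>\<^sub>L real)"
          by (rule bounded_linear.continuous_on[OF bounded_linear_blinfun_scaleR_left Ck_continuous[OF t(2)]])
        then show "continuous (at (x, t) within UNIV \<times> {0..T}) (\<lambda>(x, t). blinfun_scaleR_left (g (x, t)) :: real \<Rightarrow>\<^sub>L real)"
          using p(2) by (auto simp: continuous_on_eq_continuous_within case_prod_unfold)
      qed (use p in auto)
      then show "(f has_derivative (\<lambda>w. f' p (fst w) + snd w * g p)) (at p within {q \<in> strip T. q - p \<in> UNIV})"
        by (simp add: p case_prod_unfold)
    qed
    show "(\<lambda>p. f' p (fst w) + snd w * g p) \<in> Ck k T" for w :: "(real ^ 'a) \<times> real"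
      by (rule falg_add[OF falg_Ck x(2) falg_mult[OF falg_Ck falg_const[OF falg_Ck] t(2)]])
  qed
  then show ?thesis by simp
qed

text \<open>A time derivative can be traded for regularity in all variables without losing any regularity
  in \<open>x\<close>: the time derivative commutes with the \<open>x\<close>-derivatives, so that the statement for
  \<open>f\<close> contains the one for its \<open>x\<close>-derivatives.\<close>

lemma smooth_x_upgrade:
  fixes f :: "(real ^ 'n) \<times> real \<Rightarrow> real"
  assumes "f \<in> smooth_class xdirs (strip T) (Ck k T)" "g \<in> smooth_class xdirs (strip T) (Ck k T)" "tderiv T f g"
  shows "f \<in> smooth_class xdirs (strip T) (Ck (Suc k) T)"
proof -
  let ?X = "smooth_class xdirs (strip T) (Ck k T) :: ((real ^ 'n) \<times> real \<Rightarrow> real) set"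
  have sub: "h \<in> Ck k T" if "h \<in> ?X" for h :: "(real ^ 'n) \<times> real \<Rightarrow> real"
    using smooth_class_subset that by (rule subsetD)
  have xd: "\<exists>h'. xderiv T h h' \<and> (\<forall>v. (\<lambda>p. h' p v) \<in> ?X)" if h: "h \<in> ?X" for h
  proof (rule smooth_class_derivative[OF thick_xdirs falg_Ck zero_xdirs h])
    fix h' assume h': "deriv_along xdirs (strip T) h h'" "\<And>v. v \<in> xdirs \<Longrightarrow> (\<lambda>p. h' p v) \<in> ?X"
    have "(\<lambda>p. h' p (v, 0)) \<in> ?X" for v by (rule h'(2)) simp
    with deriv_along_imp_xderiv[OF h'(1)] show ?thesis
      by (intro exI[of _ "\<lambda>p v. h' p (v, 0)"] conjI allI)
  qed
  have "f \<in> (deriv_class xdirs (strip T) ^^ j) (Ck (Suc k) T)" for j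
    using assms
  proof (induction j arbitrary: f g)
    case 0
    obtain f' where f': "xderiv T f f'" "\<And>v. (\<lambda>p. f' p v) \<in> ?X" using xd[OF 0(1)] by metis
    show ?case using Ck_Suc_partials[OF sub[OF 0(1)] f'(1) sub[OF f'(2)] 0(3) sub[OF 0(2)]] by simp
  next
    case (Suc j)
    obtain f' where f': "xderiv T f f'" "\<And>v. (\<lambda>p. f' p v) \<in> ?X" using xd[OF Suc.prems(1)] by metis
    obtain g' where g': "xderiv T g g'" "\<And>v. (\<lambda>p. g' p v) \<in> ?X" using xd[OF Suc.prems(2)] by metis
    have td: "tderiv T (\<lambda>p. f' p v) (\<lambda>p. g' p v)" for v
      by (rule tderiv_xderiv_commute[OF f'(1) Suc.prems(3) g'(1) Ck_continuous[OF sub[OF Suc.prems(2)]] Ck_continuous[OF sub[OF g'(2)]]])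
    have "f \<in> deriv_class xdirs (strip T) ((deriv_class xdirs (strip T) ^^ j) (Ck (Suc k) T))"
      by (rule deriv_classI[OF Suc.IH[OF Suc.prems] xderiv_imp_deriv_along[OF f'(1)] Suc.IH[OF f'(2) g'(2) td]])
    then show ?case by simp
  qed
  then show ?thesis unfolding smooth_class_def by (rule INT_I)
qed

lemma deriv_along_UNIV: "deriv_along UNIV S f f' \<longleftrightarrow> (\<forall>p\<in>S. (f has_derivative f' p) (at p within S))"
  by (simp add: deriv_along_def)

lemma Cinf_imp_smooth_on:
  fixes f :: "'a::euclidean_space \<Rightarrow> real"
  assumes S: "thick UNIV S" and f: "f \<in> Cinf S"
  shows "smooth_on S f"
proof -
  have diff: "(g has_derivative frechet_derivative g (at p within S)) (at p within S)" if g: "g \<in> Cinf S" and p: "p \<in> S" for g p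
  proof (rule smooth_class_derivative[OF S falg_cont_class UNIV_I g])
    fix g' assume "deriv_along UNIV S g g'"
    then have "g differentiable (at p within S)" using p unfolding deriv_along_UNIV differentiable_def by blast
    then show ?thesis by (simp add: frechet_derivative_works)
  qed
  have "iter_deriv S vs f \<in> Cinf S" for vs
  proof (induction vs)
    case (Cons v vs)
    have "deriv_along UNIV S (iter_deriv S vs f) (\<lambda>p. frechet_derivative (iter_deriv S vs f) (at p within S))"
      unfolding deriv_along_UNIV using diff[OF Cons] by blast
    from smooth_class_has_deriv[OF S falg_cont_class UNIV_I Cons this UNIV_I, of v] show ?case by simp
  qed (simp add: f)
  from diff[OF this] show ?thesis
    unfolding smooth_on_def differentiable_on_def differentiable_def by blast
qed

lemma smooth_on_imp_Cinf:
  fixes f :: "'a::euclidean_space \<Rightarrow> 'b::euclidean_space"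
  assumes f: "smooth_on S f"
  shows "(\<lambda>p. f p \<bullet> b) \<in> Cinf S"
proof (rule smooth_class_coinduct[where F="range (\<lambda>vs p. iter_deriv S vs f p \<bullet> b)"])
  show "(\<lambda>p. f p \<bullet> b) \<in> range (\<lambda>vs p. iter_deriv S vs f p \<bullet> b)"
    by (rule range_eqI[of _ _ "[]"]) simp
  have d: "iter_deriv S vs f differentiable_on S" for vs using f by (simp add: smooth_on_def)
  show "range (\<lambda>vs p. iter_deriv S vs f p \<bullet> b) \<subseteq> cont_class S"
    using differentiable_imp_continuous_on[OF d] by (auto simp: cont_class_def intro!: continuous_intros)
  fix g assume "g \<in> range (\<lambda>vs p. iter_deriv S vs f p \<bullet> b)"
  then obtain vs where g: "g = (\<lambda>p. iter_deriv S vs f p \<bullet> b)" by blast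
  let ?D = "\<lambda>p v. frechet_derivative (iter_deriv S vs f) (at p within S) v \<bullet> b"
  have "deriv_along UNIV S g ?D"
    unfolding deriv_along_UNIV g
  proof
    fix p assume "p \<in> S"
    then have "(iter_deriv S vs f has_derivative frechet_derivative (iter_deriv S vs f) (at p within S)) (at p within S)"
      using d[of vs] by (simp add: differentiable_on_def frechet_derivative_works)
    then show "((\<lambda>p. iter_deriv S vs f p \<bullet> b) has_derivative ?D p) (at p within S)"
      by (rule has_derivative_inner_left)
  qed
  moreover have "(\<lambda>p. ?D p v) \<in> range (\<lambda>vs p. iter_deriv S vs f p \<bullet> b)" for v
    by (rule range_eqI[of _ _ "v # vs"]) simp
  ultimately show "\<exists>g'. deriv_along UNIV S g g' \<and> (\<forall>v\<in>UNIV. (\<lambda>p. g' p v) \<in> range (\<lambda>vs p. iter_deriv S vs f p \<bullet> b))"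
    by (intro exI[of _ ?D] conjI ballI)
qed

lemma thick_Times_Icc:
  fixes T :: real
  assumes "0 < T" "open K"
  shows "thick UNIV ((UNIV :: 'a::real_normed_vector set) \<times> {0..T} \<times> (K :: 'b::real_normed_vector set))"
  unfolding thick_def
proof (intro ballI allI impI)
  fix p v :: "'a \<times> real \<times> 'b" and e :: real
  assume p: "p \<in> UNIV \<times> {0..T} \<times> K" and e: "0 < e"
  obtain x t k where xt: "p = (x, t, k)" "0 \<le> t" "t \<le> T" "k \<in> K" using p by auto
  obtain a s w where v: "v = (a, s, w)" by (cases v) auto
  have "thick UNIV K" by (rule thick_open[OF assms(2)])
  have cont: "((\<lambda>d. k + d *\<^sub>R w) \<longlongrightarrow> k + 0 *\<^sub>R w) (at 0)" by (intro tendsto_intros)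
  then have "\<forall>\<^sub>F d in at (0::real). k + d *\<^sub>R w \<in> K"
    using topological_tendstoD[OF cont assms(2)] xt(4) by simp
  then obtain r where r: "r > 0" "\<And>d. d \<noteq> 0 \<Longrightarrow> dist d 0 < r \<Longrightarrow> k + d *\<^sub>R w \<in> K"
    unfolding eventually_at by blast
  define c where "c = min (min (e / 2) (r / 2)) (T / (2 * (\<bar>s\<bar> + 1)))"
  have c: "0 < c" "c < e" "c < r" using e r assms(1) by (auto simp: c_def)
  have cs: "c * \<bar>s\<bar> \<le> T / 2"
  proof -
    have "c * \<bar>s\<bar> \<le> T / (2 * (\<bar>s\<bar> + 1)) * (\<bar>s\<bar> + 1)" using c(1) by (intro mult_mono) (auto simp: c_def)
    also have "\<dots> = T / 2" by (simp add: field_simps add_nonneg_eq_0_iff)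
    finally show ?thesis .
  qed
  \<comment> \<open>Move towards the interior of the time interval.\<close>
  define d where "d = (if (t \<le> T / 2) = (0 \<le> s) then c else - c)"
  have ad: "\<bar>d\<bar> = c" using c by (auto simp: d_def)
  have "0 \<le> t + d * s \<and> t + d * s \<le> T"
  proof (cases "t \<le> T / 2")
    case True
    then have "d * s = c * \<bar>s\<bar>" by (auto simp: d_def)
    then show ?thesis using cs True xt c(1) by auto
  next
    case False
    then have "d * s = - (c * \<bar>s\<bar>)" by (auto simp: d_def abs_if)
    moreover have "0 \<le> c * \<bar>s\<bar>" using c(1) by simp
    ultimately show ?thesis using cs False xt by linarith
  qed
  moreover have "k + d *\<^sub>R w \<in> K" by (rule r(2)) (use ad c in auto)
  ultimately show "\<exists>d. 0 < \<bar>d\<bar> \<and> \<bar>d\<bar> < e \<and> p + d *\<^sub>R v \<in> UNIV \<times> {0..T} \<times> K \<and> d *\<^sub>R v \<in> UNIV"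
    using ad c by (intro exI[of _ d]) (auto simp: xt v)
qed

lemma thick_strip: assumes "0 < T" shows "thick UNIV (strip T :: ((real ^ 'n) \<times> real) set)"
  unfolding thick_def
proof (intro ballI allI impI)
  fix p v :: "(real ^ 'n) \<times> real" and e :: real assume p: "p \<in> strip T" and e: "0 < e"
  have "(fst p, snd p, 0::real) \<in> UNIV \<times> {0..T} \<times> UNIV" using p by auto
  with thick_Times_Icc[OF assms open_UNIV, unfolded thick_def] e
  obtain d where "0 < \<bar>d\<bar>" "\<bar>d\<bar> < e" "(fst p, snd p, 0::real) + d *\<^sub>R (fst v, snd v, 0) \<in> (UNIV :: (real ^ 'n) set) \<times> {0..T} \<times> UNIV"
    by (metis UNIV_I)
  then show "\<exists>d. 0 < \<bar>d\<bar> \<and> \<bar>d\<bar> < e \<and> p + d *\<^sub>R v \<in> strip T \<and> d *\<^sub>R v \<in> UNIV"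
    by (intro exI[of _ d]) (cases p, cases v, auto)
qed

section \<open>Smooth solutions of the heat equation with a source\<close>

lemma (in invariant_operator) xreg_op:
  assumes "cper {0..T} f" "xreg T j f" shows "xreg T j (A f)"
  using assms
proof (induction j arbitrary: f)
  case 0
  then show ?case using cper_cont[OF cper_op] by (simp add: xreg_0)
next
  case (Suc j)
  obtain f' where f': "xderiv T f f'" "\<And>v. xreg T j (\<lambda>p. f' p v)" using xreg_SucE[OF Suc.prems(2)] by blast
  have f'c: "cper {0..T} (\<lambda>p. f' p v)" for v
    by (rule cper_xderiv[OF Suc.prems(1) f'(1) xreg_imp_continuous[OF f'(2)]])
  show ?case
    by (rule xreg_SucI[OF cper_cont[OF cper_op[OF Suc.prems(1)]] xderiv_op[OF Suc.prems(1) f'(1) f'c] Suc.IH[OF f'c f'(2)]])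
qed

lemma xderiv_add: "xderiv T f f' \<Longrightarrow> xderiv T g g' \<Longrightarrow> xderiv T (\<lambda>p. f p + g p) (\<lambda>p v. f' p v + g' p v)"
  unfolding xderiv_def by (auto intro!: derivative_intros)

lemma xderiv_linear: "xderiv T f f' \<Longrightarrow> t \<in> {0..T} \<Longrightarrow> linear (f' (x, t))"
  using has_derivative_linear[of "\<lambda>y. f (y, t)" "f' (x, t)" "at x"] by (simp add: xderiv_def)

lemma xderiv_cong:
  assumes "xderiv T f f'" "\<And>x t. t \<in> {0..T} \<Longrightarrow> f (x, t) = g (x, t)"
    "\<And>x t v. t \<in> {0..T} \<Longrightarrow> f' (x, t) v = g' (x, t) v"
  shows "xderiv T g g'"
proof -
  have "(\<lambda>y. f (y, t)) = (\<lambda>y. g (y, t))" "f' (x, t) = g' (x, t)" if "t \<in> {0..T}" for x t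
    using assms(2,3)[OF that] by auto
  then show ?thesis using assms(1) unfolding xderiv_def by simp
qed

lemma xreg2_derivatives:
  fixes f :: "(real ^ 'n) \<times> real \<Rightarrow> 'e::euclidean_space"
  assumes f: "cper {0..T} f" "\<And>j. xreg T j f"
  obtains f' f'' where "xderiv T f f'" "\<And>v. cper {0..T} (\<lambda>p. f' p v)" "\<And>j v. xreg T j (\<lambda>p. f' p v)"
    "\<And>v. xderiv T (\<lambda>p. f' p v) (f'' v)" "\<And>v w. cper {0..T} (\<lambda>p. f'' v p w)" "\<And>j v w. xreg T j (\<lambda>p. f'' v p w)"
proof -
  obtain f' where f': "xderiv T f f'" using xreg_SucE[OF f(2)[of "Suc 0"]] by blast
  have r': "xreg T j (\<lambda>p. f' p v)" for j v by (rule xreg_xderiv[OF f(2) f'])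
  have c': "cper {0..T} (\<lambda>p. f' p v)" for v by (rule cper_xderiv[OF f(1) f' xreg_imp_continuous[OF r'[of 0]]])
  have "\<exists>g. xderiv T (\<lambda>p. f' p v) g" for v by (rule xreg_SucE[OF r'[of "Suc 0" v]]) blast
  then obtain f'' where f'': "\<And>v. xderiv T (\<lambda>p. f' p v) (f'' v)" by metis
  have r'': "xreg T j (\<lambda>p. f'' v p w)" for j v w by (rule xreg_xderiv[OF r' f''])
  have c'': "cper {0..T} (\<lambda>p. f'' v p w)" for v w by (rule cper_xderiv[OF c' f'' xreg_imp_continuous[OF r''[of 0]]])
  show ?thesis by (rule that[OF f' c' r' f'' c'' r''])
qed

text \<open>
  The space derivatives fall on the data and on the source, because both operators are invariant under
  translations; the time derivative comes from differentiating the Gaussian averages, with the Laplacian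
  under the average. Comparing them gives the heat equation.
\<close>

lemma heat_solution:
  fixes \<phi> f :: "(real ^ 'n) \<times> real \<Rightarrow> real"
  assumes T: "0 \<le> T" and \<phi>: "cper {0..T} \<phi>" "\<And>j. xreg T j \<phi>" and f: "cper {0..T} f" "\<And>j. xreg T j f"
  defines "q \<equiv> \<lambda>p. heat_flow \<phi> p + duhamel_heat f p"
  shows "cper {0..T} q" "\<And>j. xreg T j q" "q (x, 0) = \<phi> (x, 0)"
    "\<exists>q' q''. xderiv T q q' \<and> (\<forall>v. xderiv T (\<lambda>p. q' p v) (q'' v)) \<and>
       tderiv T q (\<lambda>p. (\<Sum>i\<in>UNIV. q'' (axis i 1) p (axis i 1)) + f p)"
proof -
  interpret H: invariant_operator T 1 "heat_flow :: ((real ^ 'n) \<times> real \<Rightarrow> real) \<Rightarrow> _"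
    by (rule heat_flow_operator[OF T])
  interpret D: invariant_operator T "2 * T" "duhamel_heat :: ((real ^ 'n) \<times> real \<Rightarrow> real) \<Rightarrow> _"
    by (rule duhamel_heat_operator[OF T])
  show "cper {0..T} q" unfolding q_def by (rule cper_add[OF H.cper_op[OF \<phi>(1)] D.cper_op[OF f(1)]])
  show "xreg T j q" for j unfolding q_def by (rule xreg_add[OF H.xreg_op[OF \<phi>] D.xreg_op[OF f]])
  show "q (x, 0) = \<phi> (x, 0)" by (simp add: q_def heat_flow_def duhamel_def gauss_average_0)
  obtain \<phi>' \<phi>'' where P: "xderiv T \<phi> \<phi>'" "\<And>v. cper {0..T} (\<lambda>p. \<phi>' p v)" "\<And>j v. xreg T j (\<lambda>p. \<phi>' p v)"
    "\<And>v. xderiv T (\<lambda>p. \<phi>' p v) (\<phi>'' v)" "\<And>v w. cper {0..T} (\<lambda>p. \<phi>'' v p w)" "\<And>j v w. xreg T j (\<lambda>p. \<phi>'' v p w)"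
  proof (rule xreg2_derivatives[OF \<phi>]) qed (rule that)
  obtain f' f'' where F: "xderiv T f f'" "\<And>v. cper {0..T} (\<lambda>p. f' p v)" "\<And>j v. xreg T j (\<lambda>p. f' p v)"
    "\<And>v. xderiv T (\<lambda>p. f' p v) (f'' v)" "\<And>v w. cper {0..T} (\<lambda>p. f'' v p w)" "\<And>j v w. xreg T j (\<lambda>p. f'' v p w)"
  proof (rule xreg2_derivatives[OF f]) qed (rule that)
  let ?l\<phi> = "\<lambda>p. \<Sum>i\<in>UNIV. \<phi>'' (axis i 1) p (axis i 1)" and ?lf = "\<lambda>p. \<Sum>i\<in>UNIV. f'' (axis i 1) p (axis i 1)"
  have hc: "heat_class T \<phi> ?l\<phi>" "heat_class T f ?lf"
    unfolding heat_class_def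
    by (intro conjI \<phi>(1) exI[of _ \<phi>'] exI[of _ \<phi>''] P allI refl)
       (intro conjI f(1) exI[of _ f'] exI[of _ f''] F allI refl)
  define q' where "q' p v = heat_flow (\<lambda>p. \<phi>' p v) p + duhamel_heat (\<lambda>p. f' p v) p" for p v
  define q'' where "q'' v p w = heat_flow (\<lambda>p. \<phi>'' v p w) p + duhamel_heat (\<lambda>p. f'' v p w) p" for v p w
  have d1: "xderiv T q q'"
    unfolding q_def q'_def[abs_def] by (rule xderiv_add[OF H.xderiv_op[OF \<phi>(1) P(1,2)] D.xderiv_op[OF f(1) F(1,2)]])
  have d2: "xderiv T (\<lambda>p. q' p v) (q'' v)" for v
    unfolding q''_def[abs_def] q'_def by (rule xderiv_add[OF H.xderiv_op[OF P(2,4,5)] D.xderiv_op[OF F(2,4,5)]])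
  have "tderiv T q (\<lambda>p. (\<Sum>i\<in>UNIV. q'' (axis i 1) p (axis i 1)) + f p)"
    unfolding tderiv_def
  proof (intro allI ballI)
    fix x :: "real ^ 'n" and t assume t: "t \<in> {0..T}"
    have "((\<lambda>s. q (x, s)) has_vector_derivative heat_flow ?l\<phi> (x, t) + (f (x, t) + duhamel_heat ?lf (x, t))) (at t within {0..T})"
      unfolding q_def
      by (rule has_vector_derivative_add[OF heat_flow_time_derivative[OF hc(1) t] duhamel_heat_time_derivative[OF hc(2) t]])
    moreover have "heat_flow ?l\<phi> (x, t) = (\<Sum>i\<in>UNIV. heat_flow (\<lambda>p. \<phi>'' (axis i 1) p (axis i 1)) (x, t))"
      using H.sum_op[of UNIV "\<lambda>i p. \<phi>'' (axis i 1) p (axis i 1)" t "\<lambda>_. 1" x, OF finite P(5) t] by simp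
    moreover have "duhamel_heat ?lf (x, t) = (\<Sum>i\<in>UNIV. duhamel_heat (\<lambda>p. f'' (axis i 1) p (axis i 1)) (x, t))"
      using D.sum_op[of UNIV "\<lambda>i p. f'' (axis i 1) p (axis i 1)" t "\<lambda>_. 1" x, OF finite F(5) t] by simp
    ultimately show "((\<lambda>s. q (x, s)) has_vector_derivative (\<Sum>i\<in>UNIV. q'' (axis i 1) (x, t) (axis i 1)) + f (x, t)) (at t within {0..T})"
      by (simp add: q''_def sum.distrib algebra_simps)
  qed
  then show "\<exists>q' q''. xderiv T q q' \<and> (\<forall>v. xderiv T (\<lambda>p. q' p v) (q'' v)) \<and>
       tderiv T q (\<lambda>p. (\<Sum>i\<in>UNIV. q'' (axis i 1) p (axis i 1)) + f p)"
    by (intro exI[of _ q'] exI[of _ q''] conjI allI d1 d2)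
qed

text \<open>
  The equation for \<open>u\<close> runs backwards from the terminal time. Reversal of time reduces it to the forward
  heat equation.
\<close>

definition reverse :: "real \<Rightarrow> ((real ^ 'n) \<times> real \<Rightarrow> 'e) \<Rightarrow> (real ^ 'n) \<times> real \<Rightarrow> 'e" where
  "reverse T f p = f (fst p, T - snd p)"

lemma cper_reverse: "cper {0..T} f \<Longrightarrow> cper {0..T} (reverse T f)"
proof -
  assume f: "cper {0..T} f"
  have "continuous_on (strip T) (\<lambda>p. f (fst p, T - snd p))"
    by (rule continuous_on_compose2[OF cper_cont[OF f]]) (auto intro!: continuous_intros)
  then show "cper {0..T} (reverse T f)"
    using f by (simp add: cper_def reverse_def)
qed

lemma xderiv_reverse: "xderiv T f f' \<Longrightarrow> xderiv T (reverse T f) (\<lambda>p v. reverse T (\<lambda>p. f' p v) p)"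
  unfolding xderiv_def reverse_def by simp

lemma xreg_reverse:
  fixes f :: "(real ^ 'n) \<times> real \<Rightarrow> 'e::euclidean_space"
  assumes "xreg T j f" shows "xreg T j (reverse T f)"
  using assms
proof (induction j arbitrary: f)
  case 0
  have "continuous_on (strip T) (\<lambda>p. f (fst p, T - snd p))"
    by (rule continuous_on_compose2[OF xreg_imp_continuous[OF 0]]) (auto intro!: continuous_intros)
  then show ?case by (simp add: xreg_0 reverse_def[abs_def])
next
  case (Suc j)
  obtain f' where f': "xderiv T f f'" "\<And>v. xreg T j (\<lambda>p. f' p v)" using xreg_SucE[OF Suc.prems] by blast
  have "xreg T j (reverse T f)" by (rule Suc.IH[OF xreg_Suc_imp[OF Suc.prems]])
  then show ?case by (rule xreg_SucI[OF xreg_imp_continuous xderiv_reverse[OF f'(1)] Suc.IH[OF f'(2)]])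
qed

lemma tderiv_reverse:
  assumes "tderiv T f g" shows "tderiv T (reverse T f) (\<lambda>p. - reverse T g p)"
  unfolding tderiv_def reverse_def
proof (intro allI ballI)
  fix x :: "real ^ 'a" and t assume t: "t \<in> {0..T}"
  have "(((\<lambda>s. f (x, s)) \<circ> (\<lambda>s. T - s)) has_vector_derivative (- 1) *\<^sub>R g (x, T - t)) (at t within {0..T})"
  proof (rule vector_diff_chain_within)
    show "((\<lambda>s. T - s) has_vector_derivative - 1) (at t within {0..T})"
      by (auto intro!: derivative_eq_intros)
    show "((\<lambda>s. f (x, s)) has_vector_derivative g (x, T - t)) (at (T - t) within (\<lambda>s. T - s) ` {0..T})"
      by (rule has_vector_derivative_within_subset[where S="{0..T}"]) (use assms t in \<open>auto simp: tderiv_def\<close>)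
  qed
  then show "((\<lambda>s. f (fst (x, s), T - snd (x, s))) has_vector_derivative - g (fst (x, t), T - snd (x, t))) (at t within {0..T})"
    by (simp add: comp_def)
qed

section \<open>The solution operator of the coupled system\<close>

text \<open>
  The unknown is \<open>(m, w)\<close> with \<open>w = Du\<close>. From the source \<open>(f, F)\<close> the operator computes the
  contribution to \<open>m\<close> of the divergence of \<open>F\<close>, forwards in time, and the contribution to
  \<open>w\<close> of the gradient of \<open>f\<close>, backwards in time. In both equations the source is differentiated
  once, and this costs only the factor \<open>sqrt (2 * T)\<close>.
\<close>

definition system_operator ::
  "real \<Rightarrow> ((real ^ 'n) \<times> real \<Rightarrow> real \<times> (real ^ 'n)) \<Rightarrow> (real ^ 'n) \<times> real \<Rightarrow> real \<times> (real ^ 'n)" where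
  "system_operator T f p = ((\<Sum>i\<in>UNIV. duhamel_grad i (\<lambda>q. snd (f q) $ i) p),
     (\<chi> i. reverse T (duhamel_grad i (reverse T (\<lambda>q. fst (f q)))) p))"

lemma cper_Pair: "cper C f \<Longrightarrow> cper C g \<Longrightarrow> cper C (\<lambda>p. (f p, g p))"
  unfolding cper_def by (auto intro!: continuous_intros)

lemma cper_vec_lambda: "(\<And>i. cper C (f i)) \<Longrightarrow> cper C (\<lambda>p. \<chi> i. f i p)"
  unfolding cper_def by (auto intro!: continuous_on_vec_lambda)

lemma cper_fst_snd: "cper C f \<Longrightarrow> cper C (\<lambda>p. fst (f p))" "cper C f \<Longrightarrow> cper C (\<lambda>p. snd (f p))"
  unfolding cper_def by (auto intro!: continuous_intros)

lemma cper_vec_nth: "cper C f \<Longrightarrow> cper C (\<lambda>p. f p $ i)"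
  unfolding cper_def by (auto intro!: continuous_intros)

lemma norm_vec_le_sum: "norm (x :: real ^ 'n) \<le> (\<Sum>i\<in>UNIV. \<bar>x $ i\<bar>)"
  by (rule norm_le_l1_cart)

lemma system_operator_invariant:
  assumes T: "0 \<le> T"
  shows "invariant_operator T (2 * real CARD('n) * sqrt (2 * T))
    (system_operator T :: ((real ^ 'n) \<times> real \<Rightarrow> real \<times> (real ^ 'n)) \<Rightarrow> _)"
proof
  note I = duhamel_grad_operator[OF T]
  have rt: "T - t \<in> {0..T}" if "t \<in> {0..T}" for t using that by auto
  show "0 \<le> T" by (rule T)
  show "0 \<le> 2 * real CARD('n) * sqrt (2 * T)" using T by simp
  fix f :: "(real ^ 'n) \<times> real \<Rightarrow> real \<times> (real ^ 'n)" assume f: "cper {0..T} f"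
  have f2: "cper {0..T} (\<lambda>q. snd (f q) $ i)" for i by (rule cper_vec_nth[OF cper_fst_snd(2)[OF f]])
  have f1: "cper {0..T} (reverse T (\<lambda>q. fst (f q)))" by (rule cper_reverse[OF cper_fst_snd(1)[OF f]])
  show "cper {0..T} (system_operator T f)"
    unfolding system_operator_def[abs_def]
    by (intro cper_Pair cper_sum cper_vec_lambda invariant_operator.cper_op[OF I] f2 cper_reverse f1)
  fix x :: "real ^ 'n" and t assume t: "t \<in> {0..T}"
  show "system_operator T (\<lambda>q. f (fst q + h, snd q)) (x, t) = system_operator T f (x + h, t)" for h
    using invariant_operator.shift_op[OF I f2 t, where h=h and x=x]
      invariant_operator.shift_op[OF I f1 rt[OF t], where h=h and x=x]
    by (simp add: system_operator_def reverse_def[abs_def])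
  show "norm (system_operator T f (x, t)) \<le> 2 * real CARD('n) * sqrt (2 * T) * M"
    if M: "\<And>y s. s \<in> {0..T} \<Longrightarrow> norm (f (y, s)) \<le> M" for M
  proof -
    have n1: "norm (fst (f (y, s))) \<le> M" if "s \<in> {0..T}" for y s
      using norm_fst_le[of "fst (f (y, s))" "snd (f (y, s))"] M[OF that, of y] by simp
    have n2: "norm (snd (f (y, s)) $ i) \<le> M" if "s \<in> {0..T}" for y s i
      using component_le_norm_cart[of "snd (f (y, s))" i] norm_snd_le[of "snd (f (y, s))" "fst (f (y, s))"] M[OF that, of y]
      by simp
    have b2: "\<bar>duhamel_grad i (\<lambda>q. snd (f q) $ i) (x, t)\<bar> \<le> sqrt (2 * T) * M" for i
      using invariant_operator.bound_op[OF I f2 n2 t] by simp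
    have b1: "\<bar>duhamel_grad i (reverse T (\<lambda>q. fst (f q))) (x, T - t)\<bar> \<le> sqrt (2 * T) * M" for i
      using invariant_operator.bound_op[OF I f1 _ rt[OF t], where M=M and x=x] n1 by (simp add: reverse_def)
    have "norm (system_operator T f (x, t)) \<le> norm (\<Sum>i\<in>UNIV. duhamel_grad i (\<lambda>q. snd (f q) $ i) (x, t))
        + norm ((\<chi> i. duhamel_grad i (reverse T (\<lambda>q. fst (f q))) (x, T - t)) :: real ^ 'n)"
      unfolding system_operator_def by (rule order_trans[OF norm_Pair_le]) (simp add: reverse_def)
    also have "\<dots> \<le> (\<Sum>i\<in>(UNIV :: 'n set). sqrt (2 * T) * M) + (\<Sum>i\<in>(UNIV :: 'n set). sqrt (2 * T) * M)"
      by (intro add_mono order_trans[OF norm_sum] order_trans[OF norm_vec_le_sum] sum_mono) (use b1 b2 in auto)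
    finally show ?thesis by (simp add: algebra_simps)
  qed
  fix g :: "(real ^ 'n) \<times> real \<Rightarrow> real \<times> (real ^ 'n)" and c assume g: "cper {0..T} g"
  have g2: "cper {0..T} (\<lambda>q. snd (g q) $ i)" for i by (rule cper_vec_nth[OF cper_fst_snd(2)[OF g]])
  have g1: "cper {0..T} (reverse T (\<lambda>q. fst (g q)))" by (rule cper_reverse[OF cper_fst_snd(1)[OF g]])
  show "system_operator T (\<lambda>q. f q + c *\<^sub>R g q) (x, t) = system_operator T f (x, t) + c *\<^sub>R system_operator T g (x, t)"
    using invariant_operator.linear_op[OF I f2 g2 t, where c=c and x=x]
      invariant_operator.linear_op[OF I f1 g1 rt[OF t], where c=c and x=x]
    by (simp add: system_operator_def reverse_def[abs_def] vec_eq_iff sum.distrib sum_distrib_left)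
qed

section \<open>Short-time existence for the coupled system\<close>

lemma Cinf_periodic_derivative:
  fixes N :: "(real ^ 'n) \<times> 'c::euclidean_space \<Rightarrow> 'e::euclidean_space"
  assumes N: "\<And>b. b \<in> Basis \<Longrightarrow> (\<lambda>q. N q \<bullet> b) \<in> Cinf (UNIV \<times> C0)"
    and th: "thick UNIV ((UNIV :: (real ^ 'n) set) \<times> C0)"
    and per: "\<And>c. c \<in> C0 \<Longrightarrow> torus_periodic (\<lambda>x. N (x, c))"
  obtains N' where "deriv_along UNIV (UNIV \<times> C0) N N'"
    "\<And>v b. b \<in> Basis \<Longrightarrow> (\<lambda>q. N' q v \<bullet> b) \<in> Cinf (UNIV \<times> C0)"
    "cper C0 N" "\<And>v. cper C0 (\<lambda>q. N' q v)"
proof -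
  obtain N' where N': "deriv_along UNIV (UNIV \<times> C0) N N'"
    "\<And>v b. b \<in> Basis \<Longrightarrow> (\<lambda>q. N' q v \<bullet> b) \<in> Cinf (UNIV \<times> C0)"
  proof (rule Cinf_vector_derivative[OF N th]) qed (assumption | rule that)+
  have c: "continuous_on (UNIV \<times> C0) F" if "\<And>b. b \<in> Basis \<Longrightarrow> (\<lambda>q. F q \<bullet> b) \<in> Cinf (UNIV \<times> C0)"
    for F :: "(real ^ 'n) \<times> 'c \<Rightarrow> 'e"
    using subsetD[OF smooth_class_subset that]
    by (subst continuous_on_componentwise) (simp add: cont_class_def)
  have c1: "cper C0 N" using c[OF N] per by (simp add: cper_def torus_periodic_def)
  have c2: "cper C0 (\<lambda>q. N' q v)" for v
    unfolding cper_def
  proof (intro conjI allI ballI impI)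
    show "continuous_on (UNIV \<times> C0) (\<lambda>q. N' q v)" by (rule c[OF N'(2)])
    fix x k :: "real ^ 'n" and cc assume cc: "cc \<in> C0" and k: "\<forall>i. k $ i \<in> \<int>"
    show "N' (x + k, cc) v = N' (x, cc) v"
      by (rule periodic_deriv_along[OF N'(1) th _ cc]) (use per k in \<open>simp add: torus_periodic_def\<close>)
  qed
  show ?thesis by (rule that[OF N'(1) N'(2) c1 c2])
qed

lemma cper_subset: "cper C0 f \<Longrightarrow> C \<subseteq> C0 \<Longrightarrow> cper C f"
  unfolding cper_def by (auto intro: continuous_on_subset)

text \<open>
  The two smallness conditions have different purposes: the first one keeps the ball of radius \<open>r\<close> around
  \<open>g\<close> invariant, the second one makes the map a contraction there.
\<close>

lemma (in invariant_operator) nonlinear_fixed_point: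
  fixes N :: "(real ^ 'n) \<times> real \<times> 'e \<Rightarrow> 'e"
  assumes g: "cper {0..T} g" and r: "0 \<le> r"
    and ballK: "\<And>x t e. t \<in> {0..T} \<Longrightarrow> norm (e - g (x, t)) \<le> r \<Longrightarrow> e \<in> K"
    and N: "cper ({0..T} \<times> K) N" "\<And>x t e. t \<in> {0..T} \<Longrightarrow> e \<in> K \<Longrightarrow> norm (N (x, t, e)) \<le> M"
      "\<And>x t e e'. t \<in> {0..T} \<Longrightarrow> e \<in> K \<Longrightarrow> e' \<in> K \<Longrightarrow> norm (N (x, t, e) - N (x, t, e')) \<le> L * norm (e - e')"
    and small: "\<kappa> * M \<le> r" "\<kappa> * L \<le> 1 / 2" "0 \<le> L"
  obtains z where "cper {0..T} z" "\<And>x t. t \<in> {0..T} \<Longrightarrow> z (x, t) \<in> K"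
    "\<And>x t. t \<in> {0..T} \<Longrightarrow> z (x, t) = g (x, t) + A (\<lambda>p. N (fst p, snd p, z p)) (x, t)"
proof -
  define \<Phi> where "\<Phi> f p = g p + A (\<lambda>p. N (fst p, snd p, f p)) p" for f p
  have inK: "f (x, t) \<in> K" if "\<And>p. p \<in> UNIV \<times> {0..T} \<Longrightarrow> norm (f p - g p) \<le> r" "t \<in> {0..T}" for f x t
    by (rule ballK[where x=x, OF that(2)]) (use that in auto)
  have cN: "cper {0..T} (\<lambda>p. N (fst p, snd p, f p))"
    if "cper {0..T} f" "\<And>p. p \<in> UNIV \<times> {0..T} \<Longrightarrow> norm (f p - g p) \<le> r" for f
    by (rule cper_graph[OF N(1) that(1) inK[OF that(2)]])
  show ?thesis
  proof (rule contraction_fixed_point[of "1 / 2" r T g \<Phi>])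
    fix f assume f: "cper {0..T} f" "\<And>p. p \<in> UNIV \<times> {0..T} \<Longrightarrow> norm (f p - g p) \<le> r"
    have "norm (\<Phi> f (x, t) - g (x, t)) \<le> r" if t: "t \<in> {0..T}" for x t
    proof -
      have "norm (A (\<lambda>p. N (fst p, snd p, f p)) (x, t)) \<le> \<kappa> * M"
      proof (rule bound_op[OF cN[OF f] _ t])
        fix y s assume s: "s \<in> {0..T}"
        show "norm (N (fst (y, s), snd (y, s), f (y, s))) \<le> M"
          using N(2)[OF s inK[OF f(2) s], of y y] by simp
      qed
      then show ?thesis using small(1) by (simp add: \<Phi>_def)
    qed
    then show "cper {0..T} (\<Phi> f) \<and> (\<forall>p\<in>UNIV \<times> {0..T}. norm (\<Phi> f p - g p) \<le> r)"
      unfolding \<Phi>_def[abs_def] using cper_add[OF g cper_op[OF cN[OF f]]] by auto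
  next
    fix f1 f2 \<delta> assume f1: "cper {0..T} f1" and f2: "cper {0..T} f2"
      and b1: "\<And>p. p \<in> UNIV \<times> {0..T} \<Longrightarrow> norm (f1 p - g p) \<le> r"
      and b2: "\<And>p. p \<in> UNIV \<times> {0..T} \<Longrightarrow> norm (f2 p - g p) \<le> r"
      and d: "\<And>p. p \<in> UNIV \<times> {0..T} \<Longrightarrow> norm (f1 p - f2 p) \<le> \<delta>"
    have \<delta>0: "0 \<le> \<delta>" using order_trans[OF norm_ge_zero d[of "(0, 0)"]] T0 by simp
    have "norm (\<Phi> f1 (x, t) - \<Phi> f2 (x, t)) \<le> 1 / 2 * \<delta>" if t: "t \<in> {0..T}" for x t
    proof -
      have "\<Phi> f1 (x, t) - \<Phi> f2 (x, t) = A (\<lambda>p. N (fst p, snd p, f1 p) - N (fst p, snd p, f2 p)) (x, t)"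
        using diff_op[OF cN[OF f1 b1] cN[OF f2 b2] t] unfolding \<Phi>_def by simp
      also have "norm \<dots> \<le> \<kappa> * (L * \<delta>)"
      proof (rule bound_op[OF cper_diff[OF cN[OF f1 b1] cN[OF f2 b2]] _ t])
        fix y s assume s: "s \<in> {0..T}"
        have "norm (N (y, s, f1 (y, s)) - N (y, s, f2 (y, s))) \<le> L * norm (f1 (y, s) - f2 (y, s))"
          by (rule N(3)[OF s inK[OF b1 s] inK[OF b2 s]])
        also have "\<dots> \<le> L * \<delta>" by (rule mult_left_mono[OF d small(3)]) (use s in simp)
        finally show "norm (N (fst (y, s), snd (y, s), f1 (y, s)) - N (fst (y, s), snd (y, s), f2 (y, s))) \<le> L * \<delta>" by simp
      qed
      also have "\<dots> \<le> 1 / 2 * \<delta>" using mult_right_mono[OF small(2) \<delta>0] by (simp add: mult.assoc)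
      finally show ?thesis .
    qed
    then show "\<forall>p\<in>UNIV \<times> {0..T}. norm (\<Phi> f1 p - \<Phi> f2 p) \<le> 1 / 2 * \<delta>" by auto
  next
    fix f assume f: "cper {0..T} f" "\<And>p. p \<in> UNIV \<times> {0..T} \<Longrightarrow> norm (f p - g p) \<le> r"
      and fix': "\<And>p. p \<in> UNIV \<times> {0..T} \<Longrightarrow> \<Phi> f p = f p"
    have e: "f (x, t) = g (x, t) + A (\<lambda>p. N (fst p, snd p, f p)) (x, t)" if "t \<in> {0..T}" for x t
      using fix'[of "(x, t)"] that unfolding \<Phi>_def by simp
    from that[OF f(1) inK[OF f(2)] e] show thesis .
  qed (use r g in auto)
qed

lemma xderiv_vec_lambda:
  fixes f :: "'i::finite \<Rightarrow> (real ^ 'n) \<times> real \<Rightarrow> real"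
  assumes "\<And>i. xderiv T (f i) (f' i)"
  shows "xderiv T (\<lambda>p. \<chi> i. f i p) (\<lambda>p v. \<chi> i. f' i p v)"
  unfolding xderiv_def
proof (intro allI ballI)
  fix x :: "real ^ 'n" and t assume t: "t \<in> {0..T}"
  show "((\<lambda>y. \<chi> i. f i (y, t)) has_derivative (\<lambda>v. \<chi> i. f' i (x, t) v)) (at x)"
    by (subst has_derivative_componentwise_within)
      (use assms t in \<open>auto simp: Basis_vec_def inner_axis xderiv_def\<close>)
qed

lemma xderiv_vec_nth:
  fixes f :: "(real ^ 'n) \<times> real \<Rightarrow> real ^ 'm"
  assumes "xderiv T f f'" shows "xderiv T (\<lambda>p. f p $ i) (\<lambda>p v. f' p v $ i)"
  using xderiv_inner[OF assms, of "axis i 1"] by (simp add: inner_axis)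

lemma tderiv_cong:
  assumes "tderiv T f g" "\<And>x t. t \<in> {0..T} \<Longrightarrow> f (x, t) = f1 (x, t)" "\<And>x t. t \<in> {0..T} \<Longrightarrow> g (x, t) = g1 (x, t)"
  shows "tderiv T f1 g1"
  unfolding tderiv_def
proof (intro allI ballI)
  fix x :: "real ^ 'a" and t assume t: "t \<in> {0..T}"
  have "((\<lambda>s. f (x, s)) has_vector_derivative g1 (x, t)) (at t within {0..T})"
    using assms(1,3) t by (simp add: tderiv_def)
  then show "((\<lambda>s. f1 (x, s)) has_vector_derivative g1 (x, t)) (at t within {0..T})"
    by (rule has_vector_derivative_transform[OF t, rotated]) (use assms(2) in auto)
qed

lemma linear_axis_sum:
  fixes f :: "real ^ 'n \<Rightarrow> real"
  assumes "linear f" shows "f v = (\<chi> i. f (axis i 1)) \<bullet> v"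
proof -
  have "f v = f (\<Sum>i\<in>UNIV. v $ i *\<^sub>R axis i 1)"
    by (simp add: basis_expansion scalar_mult_eq_scaleR[symmetric])
  then show ?thesis using assms by (simp add: linear_sum linear_cmul inner_vec_def mult.commute)
qed

text \<open>
  Functions all of whose \<open>x\<close>-derivatives exist and are \<open>k\<close> times continuously differentiable in all
  variables. The induction on time regularity has to carry all \<open>x\<close>-derivatives along, since the equations
  trade one time derivative for two in \<open>x\<close>.
\<close>

abbreviation Xk :: "nat \<Rightarrow> real \<Rightarrow> ((real ^ 'n) \<times> real \<Rightarrow> real) set" where
  "Xk k T \<equiv> smooth_class xdirs (strip T) (Ck k T)"

lemma falg_Xk: "function_algebra (strip T) (Xk k T)"
  by (rule falg_smooth_class[OF falg_Ck zero_xdirs])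

lemma Xk_bounded_linear: "bounded_linear f \<Longrightarrow> f \<in> Xk k T"
proof -
  assume f: "bounded_linear f"
  have "f \<in> Ck k T" using Cinf_bounded_linear[OF f, of "strip T"] unfolding smooth_class_def by simp
  then show ?thesis by (rule smooth_class_bounded_linear[OF falg_Ck zero_xdirs f])
qed

lemma Xk_xderiv:
  assumes "f \<in> Xk k T" "xderiv T f f'" shows "(\<lambda>p. f' p v) \<in> Xk k T"
proof -
  have "(v, 0::real) \<in> xdirs" by simp
  from smooth_class_has_deriv[OF thick_xdirs falg_Ck zero_xdirs assms(1) xderiv_imp_deriv_along[OF assms(2)] this]
  show ?thesis by simp
qed

lemma Xk_compose:
  fixes F :: "(real ^ 'n) \<times> real \<times> real \<times> (real ^ 'n) \<Rightarrow> real"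
  assumes F: "F \<in> Cinf Q" and Q: "thick UNIV Q" and m: "m \<in> Xk k T" and w: "\<And>i. (\<lambda>p. w p $ i) \<in> Xk k T"
    and zQ: "\<And>x t. t \<in> {0..T} \<Longrightarrow> (x, t, m (x, t), w (x, t)) \<in> Q"
  shows "(\<lambda>p. F (fst p, snd p, m p, w p)) \<in> Xk k T"
proof -
  let ?G = "\<lambda>p. (fst p, snd p, m p, w p)"
  have "comp_closed (strip T) Q (Ck k T)"
    by (rule comp_closed_funpow[OF falg_cont_class UNIV_I Q comp_closed_cont_class])
  then have "comp_closed (strip T) Q (Xk k T)"
    by (rule comp_closed_smooth_class[OF falg_Ck zero_xdirs Q])
  from this F show "(\<lambda>p. F (?G p)) \<in> Xk k T"
  proof (rule comp_closedD)
    show "?G p \<in> Q" if "p \<in> strip T" for p using zQ[of "snd p" "fst p"] that by auto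
    fix b :: "(real ^ 'n) \<times> real \<times> real \<times> (real ^ 'n)" assume "b \<in> Basis"
    then consider i where "b = (axis i 1, 0, 0, 0)" | "b = (0, 1, 0, 0)" | "b = (0, 0, 1, 0)" | i where "b = (0, 0, 0, axis i 1)"
      by (auto simp: Basis_prod_def zero_prod_def Basis_vec_def)
    then show "(\<lambda>p. ?G p \<bullet> b) \<in> Xk k T"
    proof cases
      case 1
      have "bounded_linear (\<lambda>p::(real ^ 'n) \<times> real. fst p \<bullet> axis i 1)"
        by (rule bounded_linear_compose[OF bounded_linear_inner_left bounded_linear_fst])
      from Xk_bounded_linear[OF this] 1 show ?thesis by simp
    next
      case 2
      then show ?thesis using Xk_bounded_linear[OF bounded_linear_snd] by simp
    next
      case 3
      then show ?thesis using m by simp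
    next
      case 4
      then show ?thesis using w[of i] by (simp add: inner_axis)
    qed
  qed
qed

text \<open>The equations themselves provide the time derivatives: each use of them makes one more
  derivative in all variables continuous.\<close>

lemma system_bootstrap:
  fixes N1 :: "(real ^ 'n) \<times> real \<times> real \<times> (real ^ 'n) \<Rightarrow> real" and N2 :: "(real ^ 'n) \<times> real \<times> real \<times> (real ^ 'n) \<Rightarrow> real ^ 'n"
  assumes Q: "thick UNIV Q" and N1: "N1 \<in> Cinf Q" and N2: "\<And>i. (\<lambda>q. N2 q $ i) \<in> Cinf Q"
    and zQ: "\<And>x t. t \<in> {0..T} \<Longrightarrow> (x, t, m (x, t), w (x, t)) \<in> Q"
    and x: "xderiv T u (\<lambda>p v. w p \<bullet> v)" "xderiv T w W" "xderiv T m (\<lambda>p v. D p \<bullet> v)" "xderiv T D DM"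
      "xderiv T (\<lambda>p. N2 (fst p, snd p, m p, w p)) D2"
    and t: "tderiv T u (\<lambda>p. - (\<Sum>i\<in>UNIV. W p (axis i 1) $ i) - N1 (fst p, snd p, m p, w p))"
      "tderiv T m (\<lambda>p. (\<Sum>i\<in>UNIV. DM p (axis i 1) $ i) + (\<Sum>i\<in>UNIV. D2 p (axis i 1) $ i))"
    and reg: "\<And>j. xreg T j u" "\<And>j. xreg T j m"
  shows "u \<in> Cinf (strip T)" "m \<in> Cinf (strip T)"
proof -
  have "u \<in> Xk k T \<and> m \<in> Xk k T" for k
  proof (induction k)
    case 0
    show ?case using reg unfolding xreg_def smooth_class_def by simp
  next
    case (Suc k)
    then have u: "u \<in> Xk k T" and m: "m \<in> Xk k T" by auto
    have w: "(\<lambda>p. w p $ i) \<in> Xk k T" for i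
      using Xk_xderiv[OF u x(1), of "axis i 1"] by (simp add: inner_axis)
    have D: "(\<lambda>p. D p $ i) \<in> Xk k T" for i
      using Xk_xderiv[OF m x(3), of "axis i 1"] by (simp add: inner_axis)
    have n2: "(\<lambda>p. N2 (fst p, snd p, m p, w p) $ i) \<in> Xk k T" for i
      by (rule Xk_compose[OF N2 Q m w zQ])
    have n1: "(\<lambda>p. N1 (fst p, snd p, m p, w p)) \<in> Xk k T"
      by (rule Xk_compose[OF N1 Q m w zQ])
    have "(\<lambda>p. - (\<Sum>i\<in>UNIV. W p (axis i 1) $ i) - N1 (fst p, snd p, m p, w p)) \<in> Xk k T"
      by (intro falg_diff[OF falg_Xk _ n1] falg_uminus[OF falg_Xk] falg_sum[OF falg_Xk finite] Xk_xderiv[OF w xderiv_vec_nth[OF x(2)]])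
    from smooth_x_upgrade[OF u this t(1)] have 1: "u \<in> Xk (Suc k) T" .
    have "(\<lambda>p. (\<Sum>i\<in>UNIV. DM p (axis i 1) $ i) + (\<Sum>i\<in>UNIV. D2 p (axis i 1) $ i)) \<in> Xk k T"
      by (intro falg_add[OF falg_Xk] falg_sum[OF falg_Xk finite] Xk_xderiv[OF D xderiv_vec_nth[OF x(4)]]
          Xk_xderiv[OF n2 xderiv_vec_nth[OF x(5)]])
    from smooth_x_upgrade[OF m this t(2)] have "m \<in> Xk (Suc k) T" .
    with 1 show ?case by blast
  qed
  then have "u \<in> Ck k T" "m \<in> Ck k T" for k using subsetD[OF smooth_class_subset] by blast+
  then show "u \<in> Cinf (strip T)" "m \<in> Cinf (strip T)" unfolding smooth_class_def by auto
qed

lemma time_independent_cper_xreg: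
  fixes \<phi> :: "real ^ 'n \<Rightarrow> real"
  assumes "\<phi> \<in> Cinf UNIV" "torus_periodic \<phi>"
  shows "cper {0..T} (\<lambda>q. \<phi> (fst q))" "xreg T j (\<lambda>q. \<phi> (fst q))"
proof -
  have th: "thick UNIV (UNIV :: (real ^ 'n) set)" by (rule thick_open) simp
  have "(\<lambda>q. \<phi> (fst q)) \<in> (deriv_class xdirs (strip T) ^^ j) (cont_class (strip T))" for j
  proof (rule comp_closedD[OF comp_closed_funpow[OF falg_cont_class zero_xdirs th comp_closed_cont_class] assms(1)])
    fix b :: "real ^ 'n"
    show "(\<lambda>p. fst p \<bullet> b) \<in> (deriv_class xdirs (strip T) ^^ j) (cont_class (strip T))"
      by (rule bounded_linear_xclass, rule bounded_linear_compose[OF bounded_linear_inner_left bounded_linear_fst])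
  qed simp
  then show x: "xreg T j (\<lambda>q. \<phi> (fst q))" for j by (simp add: xreg_def)
  show "cper {0..T} (\<lambda>q. \<phi> (fst q))"
    using xreg_imp_continuous[OF x[of 0]] assms(2) by (simp add: cper_def torus_periodic_def)
qed

text \<open>
  The part of the solution that is due to the initial density and to the gradient of the terminal cost.
\<close>

definition system_data ::
  "real \<Rightarrow> (real ^ 'n \<Rightarrow> real) \<Rightarrow> (real ^ 'n \<Rightarrow> real ^ 'n \<Rightarrow> real) \<Rightarrow> (real ^ 'n) \<times> real \<Rightarrow> real \<times> (real ^ 'n)" where
  "system_data T m0 \<Psi>' p = (heat_flow (\<lambda>q. m0 (fst q)) p,
     (\<chi> i. reverse T (heat_flow (\<lambda>q. \<Psi>' (fst q) (axis i 1))) p))"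

text \<open>
  Solutions of \<open>- u\<^sub>t - \<Delta>u = N1 (x, t, m, Du)\<close>, \<open>m\<^sub>t - \<Delta>m = div (N2 (x, t, m, Du))\<close> with \<open>w = Du\<close>. The
  bound functions are the derivatives in the equations: \<open>W\<close> of \<open>w\<close>, \<open>D\<close> of \<open>m\<close>, \<open>DM\<close> of \<open>D\<close> and \<open>D2\<close> of
  \<open>N2\<close> along the solution, so that the sums over the axes are Laplacians and a divergence.
\<close>

definition classical_solution ::
  "real \<Rightarrow> ((real ^ 'n) \<times> real \<times> real \<times> (real ^ 'n) \<Rightarrow> real) \<Rightarrow> ((real ^ 'n) \<times> real \<times> real \<times> (real ^ 'n) \<Rightarrow> real ^ 'n) \<Rightarrow>
   (real ^ 'n \<Rightarrow> real) \<Rightarrow> (real ^ 'n \<Rightarrow> real) \<Rightarrow>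
   ((real ^ 'n) \<times> real \<Rightarrow> real) \<Rightarrow> ((real ^ 'n) \<times> real \<Rightarrow> real) \<Rightarrow> ((real ^ 'n) \<times> real \<Rightarrow> real ^ 'n) \<Rightarrow> bool" where
  "classical_solution T N1 N2 \<Psi> m0 u m w \<longleftrightarrow>
     cper {0..T} u \<and> cper {0..T} m \<and> u \<in> Cinf (strip T) \<and> m \<in> Cinf (strip T) \<and>
     (\<exists>W D DM D2. xderiv T u (\<lambda>p v. w p \<bullet> v) \<and> xderiv T w W \<and> xderiv T m (\<lambda>p v. D p \<bullet> v) \<and> xderiv T D DM \<and>
       xderiv T (\<lambda>p. N2 (fst p, snd p, m p, w p)) D2 \<and>
       tderiv T u (\<lambda>p. - (\<Sum>i\<in>UNIV. W p (axis i 1) $ i) - N1 (fst p, snd p, m p, w p)) \<and>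
       tderiv T m (\<lambda>p. (\<Sum>i\<in>UNIV. DM p (axis i 1) $ i) + (\<Sum>i\<in>UNIV. D2 p (axis i 1) $ i))) \<and>
     (\<forall>x. u (x, T) = \<Psi> x) \<and> (\<forall>x. m (x, 0) = m0 x)"

text \<open>
  A fixed point that is smooth in \<open>x\<close> solves the system: \<open>m\<close> is a solution of the heat equation with
  source \<open>div (N2 (m, w))\<close>, and the second component of the fixed-point equation is the gradient
  of the Duhamel formula for \<open>u\<close>, so that \<open>w = Du\<close>.
\<close>

lemma system_of_fixed_point:
  fixes N1 :: "(real ^ 'n) \<times> real \<times> real \<times> (real ^ 'n) \<Rightarrow> real"
    and N2 :: "(real ^ 'n) \<times> real \<times> real \<times> (real ^ 'n) \<Rightarrow> real ^ 'n"
  assumes T: "0 \<le> T" and Q: "thick UNIV Q" and N1: "N1 \<in> Cinf Q" and N2: "\<And>i. (\<lambda>q. N2 q $ i) \<in> Cinf Q"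
    and m0: "m0 \<in> Cinf UNIV" "torus_periodic m0"
    and \<Psi>: "\<Psi> \<in> Cinf UNIV" "torus_periodic \<Psi>"
      "\<And>x. (\<Psi> has_derivative \<Psi>' x) (at x)"
    and z: "cper {0..T} z" "\<And>j. xreg T j z" and zQ: "\<And>x t. t \<in> {0..T} \<Longrightarrow> (x, t, z (x, t)) \<in> Q"
    and n: "cper {0..T} (\<lambda>p. N1 (fst p, snd p, z p))" "cper {0..T} (\<lambda>p. N2 (fst p, snd p, z p))"
    and eq: "\<And>x t. t \<in> {0..T} \<Longrightarrow> z (x, t) = system_data T m0 \<Psi>' (x, t)
       + system_operator T (\<lambda>p. (N1 (fst p, snd p, z p), N2 (fst p, snd p, z p))) (x, t)"
  shows "\<exists>u. classical_solution T N1 N2 \<Psi> m0 u (\<lambda>p. fst (z p)) (\<lambda>p. snd (z p))"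
proof -
  interpret D: invariant_operator T "2 * T" "duhamel_heat :: ((real ^ 'n) \<times> real \<Rightarrow> real) \<Rightarrow> _"
    by (rule duhamel_heat_operator[OF T])
  interpret H: invariant_operator T 1 "heat_flow :: ((real ^ 'n) \<times> real \<Rightarrow> real) \<Rightarrow> _"
    by (rule heat_flow_operator[OF T])
  have T0: "0 \<in> {0..T}" and TT: "T \<in> {0..T}" using T by auto
  have rt: "T - t \<in> {0..T}" if "t \<in> {0..T}" for t using that by auto
  define m w where "m p = fst (z p)" and "w p = snd (z p)" for p
  have zmw: "z p = (m p, w p)" for p by (simp add: m_def w_def)
  define n1 n2 where "n1 p = N1 (fst p, snd p, z p)" and "n2 p = N2 (fst p, snd p, z p)" for p
  have n1c: "cper {0..T} n1" and n2c: "cper {0..T} (\<lambda>p. n2 p $ i)" for i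
    using n cper_vec_nth[OF n(2), of i] by (simp_all add: n1_def[abs_def] n2_def[abs_def])
  have n1r: "xreg T j n1" for j
    unfolding n1_def[abs_def] by (rule xreg_compose[OF N1 Q z(2) zQ])
  have n2r: "xreg T j (\<lambda>p. n2 p $ i)" for i j
    unfolding n2_def by (rule xreg_compose[OF N2 Q z(2) zQ])
  have "\<exists>d. xderiv T (\<lambda>p. n2 p $ i) d" for i by (rule xreg_SucE[OF n2r[of "Suc 0" i]]) blast
  then obtain d2 where d2: "\<And>i. xderiv T (\<lambda>p. n2 p $ i) (d2 i)" by metis
  have d2r: "xreg T j (\<lambda>p. d2 i p v)" for i v j by (rule xreg_xderiv[OF n2r d2])
  have d2c: "cper {0..T} (\<lambda>p. d2 i p v)" for i v
    by (rule cper_xderiv[OF n2c d2 xreg_imp_continuous[OF d2r[of 0]]])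
  define f where "f p = (\<Sum>i\<in>UNIV. d2 i p (axis i 1))" for p
  have fc: "cper {0..T} f" and fr: "xreg T j f" for j
    unfolding f_def[abs_def] by (rule cper_sum[OF d2c], rule xreg_sum[OF d2r finite])
  let ?\<mu> = "\<lambda>q. m0 (fst q)" and ?\<psi> = "\<lambda>q. \<Psi> (fst q)"
  note \<mu>c = time_independent_cper_xreg[OF m0, of T] and \<psi>c = time_independent_cper_xreg[OF \<Psi>(1,2), of T]

  \<comment> \<open>The density.\<close>
  define qm where "qm p = heat_flow ?\<mu> p + duhamel_heat f p" for p
  note hm = heat_solution[OF T \<mu>c fc fr, folded qm_def]
  obtain q' q'' where q: "xderiv T qm q'" "\<And>v. xderiv T (\<lambda>p. q' p v) (q'' v)"
    "tderiv T qm (\<lambda>p. (\<Sum>i\<in>UNIV. q'' (axis i 1) p (axis i 1)) + f p)"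
    using hm(4) by blast
  have mq: "qm (x, t) = m (x, t)" if t: "t \<in> {0..T}" for x t
  proof -
    have "m (x, t) = heat_flow ?\<mu> (x, t) + (\<Sum>i\<in>UNIV. duhamel_grad i (\<lambda>p. n2 p $ i) (x, t))"
      using eq[OF t, of x] unfolding m_def by (simp add: system_data_def system_operator_def n2_def)
    also have "(\<Sum>i\<in>UNIV. duhamel_grad i (\<lambda>p. n2 p $ i) (x, t)) = (\<Sum>i\<in>UNIV. duhamel_heat (\<lambda>p. d2 i p (axis i 1)) (x, t))"
      by (rule sum.cong[OF refl duhamel_grad_eq_heat[OF n2c d2 d2c t]])
    also have "\<dots> = duhamel_heat f (x, t)"
      unfolding f_def using D.sum_op[of UNIV "\<lambda>i p. d2 i p (axis i 1)" t "\<lambda>_. 1" x, OF finite d2c t] by simp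
    finally show ?thesis by (simp add: qm_def)
  qed
  define DD where "DD p = (\<chi> i. q' p (axis i 1))" for p
  define DM where "DM p v = (\<chi> i. q'' (axis i 1) p v)" for p v
  define D2 where "D2 p v = (\<chi> i. d2 i p v)" for p v
  have mc: "cper {0..T} m" by (rule cper_cong[OF hm(1) mq])
  have mr: "xreg T j m" for j by (rule xreg_cong[OF hm(2) mq])
  have mx: "xderiv T m (\<lambda>p v. DD p \<bullet> v)"
  proof (rule xderiv_cong[OF q(1) mq])
    show "q' (x, t) v = DD (x, t) \<bullet> v" if "t \<in> {0..T}" for x t v
      unfolding DD_def by (rule linear_axis_sum[OF xderiv_linear[OF q(1) that]])
  qed
  have DDx: "xderiv T DD DM"
    unfolding DD_def[abs_def] DM_def[abs_def] by (rule xderiv_vec_lambda[OF q(2)])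
  have n2x: "xderiv T (\<lambda>p. N2 (fst p, snd p, m p, w p)) D2"
    using xderiv_vec_lambda[where f="\<lambda>i p. n2 p $ i" and f'=d2, OF d2]
    by (simp add: D2_def[abs_def] n2_def zmw vec_lambda_eta)
  have mt: "tderiv T m (\<lambda>p. (\<Sum>i\<in>UNIV. DM p (axis i 1) $ i) + (\<Sum>i\<in>UNIV. D2 p (axis i 1) $ i))"
    by (rule tderiv_cong[OF q(3)]) (use mq in \<open>auto simp: DM_def D2_def f_def\<close>)
  have m_init: "m (x, 0) = m0 x" for x using hm(3)[of x] mq[OF T0, of x] by simp

  \<comment> \<open>The value function, by reversing time.\<close>
  define r where "r = reverse T n1"
  have rc: "cper {0..T} r" and rr: "xreg T j r" for j
    unfolding r_def by (rule cper_reverse[OF n1c], rule xreg_reverse[OF n1r])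
  obtain r' where r': "xderiv T r r'" by (rule xreg_SucE[OF rr[of "Suc 0"]]) blast
  have r'c: "cper {0..T} (\<lambda>p. r' p v)" for v
    by (rule cper_xderiv[OF rc r' xreg_imp_continuous[OF xreg_xderiv[OF rr[of "Suc 0"] r']]])
  define U where "U p = heat_flow ?\<psi> p + duhamel_heat r p" for p
  note hU = heat_solution[OF T \<psi>c rc rr, folded U_def]
  obtain U' U'' where U: "xderiv T U U'" "\<And>v. xderiv T (\<lambda>p. U' p v) (U'' v)"
    "tderiv T U (\<lambda>p. (\<Sum>i\<in>UNIV. U'' (axis i 1) p (axis i 1)) + r p)"
    using hU(4) by blast
  have \<psi>x: "xderiv T ?\<psi> (\<lambda>p. \<Psi>' (fst p))" unfolding xderiv_def using \<Psi>(3) by simp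
  have \<psi>'c: "cper {0..T} (\<lambda>p. \<Psi>' (fst p) v)" for v
    by (rule cper_xderiv[OF \<psi>c(1) \<psi>x xreg_imp_continuous[OF xreg_xderiv[OF \<psi>c(2)[of "Suc 0"] \<psi>x]]])
  have U'eq: "U' (x, t) v = heat_flow (\<lambda>p. \<Psi>' (fst p) v) (x, t) + duhamel_heat (\<lambda>p. r' p v) (x, t)" if "t \<in> {0..T}" for x t v
  proof -
    have "xderiv T U (\<lambda>p v. heat_flow (\<lambda>p. \<Psi>' (fst p) v) p + duhamel_heat (\<lambda>p. r' p v) p)"
      unfolding U_def[abs_def]
      by (rule xderiv_add[OF H.xderiv_op[OF \<psi>c(1) \<psi>x \<psi>'c] D.xderiv_op[OF rc r' r'c]])
    from xderiv_unique[OF U(1) this that] show ?thesis by simp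
  qed
  have wU: "reverse T (\<lambda>p. U' p (axis i 1)) (x, t) = w (x, t) $ i" if t: "t \<in> {0..T}" for x t i
  proof -
    have "w (x, t) $ i = reverse T (heat_flow (\<lambda>q. \<Psi>' (fst q) (axis i 1))) (x, t) + reverse T (duhamel_grad i r) (x, t)"
      using eq[OF t, of x] unfolding w_def r_def by (simp add: system_data_def system_operator_def n1_def[abs_def])
    then show ?thesis
      using duhamel_grad_eq_heat[OF rc r' r'c rt[OF t]] U'eq[OF rt[OF t], of x "axis i 1"]
      by (simp add: reverse_def)
  qed
  define u where "u = reverse T U"
  define W where "W p v = (\<chi> i. reverse T (\<lambda>p. U'' (axis i 1) p v) p)" for p v
  have uc: "cper {0..T} u" unfolding u_def by (rule cper_reverse[OF hU(1)])
  have ur: "xreg T j u" for j unfolding u_def by (rule xreg_reverse[OF hU(2)])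
  have ux: "xderiv T u (\<lambda>p v. w p \<bullet> v)"
    unfolding u_def
  proof (rule xderiv_cong[OF xderiv_reverse[OF U(1)]])
    fix x v :: "real ^ 'n" and t assume t: "t \<in> {0..T}"
    have "reverse T (\<lambda>p. U' p v) (x, t) = U' (x, T - t) v" by (simp add: reverse_def)
    also have "\<dots> = (\<chi> i. U' (x, T - t) (axis i 1)) \<bullet> v"
      by (rule linear_axis_sum[OF xderiv_linear[OF U(1) rt[OF t]]])
    also have "(\<chi> i. U' (x, T - t) (axis i 1)) = w (x, t)"
      using wU[OF t] by (simp add: vec_eq_iff reverse_def)
    finally show "reverse T (\<lambda>p. U' p v) (x, t) = w (x, t) \<bullet> v" .
  qed simp
  have wx: "xderiv T w W"
  proof (rule xderiv_cong)
    show "xderiv T (\<lambda>p. \<chi> i. reverse T (\<lambda>p. U' p (axis i 1)) p) W"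
      unfolding W_def[abs_def] by (rule xderiv_vec_lambda[OF xderiv_reverse[OF U(2)]])
    show "(\<chi> i. reverse T (\<lambda>p. U' p (axis i 1)) (x, t)) = w (x, t)" if "t \<in> {0..T}" for x t
      using wU[OF that] by (simp add: vec_eq_iff)
  qed simp
  have ut: "tderiv T u (\<lambda>p. - (\<Sum>i\<in>UNIV. W p (axis i 1) $ i) - N1 (fst p, snd p, m p, w p))"
    unfolding u_def
    by (rule tderiv_cong[OF tderiv_reverse[OF U(3)]]) (auto simp: W_def reverse_def r_def n1_def zmw)
  have u_term: "u (x, T) = \<Psi> x" for x using hU(3)[of x] by (simp add: u_def reverse_def)

  have smooth: "u \<in> Cinf (strip T)" "m \<in> Cinf (strip T)"
    using system_bootstrap[OF Q N1 N2 zQ[unfolded zmw] ux wx mx DDx n2x ut mt ur mr] by simp_all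
  show ?thesis
    unfolding classical_solution_def m_def[symmetric] w_def[symmetric]
    by (rule exI[of _ u], intro conjI uc mc smooth allI u_term m_init, rule exI[of _ W], rule exI[of _ DD],
        rule exI[of _ DM], rule exI[of _ D2]) (intro conjI ux wx mx DDx n2x ut mt)
qed

lemma system_data_cper_xreg:
  assumes T: "0 \<le> T" and m0: "m0 \<in> Cinf UNIV" "torus_periodic m0"
    and \<Psi>': "\<And>v. (\<lambda>x. \<Psi>' x v) \<in> Cinf UNIV" "\<And>v. torus_periodic (\<lambda>x. \<Psi>' x v)"
  shows "cper {0..T} (system_data T m0 \<Psi>')" "xreg T j (system_data T m0 \<Psi>')"
proof -
  interpret H: invariant_operator T 1 "heat_flow :: ((real ^ 'a) \<times> real \<Rightarrow> real) \<Rightarrow> _"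
    by (rule heat_flow_operator[OF T])
  note \<mu> = time_independent_cper_xreg[OF m0, of T] and \<psi> = time_independent_cper_xreg[OF \<Psi>', of T]
  show "cper {0..T} (system_data T m0 \<Psi>')"
    unfolding system_data_def[abs_def]
    by (intro cper_Pair cper_vec_lambda cper_reverse H.cper_op \<mu>(1) \<psi>(1))
  have "xreg T j (reverse T (heat_flow (\<lambda>q. \<Psi>' (fst q) (axis i 1))))" for i
    by (intro xreg_reverse H.xreg_op \<psi>)
  moreover have "xreg T j (heat_flow (\<lambda>q. m0 (fst q)))" by (intro H.xreg_op \<mu>)
  ultimately show "xreg T j (system_data T m0 \<Psi>')"
    unfolding xreg_def system_data_def[abs_def]
    by (auto simp: Basis_prod_def zero_prod_def Basis_vec_def inner_axis)
qed

lemma small_time: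
  fixes \<kappa> :: "real \<Rightarrow> real"
  assumes "0 < Tb" "0 < \<eta>" "0 \<le> c"
  obtains T0 where "0 < T0" "T0 \<le> Tb" "\<And>T. 0 < T \<Longrightarrow> T \<le> T0 \<Longrightarrow> c * sqrt (2 * T) \<le> \<eta>"
proof -
  define T0 where "T0 = min Tb ((\<eta> / (c + 1))\<^sup>2 / 2)"
  have "c * sqrt (2 * T) \<le> \<eta>" if T: "0 < T" "T \<le> T0" for T
  proof -
    have "2 * T \<le> (\<eta> / (c + 1))\<^sup>2" using T by (simp add: T0_def)
    then have "sqrt (2 * T) \<le> \<eta> / (c + 1)" using assms by (intro real_le_lsqrt) auto
    then have "c * sqrt (2 * T) \<le> (c + 1) * (\<eta> / (c + 1))" using assms T by (intro mult_mono) auto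
    then show ?thesis using assms by simp
  qed
  moreover have "0 < T0" "T0 \<le> Tb" using assms by (auto simp: T0_def)
  ultimately show ?thesis using that by blast
qed

text \<open>
  Only the values of the nonlinearities near those of the data matter: on a compact convex
  neighbourhood \<open>K\<close> of these values they are bounded and Lipschitz, so that the fixed-point map is
  a contraction of a ball into itself once \<open>sqrt T\<close> is small. The time \<open>T0\<close> does not depend on
  how many derivatives of the solution are considered.
\<close>

lemma short_time_system:
  fixes N1 :: "(real ^ 'n) \<times> real \<times> real \<times> (real ^ 'n) \<Rightarrow> real"
    and N2 :: "(real ^ 'n) \<times> real \<times> real \<times> (real ^ 'n) \<Rightarrow> real ^ 'n"
  assumes Tb: "0 < Tb" and N1: "N1 \<in> Cinf (UNIV \<times> {0..Tb} \<times> {0<..} \<times> UNIV)"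
    and N2: "\<And>i. (\<lambda>q. N2 q $ i) \<in> Cinf (UNIV \<times> {0..Tb} \<times> {0<..} \<times> UNIV)"
    and per: "\<And>c. c \<in> {0..Tb} \<times> {0<..} \<times> UNIV \<Longrightarrow> torus_periodic (\<lambda>x. N1 (x, c))"
      "\<And>c. c \<in> {0..Tb} \<times> {0<..} \<times> UNIV \<Longrightarrow> torus_periodic (\<lambda>x. N2 (x, c))"
    and m0: "m0 \<in> Cinf UNIV" "torus_periodic m0"
    and k0: "0 < k0" "\<And>x. k0 \<le> m0 x"
    and \<Psi>: "\<Psi> \<in> Cinf UNIV" "torus_periodic \<Psi>"
  shows "\<exists>T0>0. T0 \<le> Tb \<and> (\<forall>T. 0 < T \<and> T \<le> T0 \<longrightarrow>
    (\<exists>u m w. classical_solution T N1 N2 \<Psi> m0 u m w \<and> (\<forall>x. \<forall>t\<in>{0..T}. 0 < m (x, t))))"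
proof -
  let ?C0 = "{0..Tb} \<times> {0::real<..} \<times> (UNIV :: (real ^ 'n) set)"
  let ?Q = "(UNIV :: (real ^ 'n) set) \<times> ?C0"
  have thQ: "thick UNIV ?Q" by (rule thick_Times_Icc[OF Tb]) (auto intro!: open_Times)
  have thU: "thick UNIV ((UNIV :: (real ^ 'n) set))" by (rule thick_open) simp
  define N where "N q = (N1 q, N2 q)" for q
  have Nb: "(\<lambda>q. N q \<bullet> b) \<in> Cinf ?Q" if "b \<in> Basis" for b
    using that N1 N2 by (auto simp: N_def Basis_prod_def zero_prod_def Basis_vec_def inner_axis)
  obtain N' where N': "deriv_along UNIV ?Q N N'" "\<And>v b. b \<in> Basis \<Longrightarrow> (\<lambda>q. N' q v \<bullet> b) \<in> Cinf ?Q"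
    and Nc: "cper ?C0 N" and N'c: "\<And>v. cper ?C0 (\<lambda>q. N' q v)"
  proof (rule Cinf_periodic_derivative[OF Nb thQ])
    show "torus_periodic (\<lambda>x. N (x, c))" if "c \<in> ?C0" for c
      using per[OF that] by (simp add: N_def torus_periodic_def)
  qed (assumption | rule that)+
  obtain \<Psi>' where "deriv_along UNIV UNIV \<Psi> \<Psi>'" and \<Psi>'s: "\<And>v. (\<lambda>x. \<Psi>' x v) \<in> Cinf UNIV"
  proof (rule smooth_class_derivative[OF thU falg_cont_class UNIV_I \<Psi>(1)]) qed (rule that, assumption, simp)
  then have \<Psi>'d: "(\<Psi> has_derivative \<Psi>' x) (at x)" for x by (simp add: deriv_along_UNIV)
  have \<Psi>'p: "torus_periodic (\<lambda>x. \<Psi>' x v)" for v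
    unfolding torus_periodic_def
  proof (intro allI impI)
    fix x k :: "real ^ 'n" assume k: "\<forall>i. k $ i \<in> \<int>"
    have "((\<lambda>y. y + k) has_derivative (\<lambda>v. v)) (at x)" by (auto intro!: derivative_eq_intros)
    from has_derivative_compose[OF this \<Psi>'d[of "x + k"]]
    have "(\<Psi> has_derivative \<Psi>' (x + k)) (at x)" using \<Psi>(2) k by (simp add: torus_periodic_def)
    from has_derivative_unique[OF this \<Psi>'d] show "\<Psi>' (x + k) v = \<Psi>' x v" by simp
  qed
  \<comment> \<open>The values of the data, uniformly in the terminal time.\<close>
  note \<mu> = time_independent_cper_xreg[OF m0, of Tb] and \<psi> = time_independent_cper_xreg[OF \<Psi>'s \<Psi>'p, of Tb]
  obtain M0 where M0': "M0 \<ge> 0" "\<And>x c. c \<in> {0..Tb} \<Longrightarrow> norm (m0 (fst (x :: real ^ 'n, c :: real))) \<le> M0"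
    using cper_bounded[OF compact_Icc \<mu>(1)] by blast
  have M0: "M0 \<ge> 0" "\<bar>m0 x\<bar> \<le> M0" for x using M0'(1) M0'(2)[of 0 x] Tb by auto
  have "\<exists>R. R \<ge> 0 \<and> (\<forall>x. \<bar>\<Psi>' x (axis i 1)\<bar> \<le> R)" for i
  proof -
    obtain R where "R \<ge> 0" "\<And>x c. c \<in> {0..Tb} \<Longrightarrow> norm (\<Psi>' (fst (x :: real ^ 'n, c :: real)) (axis i 1)) \<le> R"
      using cper_bounded[OF compact_Icc \<psi>(1)[of "axis i 1"]] by blast
    then show ?thesis using Tb by (intro exI[of _ R]) force
  qed
  then obtain R where R: "\<And>i. R i \<ge> 0" "\<And>i x. \<bar>\<Psi>' x (axis i 1)\<bar> \<le> R i" by metis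
  define R0 where "R0 = (\<Sum>i\<in>UNIV. R i)"
  define r where "r = min (k0 / 2) 1"
  have r: "0 < r" "r \<le> k0 / 2" "r \<le> 1" using k0 by (auto simp: r_def)
  define K where "K = {k0 / 2..M0 + 1} \<times> cball (0 :: real ^ 'n) (R0 + 1)"
  have K: "compact K" "convex K" unfolding K_def by (intro compact_Times convex_Times compact_Icc compact_cball convex_cball; simp)+
  have KC: "{0..Tb} \<times> K \<subseteq> ?C0" using k0 by (auto simp: K_def)
  note NcK = cper_subset[OF Nc KC] and N'cK = cper_subset[OF N'c KC]
  have cK: "compact ({0..Tb} \<times> K)" by (intro compact_Times compact_Icc K)
  obtain M where M: "M \<ge> 0" "\<And>x t e. t \<in> {0..Tb} \<Longrightarrow> e \<in> K \<Longrightarrow> norm (N (x, t, e)) \<le> M"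
    using cper_bounded[OF cK NcK] by (metis mem_Sigma_iff)
  have "\<exists>l. l \<ge> 0 \<and> (\<forall>x. \<forall>t\<in>{0..Tb}. \<forall>e\<in>K. norm (N' (x, t, e) v) \<le> l)" for v
    using cper_bounded[OF cK N'cK[of v]] by (metis mem_Sigma_iff)
  then obtain l where l: "\<And>v. l v \<ge> 0" "\<And>v x t e. t \<in> {0..Tb} \<Longrightarrow> e \<in> K \<Longrightarrow> norm (N' (x, t, e) v) \<le> l v" by metis
  define L where "L = (\<Sum>b\<in>(Basis :: (real \<times> (real ^ 'n)) set). l (0, 0, b))"
  have L0: "0 \<le> L" unfolding L_def by (intro sum_nonneg l)
  have Nd: "(N has_derivative N' q) (at q within UNIV \<times> {0..Tb} \<times> K)" if "q \<in> UNIV \<times> {0..Tb} \<times> K" for q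
    by (rule has_derivative_subset[where s="?Q"]) (use N'(1) KC that in \<open>auto simp: deriv_along_UNIV\<close>)
  have lin: "linear (N' (x, t, e))" if "t \<in> {0..Tb}" "e \<in> K" for x t e
    using has_derivative_linear[OF Nd, of "(x, t, e)"] that by simp
  have LB: "norm (N' (x, t, e) (0, 0, \<zeta>)) \<le> L * norm \<zeta>" if te: "t \<in> {0..Tb}" "e \<in> K" for x t e \<zeta>
  proof -
    have lz: "linear (\<lambda>\<zeta>. N' (x, t, e) (0, 0, \<zeta>))"
      using linear_compose[OF _ lin[OF te], of "\<lambda>v. (0, 0, v)" x] by (auto simp: comp_def linear_iff)
    have "(\<Sum>b\<in>Basis. norm (N' (x, t, e) (0, 0, b))) \<le> L"
      unfolding L_def by (intro sum_mono l te)
    from order_trans[OF norm_linear_le_sum_Basis[OF lz] mult_right_mono[OF this norm_ge_zero]] show ?thesis .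
  qed
  have Lip: "norm (N (x, t, e) - N (x, t, e')) \<le> L * norm (e - e')" if t: "t \<in> {0..Tb}" and e: "e \<in> K" "e' \<in> K" for x t e e'
  proof (rule differentiable_bound[OF K(2) _ _ e])
    fix a assume a: "a \<in> K"
    have "((\<lambda>a. (x, t, a)) has_derivative (\<lambda>\<zeta>. (0, 0, \<zeta>))) (at a within K)"
      by (auto intro!: derivative_eq_intros)
    moreover have "(N has_derivative N' (x, t, a)) (at (x, t, a) within (\<lambda>a. (x, t, a)) ` K)"
      by (rule has_derivative_subset[OF Nd]) (use a t in auto)
    ultimately show "((\<lambda>a. N (x, t, a)) has_derivative (\<lambda>\<zeta>. N' (x, t, a) (0, 0, \<zeta>))) (at a within K)"
      by (rule has_derivative_in_compose)
    show "onorm (\<lambda>\<zeta>. N' (x, t, a) (0, 0, \<zeta>)) \<le> L"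
      by (rule onorm_le) (rule LB[OF t a])
  qed
  define \<eta> where "\<eta> = min (r / (M + 1)) (1 / (2 * (L + 1)))"
  have \<eta>: "0 < \<eta>" "\<eta> * M \<le> r" "\<eta> * L \<le> 1 / 2"
  proof -
    show "0 < \<eta>" using r M(1) L0 by (simp add: \<eta>_def)
    have "\<eta> * M \<le> r / (M + 1) * (M + 1)" using M(1) r \<open>0 < \<eta>\<close> by (intro mult_mono) (auto simp: \<eta>_def)
    then show "\<eta> * M \<le> r" using M(1) by simp
    have "\<eta> * L \<le> 1 / (2 * (L + 1)) * (L + 1)" using L0 \<open>0 < \<eta>\<close> by (intro mult_mono) (auto simp: \<eta>_def)
    also have "\<dots> = 1 / 2" using L0 by (simp add: field_simps)
    finally show "\<eta> * L \<le> 1 / 2" .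
  qed
  obtain T0 where T0: "0 < T0" "T0 \<le> Tb" "\<And>T. 0 < T \<Longrightarrow> T \<le> T0 \<Longrightarrow> 2 * real CARD('n) * sqrt (2 * T) \<le> \<eta>"
    using small_time[OF Tb \<eta>(1), of "2 * real CARD('n)"] by auto
  have sol: "\<exists>u m w. classical_solution T N1 N2 \<Psi> m0 u m w \<and> (\<forall>x. \<forall>t\<in>{0..T}. 0 < m (x, t))"
    if T: "0 < T" "T \<le> T0" for T
  proof -
    have T': "0 \<le> T" and sub: "{0..T} \<subseteq> {0..Tb}" using T T0 by auto
    let ?\<kappa> = "2 * real CARD('n) * sqrt (2 * T)"
    interpret S: invariant_operator T ?\<kappa> "system_operator T :: ((real ^ 'n) \<times> real \<Rightarrow> real \<times> (real ^ 'n)) \<Rightarrow> _"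
      by (rule system_operator_invariant[OF T'])
    interpret H: invariant_operator T 1 "heat_flow :: ((real ^ 'n) \<times> real \<Rightarrow> real) \<Rightarrow> _"
      by (rule heat_flow_operator[OF T'])
    have \<kappa>: "?\<kappa> * M \<le> r" "?\<kappa> * L \<le> 1 / 2"
      using mult_right_mono[OF T0(3)[OF T] M(1)] mult_right_mono[OF T0(3)[OF T] L0] \<eta> by auto
    let ?g = "system_data T m0 \<Psi>'"
    note g = system_data_cper_xreg[OF T' m0 \<Psi>'s \<Psi>'p]
    note \<mu>T = time_independent_cper_xreg[OF m0, of T] and \<psi>T = time_independent_cper_xreg[OF \<Psi>'s \<Psi>'p, of T]
    have gm: "k0 \<le> fst (?g (x, t))" "fst (?g (x, t)) \<le> M0" and gw: "norm (snd (?g (x, t))) \<le> R0" if t: "t \<in> {0..T}" for x t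
    proof -
      show "k0 \<le> fst (?g (x, t))"
        unfolding system_data_def fst_conv by (rule heat_flow_lower_bound[OF T' \<mu>T(1)]) (simp add: k0(2))
      have "norm (heat_flow (\<lambda>q. m0 (fst q)) (x, t)) \<le> 1 * M0"
        by (rule H.bound_op[OF \<mu>T(1) _ t]) (use M0 in simp)
      then show "fst (?g (x, t)) \<le> M0" by (simp add: system_data_def)
      have "\<bar>snd (?g (x, t)) $ i\<bar> \<le> R i" for i
      proof -
        have "norm (heat_flow (\<lambda>q. \<Psi>' (fst q) (axis i 1)) (x, T - t)) \<le> 1 * R i"
          by (rule H.bound_op[OF \<psi>T(1)]) (use R t in auto)
        then show ?thesis by (simp add: system_data_def reverse_def)
      qed
      then show "norm (snd (?g (x, t))) \<le> R0"
        unfolding R0_def by (intro order_trans[OF norm_vec_le_sum] sum_mono)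
    qed
    have ballK: "e \<in> K" if t: "t \<in> {0..T}" and e: "norm (e - ?g (x, t)) \<le> r" for x t e
    proof -
      let ?d = "e - ?g (x, t)"
      have "norm (fst ?d) \<le> r"
        using norm_fst_le[of "fst ?d" "snd ?d", unfolded prod.collapse] e by linarith
      then have "\<bar>fst e - fst (?g (x, t))\<bar> \<le> r" by simp
      moreover have "norm (snd ?d) \<le> r"
        using norm_snd_le[of "snd ?d" "fst ?d", unfolded prod.collapse] e by linarith
      then have "norm (snd e - snd (?g (x, t))) \<le> r" by simp
      ultimately have "k0 / 2 \<le> fst e" "fst e \<le> M0 + 1" "norm (snd e) \<le> R0 + 1"
        using gm[OF t, of x] gw[OF t, of x] r norm_triangle_sub[of "snd e" "snd (?g (x, t))"] by auto
      then show ?thesis by (cases e) (simp add: K_def)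
    qed
    have subK: "{0..T} \<times> K \<subseteq> {0..Tb} \<times> K" using sub by auto
    note NcT = cper_subset[OF NcK subK] and N'cT = cper_subset[OF N'cK subK]
    have r0: "0 \<le> r" using r by simp
    obtain z where z: "cper {0..T} z" "\<And>x t. t \<in> {0..T} \<Longrightarrow> z (x, t) \<in> K"
      "\<And>x t. t \<in> {0..T} \<Longrightarrow> z (x, t) = ?g (x, t) + system_operator T (\<lambda>p. N (fst p, snd p, z p)) (x, t)"
    proof (rule S.nonlinear_fixed_point[OF g(1) r0 ballK NcT _ _ \<kappa> L0])
      show "norm (N (x, t, e)) \<le> M" if "t \<in> {0..T}" "e \<in> K" for x t e
        using M(2)[of t e x] that sub by auto
      show "norm (N (x, t, e) - N (x, t, e')) \<le> L * norm (e - e')" if "t \<in> {0..T}" "e \<in> K" "e' \<in> K" for x t e e'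
        using Lip[of t e e' x] that sub by auto
    qed (assumption | rule that)+
    have QK: "UNIV \<times> {0..T} \<times> K \<subseteq> ?Q" using KC subK by auto
    have zr: "xreg T j z" for j
    proof (rule S.xreg_nonlinear_fixed_point[OF z(1,2) K g z(3) thQ QK NcT N'(1,2) N'cT _ L0])
      show "norm (N' (x, t, e) (0, 0, \<zeta>)) \<le> L * norm \<zeta>" if "t \<in> {0..T}" "e \<in> K" for x t e \<zeta>
        using LB[of t e x \<zeta>] that sub by auto
      show "?\<kappa> * L < 1" using \<kappa>(2) by simp
    qed
    have zQ: "(x, t, z (x, t)) \<in> ?Q" if "t \<in> {0..T}" for x t
      by (rule subsetD[OF QK]) (use z(2)[OF that] that in auto)
    have cN: "cper {0..T} (\<lambda>p. N (fst p, snd p, z p))" by (rule cper_graph[OF NcT z(1,2)])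
    have cn: "cper {0..T} (\<lambda>p. N1 (fst p, snd p, z p))" "cper {0..T} (\<lambda>p. N2 (fst p, snd p, z p))"
      using cper_fst_snd[OF cN] by (simp_all add: N_def)
    have zpos: "0 < fst (z (x, t))" if "t \<in> {0..T}" for x t
      using z(2)[OF that, of x] k0 by (cases "z (x, t)") (auto simp: K_def)
    have "\<exists>u. classical_solution T N1 N2 \<Psi> m0 u (\<lambda>p. fst (z p)) (\<lambda>p. snd (z p))"
      by (rule system_of_fixed_point[OF T' thQ N1 N2 m0 \<Psi> \<Psi>'d z(1) zr zQ cn z(3)[unfolded N_def]])
    then obtain u where "classical_solution T N1 N2 \<Psi> m0 u (\<lambda>p. fst (z p)) (\<lambda>p. snd (z p))" ..
    with zpos show ?thesis
      by (intro exI[of _ u] exI[of _ "\<lambda>p. fst (z p)"] exI[of _ "\<lambda>p. snd (z p)"] conjI allI ballI)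
  qed
  show ?thesis
    by (rule exI[of _ T0], intro conjI allI impI T0(1,2), rule sol, simp_all)
qed

section \<open>The mean field game system\<close>

text \<open>
  The monomials \<open>c * s powr a\<close> form a family closed under differentiation.
\<close>

lemma Cinf_powr: "(\<lambda>s. s powr a) \<in> Cinf {0<..}"
proof -
  define monomial where "monomial p = (\<lambda>s::real. fst p * s powr snd p)" for p :: "real \<times> real"
  have der: "deriv_along UNIV {0<..} (monomial (c, a)) (\<lambda>s v. monomial (c * a * v, a - 1) s)" for c a
    unfolding deriv_along_UNIV
  proof
    fix s :: real assume s: "s \<in> {0<..}"
    have "((\<lambda>s. c * s powr a) has_real_derivative c * (a * s powr (a - 1))) (at s)"
      by (rule DERIV_cmult[OF has_real_derivative_powr]) (use s in simp)
    then have "((\<lambda>s. c * s powr a) has_derivative (\<lambda>v. c * (a * s powr (a - 1)) * v)) (at s within {0<..})"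
      unfolding has_field_derivative_def by (rule has_derivative_at_withinI)
    moreover have "(\<lambda>v. c * (a * s powr (a - 1)) * v) = (\<lambda>v. monomial (c * a * v, a - 1) s)"
      by (simp add: monomial_def fun_eq_iff)
    ultimately show "(monomial (c, a) has_derivative (\<lambda>v. monomial (c * a * v, a - 1) s)) (at s within {0<..})"
      by (simp add: monomial_def)
  qed
  have "monomial p \<in> Cinf {0<..}" for p
  proof (rule smooth_class_coinduct[where F="range monomial"])
    have "continuous_on {0<..} (monomial p)" for p
      unfolding monomial_def by (rule continuous_on_mult_left, rule continuous_on_powr) (auto intro: continuous_intros)
    then show "range monomial \<subseteq> cont_class {0<..}" by (auto simp: cont_class_def)
    fix g assume "g \<in> range monomial"
    then obtain c a where g: "g = monomial (c, a)" by force
    show "\<exists>g'. deriv_along UNIV {0<..} g g' \<and> (\<forall>v\<in>UNIV. (\<lambda>s. g' s v) \<in> range monomial)"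
      unfolding g by (rule exI[of _ "\<lambda>s v. monomial (c * a * v, a - 1) s"], rule conjI[OF der], rule ballI, rule rangeI)
  qed (rule rangeI)
  from this[of "(1, a)"] show ?thesis by (simp add: monomial_def)
qed

lemma grad_eqI:
  assumes "(f has_derivative (\<lambda>v. D \<bullet> v)) (at x)" shows "grad f x = D"
  unfolding grad_def
proof (rule the_equality)
  show "GDERIV f x :> D" using assms by (simp add: gderiv_def inner_commute)
  fix D' assume "GDERIV f x :> D'"
  then have "(f has_derivative (\<lambda>v. D' \<bullet> v)) (at x)" by (simp add: gderiv_def inner_commute)
  from fun_cong[OF has_derivative_unique[OF this assms]] have "\<forall>v. D' \<bullet> v = D \<bullet> v" by simp
  then show "D' = D" by (simp only: vector_eq_rdot)
qed

lemma divergence_eqI: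
  assumes "(F has_derivative F') (at x)" shows "divergence F x = (\<Sum>i\<in>UNIV. F' (axis i 1) $ i)"
proof -
  have "frechet_derivative F (at x) = F'" using frechet_derivative_at[OF assms] by simp
  then show ?thesis by (simp add: divergence_def jacobian_def trace_def matrix_def)
qed

lemma grad_partial:
  fixes h :: "(real ^ 'n) \<times> (real ^ 'n) \<Rightarrow> real"
  assumes "deriv_along UNIV UNIV h h'"
  shows "grad (\<lambda>p. h (x, p)) p = (\<chi> i. h' (x, p) (0, axis i 1))"
proof (rule grad_eqI)
  have h: "(h has_derivative h' (x, p)) (at (x, p))" using assms by (simp add: deriv_along_UNIV)
  have "((\<lambda>p. (x, p)) has_derivative (\<lambda>v. (0, v))) (at p)" by (auto intro!: derivative_eq_intros)
  from has_derivative_compose[OF this h]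
  have d: "((\<lambda>p. h (x, p)) has_derivative (\<lambda>v. h' (x, p) (0, v))) (at p)" .
  from linear_axis_sum[OF has_derivative_linear[OF d]]
  have "(\<lambda>v. h' (x, p) (0, v)) = (\<lambda>v. (\<chi> i. h' (x, p) (0, axis i 1)) \<bullet> v)" by (rule ext)
  with d show "((\<lambda>p. h (x, p)) has_derivative (\<lambda>v. (\<chi> i. h' (x, p) (0, axis i 1)) \<bullet> v)) (at p)" by simp
qed

text \<open>
  The domain of the nonlinearities as functions of \<open>(x, t, m, w)\<close>: for \<open>m > 0\<close> the congestion factor
  \<open>m powr \<alpha>\<close> and its reciprocal are smooth.
\<close>

abbreviation state_domain :: "real \<Rightarrow> ((real ^ 'n) \<times> real \<times> real \<times> (real ^ 'n)) set" where
  "state_domain Tb \<equiv> UNIV \<times> {0..Tb} \<times> {0<..} \<times> UNIV"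

lemma Cinf_coordinates:
  fixes S :: "((real ^ 'n) \<times> real \<times> real \<times> (real ^ 'n)) set"
  shows "(\<lambda>q. fst q \<bullet> c) \<in> Cinf S" "(\<lambda>q. fst (snd q)) \<in> Cinf S" "(\<lambda>q. fst (snd (snd q))) \<in> Cinf S"
    "(\<lambda>q. snd (snd (snd q)) \<bullet> c) \<in> Cinf S"
proof -
  have s: "bounded_linear (\<lambda>q::(real ^ 'n) \<times> real \<times> real \<times> (real ^ 'n). snd (snd q))"
    by (rule bounded_linear_compose[OF bounded_linear_snd bounded_linear_snd])
  show "(\<lambda>q. fst q \<bullet> c) \<in> Cinf S"
    by (rule Cinf_bounded_linear, rule bounded_linear_compose[OF bounded_linear_inner_left bounded_linear_fst])
  show "(\<lambda>q. fst (snd q)) \<in> Cinf S"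
    by (rule Cinf_bounded_linear, rule bounded_linear_compose[OF bounded_linear_fst bounded_linear_snd])
  show "(\<lambda>q. fst (snd (snd q))) \<in> Cinf S"
    by (rule Cinf_bounded_linear, rule bounded_linear_compose[OF bounded_linear_fst s])
  show "(\<lambda>q. snd (snd (snd q)) \<bullet> c) \<in> Cinf S"
    by (rule Cinf_bounded_linear, rule bounded_linear_compose[OF bounded_linear_inner_left
          bounded_linear_compose[OF bounded_linear_snd s]])
qed

lemma Cinf_state_compose:
  fixes F :: "(real ^ 'n) \<times> 'c::euclidean_space \<Rightarrow> real"
    and G :: "(real ^ 'n) \<times> real \<times> real \<times> (real ^ 'n) \<Rightarrow> 'c"
  assumes F: "F \<in> Cinf (UNIV \<times> C)" and th: "thick UNIV ((UNIV :: (real ^ 'n) set) \<times> C)"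
    and G: "\<And>q. q \<in> S \<Longrightarrow> G q \<in> C" "\<And>b. b \<in> Basis \<Longrightarrow> (\<lambda>q. G q \<bullet> b) \<in> Cinf S"
  shows "(\<lambda>q. F (fst q, G q)) \<in> Cinf S"
proof (rule comp_closedD[OF comp_closed_Cinf[OF th] F])
  show "(fst q, G q) \<in> UNIV \<times> C" if "q \<in> S" for q using G(1)[OF that] by simp
  fix b :: "(real ^ 'n) \<times> 'c" assume "b \<in> Basis"
  then consider i where "b = (i, 0)" | i where "b = (0, i)" "i \<in> Basis"
    by (auto simp: Basis_prod_def)
  then show "(\<lambda>q. (fst q, G q) \<bullet> b) \<in> Cinf S"
  proof cases
    case 1
    then show ?thesis using Cinf_coordinates(1)[of i S] by simp
  next
    case 2
    then show ?thesis using G(2)[of i] by simp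
  qed
qed

text \<open>
  Here \<open>h\<close>, \<open>B\<close> and \<open>W\<close> are the Hamiltonian, the drift and the coupling as functions of one pair, and \<open>v\<close>
  is the direction of a partial derivative of \<open>h\<close> in the momentum.
\<close>

lemma mfg_nonlinearities_smooth:
  fixes h :: "(real ^ 'n) \<times> (real ^ 'n) \<Rightarrow> real" and B :: "(real ^ 'n) \<times> real \<Rightarrow> real ^ 'n"
    and W :: "(real ^ 'n) \<times> real \<Rightarrow> real"
  assumes Tb: "0 < Tb" and h: "h \<in> Cinf UNIV" "deriv_along UNIV UNIV h h'"
    and B: "\<And>c. (\<lambda>p. B p \<bullet> c) \<in> Cinf (strip Tb)" and W: "W \<in> Cinf UNIV"
  shows "(\<lambda>(x, t, m, w). W (x, m) - m powr \<alpha> * h (x, w /\<^sub>R (m powr \<alpha>)) - B (x, t) \<bullet> w) \<in> Cinf (state_domain Tb)"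
    "(\<lambda>(x, t, m, w). m * h' (x, w /\<^sub>R (m powr \<alpha>)) v + m * B (x, t) $ i) \<in> Cinf (state_domain Tb)"
proof -
  let ?S = "state_domain Tb :: ((real ^ 'n) \<times> real \<times> real \<times> (real ^ 'n)) set"
  let ?m = "\<lambda>q::(real ^ 'n) \<times> real \<times> real \<times> (real ^ 'n). fst (snd (snd q))"
  let ?w = "\<lambda>q::(real ^ 'n) \<times> real \<times> real \<times> (real ^ 'n). snd (snd (snd q))"
  have thU: "thick UNIV ((UNIV :: (real ^ 'n) set) \<times> (UNIV :: 'c::real_normed_vector set))"
    by (rule thick_open) (simp add: open_Times)
  have h': "(\<lambda>p. h' p v) \<in> Cinf UNIV" for v
    by (rule smooth_class_has_deriv[OF thick_open[OF open_UNIV] falg_cont_class UNIV_I h UNIV_I])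
  have pow: "(\<lambda>q. ?m q powr a) \<in> Cinf ?S" for a
  proof (rule comp_closedD[OF comp_closed_Cinf[OF thick_open[OF open_greaterThan]] Cinf_powr])
    show "?m q \<in> {0<..}" if "q \<in> ?S" for q using that by auto
    show "(\<lambda>q. ?m q \<bullet> c) \<in> Cinf ?S" if "c \<in> Basis" for c
      using that Cinf_coordinates(3)[of ?S] by simp
  qed
  have p: "(\<lambda>q. (?w q /\<^sub>R (?m q powr \<alpha>)) \<bullet> b) \<in> Cinf ?S" for b
    using falg_mult[OF falg_Cinf pow[of "- \<alpha>"] Cinf_coordinates(4)[of b ?S]] by (simp add: powr_minus)
  have hq: "(\<lambda>q. h (fst q, ?w q /\<^sub>R (?m q powr \<alpha>))) \<in> Cinf ?S"
    by (rule Cinf_state_compose[OF _ thU _ p]) (simp_all only: UNIV_Times_UNIV h(1) UNIV_I)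
  have h'q: "(\<lambda>q. h' (fst q, ?w q /\<^sub>R (?m q powr \<alpha>)) v) \<in> Cinf ?S" for v
    by (rule Cinf_state_compose[where F="\<lambda>p. h' p v", OF _ thU _ p]) (simp_all only: UNIV_Times_UNIV h' UNIV_I)
  have Wq: "(\<lambda>q. W (fst q, ?m q)) \<in> Cinf ?S"
  proof (rule Cinf_state_compose[OF _ thU])
    show "W \<in> Cinf (UNIV \<times> UNIV)" by (simp only: UNIV_Times_UNIV W)
    show "(\<lambda>q. ?m q \<bullet> c) \<in> Cinf ?S" if "c \<in> Basis" for c
      using that Cinf_coordinates(3)[of ?S] by simp
  qed simp
  have Bq: "(\<lambda>q. B (fst q, fst (snd q)) \<bullet> c) \<in> Cinf ?S" for c
  proof (rule Cinf_state_compose[where F="\<lambda>p. B p \<bullet> c", OF B thick_strip[OF Tb]])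
    show "fst (snd q) \<in> {0..Tb}" if "q \<in> ?S" for q using that by auto
    show "(\<lambda>q. fst (snd q) \<bullet> c) \<in> Cinf ?S" if "c \<in> Basis" for c
      using that Cinf_coordinates(2)[of ?S] by simp
  qed
  have Bw: "(\<lambda>q. B (fst q, fst (snd q)) \<bullet> ?w q) \<in> Cinf ?S"
    by (subst euclidean_inner)
      (intro falg_sum[OF falg_Cinf] falg_mult[OF falg_Cinf] Bq Cinf_coordinates finite_Basis)
  show "(\<lambda>(x, t, m, w). W (x, m) - m powr \<alpha> * h (x, w /\<^sub>R (m powr \<alpha>)) - B (x, t) \<bullet> w) \<in> Cinf ?S"
    unfolding case_prod_unfold
    by (rule falg_diff[OF falg_Cinf falg_diff[OF falg_Cinf Wq falg_mult[OF falg_Cinf pow hq]] Bw])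
  have "(\<lambda>q. B (fst q, fst (snd q)) $ i) \<in> Cinf ?S" using Bq[of "axis i 1"] by (simp add: inner_axis)
  from falg_add[OF falg_Cinf falg_mult[OF falg_Cinf Cinf_coordinates(3) h'q[of v]] falg_mult[OF falg_Cinf Cinf_coordinates(3) this]]
  show "(\<lambda>(x, t, m, w). m * h' (x, w /\<^sub>R (m powr \<alpha>)) v + m * B (x, t) $ i) \<in> Cinf ?S"
    unfolding case_prod_unfold .
qed

theorem theorem1:
  fixes L0 H0 :: "real ^ 'n \<Rightarrow> real ^ 'n \<Rightarrow> real"
    and b :: "real ^ 'n \<Rightarrow> real \<Rightarrow> real ^ 'n"
    and V :: "real ^ 'n \<Rightarrow> real \<Rightarrow> real"
    and \<Psi> m0 :: "real ^ 'n \<Rightarrow> real"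
    and \<alpha> \<gamma> \<gamma>' Tb :: real
  assumes Tb: "Tb > 0"
    and H0_def: "H0 = legendre L0"
    and \<Psi>_torus: "torus_periodic \<Psi>"
    and \<Psi>_smooth: "smooth_on UNIV \<Psi>" "bounded_derivs_on UNIV \<Psi>"
    and b_torus: "\<forall>t\<in>{0..Tb}. torus_periodic (\<lambda>x. b x t)"
    and b_smooth: "smooth_on (UNIV \<times> {0..Tb}) (\<lambda>(x, t). b x t)"
      "bounded_derivs_on (UNIV \<times> {0..Tb}) (\<lambda>(x, t). b x t)"
    and V_torus: "torus_periodic V"
    and V_smooth: "smooth_on UNIV (\<lambda>(x, z). V x z)" "bounded_derivs_on UNIV (\<lambda>(x, z). V x z)"
    and m0_torus: "torus_periodic m0"
    and m0_smooth: "smooth_on UNIV m0"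
    and m0_mass: "integral (cbox 0 1) m0 = 1"
    and m0_pos: "\<exists>k0>0. \<forall>x. m0 x \<ge> k0"
    and L0_torus: "torus_periodic L0"
    and L0_smooth: "smooth_on UNIV (\<lambda>(x, v). L0 x v)"
    and L0_convex: "\<forall>x. strictly_convex (L0 x)"
    and L0_nonneg: "\<forall>x v. L0 x v \<ge> 0"
    and conjugate: "\<gamma> > 1" "\<gamma>' > 1" "1 / \<gamma> + 1 / \<gamma>' = 1"
    and L0_growth: "\<exists>C1>0. \<exists>c1>0. \<exists>C2>0. \<exists>c2>0. \<forall>x v.
      C1 * (norm v powr \<gamma>' / \<gamma>') - c1 \<le> L0 x v \<and> L0 x v \<le> C2 * (norm v powr \<gamma>' / \<gamma>') + c2"
    and H0_coercive: "\<exists>c>0. \<exists>C>0. \<forall>x p.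
      p \<bullet> grad (H0 x) p - H0 x p \<ge> c * norm p powr \<gamma> - C"
    and H0_growth: "\<exists>C. \<forall>x p. norm (grad (H0 x) p) \<le> C * norm p powr (\<gamma> - 1) + C"
    and \<alpha>: "0 \<le> \<alpha>" "CARD('n) > 2 \<Longrightarrow> \<alpha> < 2 / (real CARD('n) - 2)"
    and \<gamma>: "\<gamma> < 2"
    and H0_smooth: "smooth_on UNIV (\<lambda>(x, p). H0 x p)"
    and H0_convex: "\<forall>x p \<xi>. \<xi> \<noteq> 0 \<longrightarrow> \<xi> \<bullet> (hessian (H0 x) p *v \<xi>) > 0"
    and H0_\<alpha>: "\<forall>x p. p \<noteq> 0 \<longrightarrow>
      grad (H0 x) p \<bullet> p - H0 x p > \<alpha> / 4 * (p \<bullet> (hessian (H0 x) p *v p))"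
    and V_mono: "\<forall>x. strict_mono (V x)"
  shows "\<exists>T0>0. T0 \<le> Tb \<and> (\<forall>T. 0 < T \<and> T \<le> T0 \<longrightarrow>
    (\<exists>u m :: real ^ 'n \<Rightarrow> real \<Rightarrow> real.
      (\<forall>t\<in>{0..T}. torus_periodic (\<lambda>x. u x t) \<and> torus_periodic (\<lambda>x. m x t)) \<and>
      smooth_on (UNIV \<times> {0..T}) (\<lambda>(x, t). u x t) \<and>
      smooth_on (UNIV \<times> {0..T}) (\<lambda>(x, t). m x t) \<and>
      (\<forall>x. \<forall>t\<in>{0..T}. m x t > 0) \<and>
      (\<forall>x. \<forall>t\<in>{0..T}.
         - vector_derivative (\<lambda>s. u x s) (at t within {0..T})
         - laplacian (\<lambda>y. u y t) x
         + m x t powr \<alpha> * H0 x (grad (\<lambda>y. u y t) x /\<^sub>R (m x t powr \<alpha>))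
         + b x t \<bullet> grad (\<lambda>y. u y t) x
         = V x (m x t)) \<and>
      (\<forall>x. \<forall>t\<in>{0..T}.
         vector_derivative (\<lambda>s. m x s) (at t within {0..T})
         - laplacian (\<lambda>y. m y t) x
         - divergence (\<lambda>y. m y t *\<^sub>R
             grad (H0 y) (grad (\<lambda>z. u z t) y /\<^sub>R (m y t powr \<alpha>))) x
         - divergence (\<lambda>y. m y t *\<^sub>R b y t) x
         = 0) \<and>
      (\<forall>x. u x T = \<Psi> x \<and> m x 0 = m0 x)))"
proof -
  obtain k0 where k0: "0 < k0" "\<And>x. k0 \<le> m0 x" using m0_pos by blast
  define h where "h p = H0 (fst p) (snd p)" for p
  define B where "B p = b (fst p) (snd p)" for p
  define W where "W p = V (fst p) (snd p)" for p
  have h: "h \<in> Cinf UNIV"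
    using smooth_on_imp_Cinf[OF H0_smooth, of 1] by (simp add: h_def[abs_def] case_prod_unfold)
  have W: "W \<in> Cinf UNIV"
    using smooth_on_imp_Cinf[OF V_smooth(1), of 1] by (simp add: W_def[abs_def] case_prod_unfold)
  have B: "(\<lambda>p. B p \<bullet> c) \<in> Cinf (strip Tb)" for c
    using smooth_on_imp_Cinf[OF b_smooth(1), of c] by (simp add: B_def case_prod_unfold)
  have \<Psi>: "\<Psi> \<in> Cinf UNIV" and m0: "m0 \<in> Cinf UNIV"
    using smooth_on_imp_Cinf[OF \<Psi>_smooth(1), of 1] smooth_on_imp_Cinf[OF m0_smooth, of 1] by simp_all
  obtain h' where h': "deriv_along UNIV UNIV h h'"
  proof (rule smooth_class_derivative[OF thick_open[OF open_UNIV] falg_cont_class UNIV_I h]) qed (rule that)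
  have gradH: "grad (H0 x) p = (\<chi> i. h' (x, p) (0, axis i 1))" for x p
    using grad_partial[OF h', of x p] by (simp add: h_def)
  \<comment> \<open>The Legendre transform acts only on \<open>v\<close>, so \<open>H0\<close> inherits the periodicity of \<open>L0\<close>.\<close>
  have H0_per: "H0 (x + k) = H0 x" if "\<forall>i. k $ i \<in> \<int>" for x k
  proof -
    have "L0 (x + k) = L0 x" using L0_torus that unfolding torus_periodic_def by blast
    then show ?thesis unfolding H0_def legendre_def by simp
  qed

  \<comment> \<open>The equations as \<open>- u\<^sub>t - \<Delta>u = N1\<close> and \<open>m\<^sub>t - \<Delta>m = div N2\<close>.\<close>
  define N1 where "N1 = (\<lambda>(x, t, m, w). V x m - m powr \<alpha> * H0 x (w /\<^sub>R (m powr \<alpha>)) - b x t \<bullet> w)"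
  define N2 where "N2 = (\<lambda>(x, t, m, w). m *\<^sub>R grad (H0 x) (w /\<^sub>R (m powr \<alpha>)) + m *\<^sub>R b x t)"
  have N1: "N1 \<in> Cinf (state_domain Tb)"
    using mfg_nonlinearities_smooth(1)[OF Tb h h' B W, of \<alpha>] by (simp add: N1_def W_def h_def B_def)
  have N2: "(\<lambda>q. N2 q $ i) \<in> Cinf (state_domain Tb)" for i
    using mfg_nonlinearities_smooth(2)[OF Tb h h' B W, of \<alpha> "(0, axis i 1)" i]
    by (simp add: N2_def gradH B_def case_prod_unfold)
  have per1: "torus_periodic (\<lambda>x. N1 (x, c))" if "c \<in> {0..Tb} \<times> {0<..} \<times> UNIV" for c
    using that H0_per V_torus b_torus unfolding torus_periodic_def N1_def by auto
  have per2: "torus_periodic (\<lambda>x. N2 (x, c))" if "c \<in> {0..Tb} \<times> {0<..} \<times> UNIV" for c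
    using that H0_per b_torus unfolding torus_periodic_def N2_def by auto
  have "\<exists>T0>0. T0 \<le> Tb \<and> (\<forall>T. 0 < T \<and> T \<le> T0 \<longrightarrow>
      (\<exists>u m w. classical_solution T N1 N2 \<Psi> m0 u m w \<and> (\<forall>x. \<forall>t\<in>{0..T}. 0 < m (x, t))))"
    by (rule short_time_system[OF Tb N1 N2 per1 per2 m0 m0_torus k0 \<Psi> \<Psi>_torus])
  then obtain T0 where T0: "0 < T0" "T0 \<le> Tb" and ex: "\<And>T. 0 < T \<and> T \<le> T0 \<Longrightarrow>
      \<exists>u m w. classical_solution T N1 N2 \<Psi> m0 u m w \<and> (\<forall>x. \<forall>t\<in>{0..T}. 0 < m (x, t))"
    by blast
  show ?thesis
  proof (rule exI[of _ T0], intro conjI allI impI T0)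
    fix T assume T: "0 < T \<and> T \<le> T0"
    then have T': "0 < T" "T \<le> Tb" using T0 by auto
    obtain u m w where "classical_solution T N1 N2 \<Psi> m0 u m w" and pos: "\<And>x t. t \<in> {0..T} \<Longrightarrow> 0 < m (x, t)"
      using ex[OF T] by blast
    then obtain W D DM D2 where sol: "cper {0..T} u" "cper {0..T} m" "u \<in> Cinf (strip T)" "m \<in> Cinf (strip T)"
      "xderiv T u (\<lambda>p v. w p \<bullet> v)" "xderiv T w W" "xderiv T m (\<lambda>p v. D p \<bullet> v)" "xderiv T D DM"
      "xderiv T (\<lambda>p. N2 (fst p, snd p, m p, w p)) D2"
      "tderiv T u (\<lambda>p. - (\<Sum>i\<in>UNIV. W p (axis i 1) $ i) - N1 (fst p, snd p, m p, w p))"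
      "tderiv T m (\<lambda>p. (\<Sum>i\<in>UNIV. DM p (axis i 1) $ i) + (\<Sum>i\<in>UNIV. D2 p (axis i 1) $ i))"
      "\<forall>x. u (x, T) = \<Psi> x" "\<forall>x. m (x, 0) = m0 x"
      unfolding classical_solution_def by (elim exE conjE) (rule that)
    define uu mm where "uu x t = u (x, t)" and "mm x t = m (x, t)" for x t
    have per: "torus_periodic (\<lambda>x. uu x t) \<and> torus_periodic (\<lambda>x. mm x t)" if "t \<in> {0..T}" for t
      using sol(1,2) that unfolding cper_def torus_periodic_def uu_def mm_def by blast
    have smooth: "smooth_on (UNIV \<times> {0..T}) (\<lambda>(x, t). uu x t)" "smooth_on (UNIV \<times> {0..T}) (\<lambda>(x, t). mm x t)"
      using Cinf_imp_smooth_on[OF thick_strip[OF T'(1)] sol(3)] Cinf_imp_smooth_on[OF thick_strip[OF T'(1)] sol(4)]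
      by (simp_all add: uu_def mm_def)
    have gu: "grad (\<lambda>y. uu y t) x = w (x, t)" if "t \<in> {0..T}" for x t
      unfolding uu_def by (rule grad_eqI) (use sol(5) that in \<open>simp add: xderiv_def\<close>)
    have gm: "grad (\<lambda>y. mm y t) x = D (x, t)" if "t \<in> {0..T}" for x t
      unfolding mm_def by (rule grad_eqI) (use sol(7) that in \<open>simp add: xderiv_def\<close>)
    have lu: "laplacian (\<lambda>y. uu y t) x = (\<Sum>i\<in>UNIV. W (x, t) (axis i 1) $ i)" if t: "t \<in> {0..T}" for x t
    proof -
      have "grad (\<lambda>y. uu y t) = (\<lambda>x. w (x, t))" using gu[OF t] by (rule ext)
      then show ?thesis
        unfolding laplacian_def using sol(6) t by (intro divergence_eqI) (simp add: xderiv_def)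
    qed
    have lm: "laplacian (\<lambda>y. mm y t) x = (\<Sum>i\<in>UNIV. DM (x, t) (axis i 1) $ i)" if t: "t \<in> {0..T}" for x t
    proof -
      have "grad (\<lambda>y. mm y t) = (\<lambda>x. D (x, t))" using gm[OF t] by (rule ext)
      then show ?thesis
        unfolding laplacian_def using sol(8) t by (intro divergence_eqI) (simp add: xderiv_def)
    qed
    have tu: "vector_derivative (\<lambda>s. uu x s) (at t within {0..T}) =
      - (\<Sum>i\<in>UNIV. W (x, t) (axis i 1) $ i) - N1 (x, t, m (x, t), w (x, t))" if t: "t \<in> {0..T}" for x t
      unfolding uu_def
      by (rule vector_derivative_within_cbox[of 0 T, unfolded box_real])
        (use sol(10) t T'(1) in \<open>simp_all add: tderiv_def\<close>)
    have tm: "vector_derivative (\<lambda>s. mm x s) (at t within {0..T}) =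
      (\<Sum>i\<in>UNIV. DM (x, t) (axis i 1) $ i) + (\<Sum>i\<in>UNIV. D2 (x, t) (axis i 1) $ i)" if t: "t \<in> {0..T}" for x t
      unfolding mm_def
      by (rule vector_derivative_within_cbox[of 0 T, unfolded box_real])
        (use sol(11) t T'(1) in \<open>simp_all add: tderiv_def\<close>)
    \<comment> \<open>\<open>N2\<close> and the drift part \<open>m b\<close> are differentiable, hence so is the Hamiltonian part, and the
      divergence of \<open>N2\<close> splits into the two divergences of the equation.\<close>
    have divs: "divergence (\<lambda>y. mm y t *\<^sub>R grad (H0 y) (grad (\<lambda>z. uu z t) y /\<^sub>R (mm y t powr \<alpha>))) x
       + divergence (\<lambda>y. mm y t *\<^sub>R b y t) x = (\<Sum>i\<in>UNIV. D2 (x, t) (axis i 1) $ i)" if t: "t \<in> {0..T}" for x t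
    proof -
      have "(\<lambda>(x, t). b x t) differentiable (at (x, t) within UNIV \<times> {0..Tb})"
        using b_smooth(1)[unfolded smooth_on_def, rule_format, of "[]"] t T'(2) by (simp add: differentiable_on_def)
      then obtain b' where "((\<lambda>(x, t). b x t) has_derivative b') (at (x, t) within UNIV \<times> {0..Tb})"
        unfolding differentiable_def by blast
      then have b': "((\<lambda>(x, t). b x t) has_derivative b') (at (x, t) within range (\<lambda>y. (y, t)))"
        by (rule has_derivative_subset) (use t T'(2) in auto)
      have "((\<lambda>y. (y, t)) has_derivative (\<lambda>v. (v, 0))) (at x)" by (auto intro!: derivative_eq_intros)
      from has_derivative_in_compose[OF this b']
      have bx: "((\<lambda>y. b y t) has_derivative (\<lambda>v. b' (v, 0))) (at x)" by simp
      have "((\<lambda>y. mm y t) has_derivative (\<lambda>v. D (x, t) \<bullet> v)) (at x)"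
        unfolding mm_def using sol(7) t by (simp add: xderiv_def)
      from has_derivative_scaleR[OF this bx]
      obtain E where E: "((\<lambda>y. mm y t *\<^sub>R b y t) has_derivative E) (at x)" by blast
      have "((\<lambda>y. N2 (y, t, m (y, t), w (y, t))) has_derivative D2 (x, t)) (at x)"
        using sol(9) t by (simp add: xderiv_def)
      from has_derivative_diff[OF this E]
      have "((\<lambda>y. mm y t *\<^sub>R grad (H0 y) (grad (\<lambda>z. uu z t) y /\<^sub>R (mm y t powr \<alpha>)))
          has_derivative (\<lambda>v. D2 (x, t) v - E v)) (at x)"
        by (simp add: N2_def gu[OF t] mm_def)
      from divergence_eqI[OF this] divergence_eqI[OF E] show ?thesis by (simp add: sum_subtractf)
    qed
    show "\<exists>u m :: real ^ 'n \<Rightarrow> real \<Rightarrow> real.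
      (\<forall>t\<in>{0..T}. torus_periodic (\<lambda>x. u x t) \<and> torus_periodic (\<lambda>x. m x t)) \<and>
      smooth_on (UNIV \<times> {0..T}) (\<lambda>(x, t). u x t) \<and>
      smooth_on (UNIV \<times> {0..T}) (\<lambda>(x, t). m x t) \<and>
      (\<forall>x. \<forall>t\<in>{0..T}. m x t > 0) \<and>
      (\<forall>x. \<forall>t\<in>{0..T}.
         - vector_derivative (\<lambda>s. u x s) (at t within {0..T})
         - laplacian (\<lambda>y. u y t) x
         + m x t powr \<alpha> * H0 x (grad (\<lambda>y. u y t) x /\<^sub>R (m x t powr \<alpha>))
         + b x t \<bullet> grad (\<lambda>y. u y t) x
         = V x (m x t)) \<and>
      (\<forall>x. \<forall>t\<in>{0..T}.
         vector_derivative (\<lambda>s. m x s) (at t within {0..T})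
         - laplacian (\<lambda>y. m y t) x
         - divergence (\<lambda>y. m y t *\<^sub>R
             grad (H0 y) (grad (\<lambda>z. u z t) y /\<^sub>R (m y t powr \<alpha>))) x
         - divergence (\<lambda>y. m y t *\<^sub>R b y t) x
         = 0) \<and>
      (\<forall>x. u x T = \<Psi> x \<and> m x 0 = m0 x)"
    proof (rule exI[of _ uu], rule exI[of _ mm], intro conjI ballI allI smooth)
      fix x t assume t: "t \<in> {0..T}"
      show "torus_periodic (\<lambda>x. uu x t)" "torus_periodic (\<lambda>x. mm x t)" using per[OF t] by auto
      show "0 < mm x t" using pos[OF t] by (simp add: mm_def)
      show "- vector_derivative (\<lambda>s. uu x s) (at t within {0..T}) - laplacian (\<lambda>y. uu y t) x
         + mm x t powr \<alpha> * H0 x (grad (\<lambda>y. uu y t) x /\<^sub>R (mm x t powr \<alpha>)) + b x t \<bullet> grad (\<lambda>y. uu y t) x = V x (mm x t)"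
        unfolding tu[OF t] lu[OF t] gu[OF t] by (simp add: N1_def mm_def)
      show "vector_derivative (\<lambda>s. mm x s) (at t within {0..T}) - laplacian (\<lambda>y. mm y t) x
         - divergence (\<lambda>y. mm y t *\<^sub>R grad (H0 y) (grad (\<lambda>z. uu z t) y /\<^sub>R (mm y t powr \<alpha>))) x
         - divergence (\<lambda>y. mm y t *\<^sub>R b y t) x = 0"
        unfolding tm[OF t] lm[OF t] using divs[OF t, of x] by linarith
    next
      fix x show "uu x T = \<Psi> x" "mm x 0 = m0 x" using sol(12) sol(13) by (simp_all add: uu_def mm_def)
    qed
  qed
qed

end
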